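(* For $i=1,2$, let $\Lambda_i\subset(0,\infty)$ be a finitely generated multiplicative subgroup and let $\Gamma_i\subset\mathbb{R}$ be a countable $\mathbb{Z}\Lambda_i$-module which is dense in $\mathbb{R}$. Suppose $\operatorname{rank}\Gamma_i\geq2$ for $i=1,2$. Let $\mathcal{S}_i:=\mathcal{S}(\Gamma_i,\Lambda_i)$ be the Stein groupoids. The following are equivalent. (1) $\mathcal{S}_1$ and $\mathcal{S}_2$ are isomorphic. (2) $\Lambda_1=\Lambda_2$ and there exists $s>0$ such that $\Gamma_1=s\Gamma_2$. (3) $(\Gamma_1\rtimes\Lambda_1)\curvearrowright\mathbb{R}_{\Gamma_1}$ and $(\Gamma_2\rtimes\Lambda_2)\curvearrowright\mathbb{R}_{\Gamma_2}$ are conjugate.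
   Context: "$\Gamma\subset\mathbb{R}$ is a $\mathbb{Z}\Lambda$-module" means that $\Gamma$ is an additive subgroup of $\mathbb{R}$ with $\lambda\Gamma\subset\Gamma$ for all $\lambda\in\Lambda$. $\operatorname{rank}\Gamma:=\dim_{\mathbb{Q}}(\Gamma\otimes\mathbb{Q})$ (possibly infinite). The space $\mathbb{R}_\Gamma$: as a set $\mathbb{R}_\Gamma=(\mathbb{R}\setminus\Gamma)\sqcup\{t_+,t_-\mid t\in\Gamma\}$, with the canonical surjection $q:\mathbb{R}_\Gamma\to\mathbb{R}$ ($q(t_\pm)=t$, $q(x)=x$ for $x\notin\Gamma$), the total order such that $q(x)<q(y)$ implies $x<y$ and $t_-<t_+$ for $t\in\Gamma$, and the order topology. It is totally disconnected and locally compact Hausdorff; the sets $[t_+,s_-]$ ($t<s$ in $\Gamma$) are compact open and form a basis. The group $\Gamma\rtimes\Lambda$ (with $(s,\lambda)(s',\lambda')=(s+\lambda s',\lambda\lambda')$) acts on $\mathbb{R}_\Gamma$ by $(s,\lambda)\cdot x=\lambda x+s$ for $x\in\mathbb{R}\setminus\Gamma$ and $(s,\lambda)\cdot t_\pm=(\lambda t+s)_\pm$. For an action of a discrete group $G$ on $X$, the transformation groupoid $X\rtimes G$ is $X\times G$ with the product topology, unit space $X$ (identified with $X\times\{1\}$), $r(x,\gamma)=x$, $s(x,\gamma)=\gamma^{-1}x$, $(x,\gamma)(\gamma^{-1}x,\gamma')=(x,\gamma\gamma')$. The Stein groupoid is $\mathcal{S}(\Gamma,\Lambda):=\mathbb{R}_\Gamma\rtimes(\Gamma\rtimes\Lambda)$.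 Isomorphism of groupoids means isomorphism of topological (étale) groupoids. Two actions $G_i\curvearrowright X_i$ are conjugate if there are a group isomorphism $\theta:G_1\to G_2$ and a homeomorphism $h:X_1\to X_2$ with $h(gx)=\theta(g)h(x)$ for all $g\in G_1$, $x\in X_1$. *)

theory Defs
  imports
    "HOL-Analysis.Analysis"
    "HOL-Algebra.Free_Abelian_Groups"
    "HOL-Library.Extended_Nat"
    "Jordan_Normal_Form.Missing_VectorSpace"
begin

section \<open>Rank of an abelian group\<close>

definition additive_group :: "'a::ab_group_add monoid" where
  "additive_group = \<lparr>carrier = UNIV, monoid.mult = (+), one = 0\<rparr>"

definition positive_reals :: "real monoid" where
  "positive_reals = \<lparr>carrier = {0<..}, monoid.mult = (*), one = 1\<rparr>"

definition rat_ring :: "rat ring" where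
  "rat_ring = \<lparr>carrier = UNIV, monoid.mult = (*), one = 1, zero = 0, add = (+)\<rparr>"

text \<open>The tensor product over the integers of two abelian groups, as the free abelian group on
  the pairs modulo biadditivity. Balancedness over the integers follows from biadditivity.\<close>

definition tensor_relations ::
  "('a, 'm) monoid_scheme \<Rightarrow> ('b, 'n) monoid_scheme \<Rightarrow> ('a \<times> 'b \<Rightarrow>\<^sub>0 int) set" where
  "tensor_relations A B =
    {frag_of (a \<otimes>\<^bsub>A\<^esub> a', b) - frag_of (a, b) - frag_of (a', b) |a a' b.
       a \<in> carrier A \<and> a' \<in> carrier A \<and> b \<in> carrier B} \<union>
    {frag_of (a, b \<otimes>\<^bsub>B\<^esub> b') - frag_of (a, b) - frag_of (a, b') |a b b'.
       a \<in> carrier A \<and> b \<in> carrier B \<and> b' \<in> carrier B}"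

definition tensor_kernel ::
  "('a, 'm) monoid_scheme \<Rightarrow> ('b, 'n) monoid_scheme \<Rightarrow> ('a \<times> 'b \<Rightarrow>\<^sub>0 int) set" where
  "tensor_kernel A B =
    generate (free_Abelian_group (carrier A \<times> carrier B)) (tensor_relations A B)"

definition tensor_group ::
  "('a, 'm) monoid_scheme \<Rightarrow> ('b, 'n) monoid_scheme \<Rightarrow> ('a \<times> 'b \<Rightarrow>\<^sub>0 int) set monoid" where
  "tensor_group A B = free_Abelian_group (carrier A \<times> carrier B) Mod tensor_kernel A B"

text \<open>\<open>A \<otimes> \<rat>\<close> as a rational vector space, with \<open>q \<cdot> (a \<otimes> r) = a \<otimes> q r\<close>. In the scalar
  multiplication all members of the union coincide. The fields \<open>mult\<close> and \<open>one\<close>, which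
  the record type inherits from rings, play no role in a module.\<close>

definition rationalization ::
  "('a, 'm) monoid_scheme \<Rightarrow> (rat, ('a \<times> rat \<Rightarrow>\<^sub>0 int) set) module" where
  "rationalization A =
    \<lparr>carrier = carrier (tensor_group A additive_group),
     monoid.mult = undefined,
     one = undefined,
     zero = \<one>\<^bsub>tensor_group A additive_group\<^esub>,
     add = (\<lambda>x y. x \<otimes>\<^bsub>tensor_group A additive_group\<^esub> y),
     smult = (\<lambda>q x. \<Union>f\<in>x. tensor_kernel A additive_group
        #>\<^bsub>free_Abelian_group (carrier A \<times> UNIV)\<^esub> frag_extend (\<lambda>(a, r). frag_of (a, q * r)) f)\<rparr>"

definition abelian_rank :: "('a, 'm) monoid_scheme \<Rightarrow> enat" where
  "abelian_rank A =
    (if vectorspace.fin_dim rat_ring (rationalization A)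
     then enat (vectorspace.dim rat_ring (rationalization A))
     else \<infinity>)"


section \<open>The modules \<open>\<Gamma>\<close> over \<open>\<int>\<Lambda>\<close>\<close>

definition finitely_generated_subgroup :: "'a set \<Rightarrow> ('a, 'm) monoid_scheme \<Rightarrow> bool" where
  "finitely_generated_subgroup H G \<longleftrightarrow>
    subgroup H G \<and> (\<exists>S. finite S \<and> S \<subseteq> carrier G \<and> H = generate G S)"

definition is_Z\<Lambda>_module :: "real set \<Rightarrow> real set \<Rightarrow> bool" where
  "is_Z\<Lambda>_module \<Lambda> \<Gamma> \<longleftrightarrow>
    subgroup \<Gamma> additive_group \<and> (\<forall>l\<in>\<Lambda>. (*) l ` \<Gamma> \<subseteq> \<Gamma>)"

definition module_rank :: "real set \<Rightarrow> enat" where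
  "module_rank \<Gamma> = abelian_rank (additive_group\<lparr>carrier := \<Gamma>\<rparr>)"


section \<open>The space \<open>\<real>\<^sub>\<Gamma>\<close>\<close>

datatype stein_point = Pt real | Minus real | Plus real

definition stein_set :: "real set \<Rightarrow> stein_point set" where
  "stein_set \<Gamma> = Pt ` (- \<Gamma>) \<union> Minus ` \<Gamma> \<union> Plus ` \<Gamma>"

primrec stein_proj :: "stein_point \<Rightarrow> real" where
  "stein_proj (Pt x) = x"
| "stein_proj (Minus t) = t"
| "stein_proj (Plus t) = t"

definition stein_less :: "stein_point \<Rightarrow> stein_point \<Rightarrow> bool" where
  "stein_less x y \<longleftrightarrow>
    stein_proj x < stein_proj y \<or> (\<exists>t. x = Minus t \<and> y = Plus t)"

definition order_topology_on :: "'a set \<Rightarrow> ('a \<Rightarrow> 'a \<Rightarrow> bool) \<Rightarrow> 'a topology" where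
  "order_topology_on X lt =
    topology_generated_by
      (insert X ({{y \<in> X. lt y a} |a. a \<in> X} \<union> {{y \<in> X. lt a y} |a. a \<in> X}))"

definition stein_space :: "real set \<Rightarrow> stein_point topology" where
  "stein_space \<Gamma> = order_topology_on (stein_set \<Gamma>) stein_less"


section \<open>The action of \<open>\<Gamma> \<rtimes> \<Lambda>\<close>\<close>

definition affine_group :: "real set \<Rightarrow> real set \<Rightarrow> (real \<times> real) monoid" where
  "affine_group \<Gamma> \<Lambda> =
    \<lparr>carrier = \<Gamma> \<times> \<Lambda>,
     monoid.mult = (\<lambda>(s, l) (s', l'). (s + l * s', l * l')),
     one = (0, 1)\<rparr>"

primrec stein_action :: "real \<times> real \<Rightarrow> stein_point \<Rightarrow> stein_point" where
  "stein_action g (Pt x) = Pt (snd g * x + fst g)"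
| "stein_action g (Minus t) = Minus (snd g * t + fst g)"
| "stein_action g (Plus t) = Plus (snd g * t + fst g)"

definition conjugate_actions ::
  "('g, 'm) monoid_scheme \<Rightarrow> 'x topology \<Rightarrow> ('g \<Rightarrow> 'x \<Rightarrow> 'x) \<Rightarrow>
   ('h, 'n) monoid_scheme \<Rightarrow> 'y topology \<Rightarrow> ('h \<Rightarrow> 'y \<Rightarrow> 'y) \<Rightarrow> bool" where
  "conjugate_actions G X act H Y act' \<longleftrightarrow>
    (\<exists>\<theta> h. \<theta> \<in> iso G H \<and> homeomorphic_map X Y h \<and>
      (\<forall>g\<in>carrier G. \<forall>x\<in>topspace X. h (act g x) = act' (\<theta> g) (h x)))"


section \<open>Topological groupoids\<close>

text \<open>A groupoid is given by its space of arrows; units are particular arrows, and the product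
  \<open>gmult G g h\<close> is only meaningful if \<open>gsource G g = grange G h\<close>.\<close>

record 'a top_groupoid =
  arrows :: "'a topology"
  gunits :: "'a set"
  grange :: "'a \<Rightarrow> 'a"
  gsource :: "'a \<Rightarrow> 'a"
  gmult :: "'a \<Rightarrow> 'a \<Rightarrow> 'a"

definition groupoid_hom :: "'a top_groupoid \<Rightarrow> 'b top_groupoid \<Rightarrow> ('a \<Rightarrow> 'b) \<Rightarrow> bool" where
  "groupoid_hom G H \<phi> \<longleftrightarrow>
    \<phi> ` topspace (arrows G) \<subseteq> topspace (arrows H) \<and>
    \<phi> ` gunits G \<subseteq> gunits H \<and>
    (\<forall>g\<in>topspace (arrows G).
      \<phi> (grange G g) = grange H (\<phi> g) \<and> \<phi> (gsource G g) = gsource H (\<phi> g)) \<and>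
    (\<forall>g\<in>topspace (arrows G). \<forall>h\<in>topspace (arrows G).
      gsource G g = grange G h \<longrightarrow> \<phi> (gmult G g h) = gmult H (\<phi> g) (\<phi> h))"

definition isomorphic_top_groupoids :: "'a top_groupoid \<Rightarrow> 'b top_groupoid \<Rightarrow> bool" where
  "isomorphic_top_groupoids G H \<longleftrightarrow>
    (\<exists>\<phi> \<psi>. homeomorphic_maps (arrows G) (arrows H) \<phi> \<psi> \<and>
      groupoid_hom G H \<phi> \<and> groupoid_hom H G \<psi>)"

definition transformation_groupoid ::
  "('g, 'm) monoid_scheme \<Rightarrow> 'x topology \<Rightarrow> ('g \<Rightarrow> 'x \<Rightarrow> 'x) \<Rightarrow> ('x \<times> 'g) top_groupoid" where
  "transformation_groupoid G X act =
    \<lparr>arrows = prod_topology X (discrete_topology (carrier G)),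
     gunits = topspace X \<times> {\<one>\<^bsub>G\<^esub>},
     grange = (\<lambda>(x, g). (x, \<one>\<^bsub>G\<^esub>)),
     gsource = (\<lambda>(x, g). (act (inv\<^bsub>G\<^esub> g) x, \<one>\<^bsub>G\<^esub>)),
     gmult = (\<lambda>(x, g) (y, h). (x, g \<otimes>\<^bsub>G\<^esub> h))\<rparr>"

definition stein_groupoid ::
  "real set \<Rightarrow> real set \<Rightarrow> (stein_point \<times> real \<times> real) top_groupoid" where
  "stein_groupoid \<Gamma> \<Lambda> =
    transformation_groupoid (affine_group \<Gamma> \<Lambda>) (stein_space \<Gamma>) stein_action"

end

theory Submission
  imports Defs
begin

text \<open>
The point of the theorem is that an isomorphism of Stein groupoids determines \<open>\<Lambda>\<close> and, up to a
positive factor, \<open>\<Gamma>\<close>. An isomorphism amounts to a homeomorphism \<open>h\<close> between the spaces together with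
a locally constant cocycle \<open>C\<close> such that \<open>h (g x) = C(g, x) h x\<close>. The map \<open>h\<close> need not respect the
order, nor \<open>C\<close> the subgroup of translations. What can be followed through \<open>h\<close> is measure: Lebesgue
measure of the second space, pulled back along \<open>h\<close>, is multiplied under \<open>g\<close> by the dilation component
of \<open>C\<close>, and the measures of compact open sets recover \<open>\<Gamma>\<close>.

Suppose that on translations this dilation component is a coboundary \<open>exp (F (g x) - F x)\<close>. Then the
density \<open>exp (- F)\<close> makes the pulled back measure translation invariant, hence a multiple of
Lebesgue measure. Comparing measures of small cells at \<open>0\<^sub>+\<close>, which every dilation fixes, gives
\<open>\<Lambda>\<^sub>1 \<subseteq> \<Lambda>\<^sub>2\<close>; comparing measures of compact open sets gives \<open>k \<Gamma>\<^sub>1 \<subseteq> \<Gamma>\<^sub>2\<close>, with equality if also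
\<open>\<Lambda>\<^sub>2 \<subseteq> \<Lambda>\<^sub>1\<close>. This is the theorem \<open>rigidity\<close>; applied to the inverse isomorphism as well, it yields
the claim.

That the cocycle is a coboundary comes from the rank. If \<open>e\<close> and \<open>\<alpha>\<close> in \<open>\<Gamma>\<close> are rationally
independent, \<open>translation_cocycle_trivial\<close> shows that every locally constant real cocycle over the
translations is a coboundary plus a homomorphism \<open>\<rho>\<close>. Modulo the period \<open>e\<close>, the jumps of the cocycle
are the differences of a function on \<open>\<Gamma>\<close> modulo \<open>e\<close> that each translation changes at finitely many
points. On the orbits of the irrational rotation by \<open>\<alpha>\<close> this function has limits at both ends, the
same for all orbits, and they agree because the jumps around the circle cancel. So the function is
constant up to finitely many points, and it is realised by the jumps of a locally constant
function. The homomorphism \<open>\<rho>\<close> is excluded by \<open>drift_zero\<close>: if \<open>\<Lambda>\<^sub>1\<close> contains some \<open>l \<noteq> 1\<close>, then \<open>\<rho>\<close>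
vanishes on the dense subgroup \<open>(l - 1) \<Gamma>\<^sub>1\<close>, and a nonzero \<open>\<rho>\<close> would make bounded translations
enlarge the measure of a cell without bound. If \<open>\<Lambda>\<^sub>2\<close> is trivial, so is the cocycle. There
remains the case that \<open>\<Lambda>\<^sub>1\<close> is trivial and \<open>\<Lambda>\<^sub>2\<close> is not; there the argument applies to the inverse
isomorphism and gives the contradiction \<open>\<Lambda>\<^sub>2 \<subseteq> \<Lambda>\<^sub>1\<close>.

Conversely, a dilation by \<open>1 / s\<close> conjugates the two actions if \<open>\<Gamma>\<^sub>1 = s \<Gamma>\<^sub>2\<close>, and conjugate
actions have isomorphic transformation groupoids.
\<close>

section \<open>Neighbourhoods in the split line\<close>

text \<open>The order topology has, at a point off \<open>\<Gamma>\<close>, the usual two-sided neighbourhoods, and at \<open>t\<^sub>-\<close> and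
\<open>t\<^sub>+\<close> the one-sided ones that contain no part of the other side. This \<open>\<epsilon>\<close>-form of the topology is
what all continuity arguments use.\<close>

primrec stein_near :: "real \<Rightarrow> stein_point \<Rightarrow> stein_point \<Rightarrow> bool" where
  "stein_near \<epsilon> (Pt r) z \<longleftrightarrow> \<bar>stein_proj z - r\<bar> < \<epsilon>"
| "stein_near \<epsilon> (Minus t) z \<longleftrightarrow> z = Minus t \<or> (t - \<epsilon> < stein_proj z \<and> stein_proj z < t)"
| "stein_near \<epsilon> (Plus t) z \<longleftrightarrow> z = Plus t \<or> (t < stein_proj z \<and> stein_proj z < t + \<epsilon>)"

lemma stein_near_refl [simp]: "\<epsilon> > 0 \<Longrightarrow> stein_near \<epsilon> x x"
  by (cases x) auto

lemma stein_near_mono: "stein_near \<epsilon> x z \<Longrightarrow> \<epsilon> \<le> \<delta> \<Longrightarrow> stein_near \<delta> x z"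
  by (cases x) auto

lemma stein_near_proj: "stein_near \<epsilon> x z \<Longrightarrow> \<epsilon> > 0 \<Longrightarrow> \<bar>stein_proj z - stein_proj x\<bar> < \<epsilon>"
  by (cases x) auto

lemma stein_set_simps [simp]:
  "Pt r \<in> stein_set \<Gamma> \<longleftrightarrow> r \<notin> \<Gamma>"
  "Minus r \<in> stein_set \<Gamma> \<longleftrightarrow> r \<in> \<Gamma>"
  "Plus r \<in> stein_set \<Gamma> \<longleftrightarrow> r \<in> \<Gamma>"
  by (auto simp: stein_set_def)

lemma stein_set_cases:
  assumes "x \<in> stein_set \<Gamma>"
  obtains r where "x = Pt r" "r \<notin> \<Gamma>" | t where "x = Minus t" "t \<in> \<Gamma>" | t where "x = Plus t" "t \<in> \<Gamma>"
  using assms by (cases x) auto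

lemma stein_less_simps:
  "stein_less x (Pt r) \<longleftrightarrow> stein_proj x < r"
  "stein_less x (Minus r) \<longleftrightarrow> stein_proj x < r"
  "stein_less x (Plus r) \<longleftrightarrow> stein_proj x < r \<or> x = Minus r"
  "stein_less (Pt r) x \<longleftrightarrow> r < stein_proj x"
  "stein_less (Minus r) x \<longleftrightarrow> r < stein_proj x \<or> x = Plus r"
  "stein_less (Plus r) x \<longleftrightarrow> r < stein_proj x"
  by (auto simp: stein_less_def)

abbreviation stein_open :: "real set \<Rightarrow> stein_point set \<Rightarrow> bool" where
  "stein_open \<Gamma> \<equiv> openin (stein_space \<Gamma>)"

lemma topspace_order_topology_on [simp]: "topspace (order_topology_on X lt) = X"
  unfolding order_topology_on_def topology_generated_by_topspace by auto

lemma topspace_stein_space [simp]: "topspace (stein_space \<Gamma>) = stein_set \<Gamma>"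
  by (simp add: stein_space_def)

lemma stein_ray_near:
  assumes "x \<in> stein_set \<Gamma>" "a \<in> stein_set \<Gamma>"
  shows "stein_less x a \<Longrightarrow> \<exists>\<epsilon>>0. \<forall>z\<in>stein_set \<Gamma>. stein_near \<epsilon> x z \<longrightarrow> stein_less z a"
    and "stein_less a x \<Longrightarrow> \<exists>\<epsilon>>0. \<forall>z\<in>stein_set \<Gamma>. stein_near \<epsilon> x z \<longrightarrow> stein_less a z"
proof -
  define \<epsilon> where "\<epsilon> = (if stein_proj x = stein_proj a then 1 else \<bar>stein_proj x - stein_proj a\<bar>)"
  have "\<epsilon> > 0" by (auto simp: \<epsilon>_def)
  show "\<exists>\<epsilon>>0. \<forall>z\<in>stein_set \<Gamma>. stein_near \<epsilon> x z \<longrightarrow> stein_less z a" if "stein_less x a"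
  proof (intro exI[of _ \<epsilon>] conjI ballI impI \<open>\<epsilon> > 0\<close>)
    fix z assume "z \<in> stein_set \<Gamma>" "stein_near \<epsilon> x z"
    then show "stein_less z a"
      using that assms
      by (cases a; cases x) (auto simp: stein_less_simps \<epsilon>_def split: if_splits)
  qed
  show "\<exists>\<epsilon>>0. \<forall>z\<in>stein_set \<Gamma>. stein_near \<epsilon> x z \<longrightarrow> stein_less a z" if "stein_less a x"
  proof (intro exI[of _ \<epsilon>] conjI ballI impI \<open>\<epsilon> > 0\<close>)
    fix z assume "z \<in> stein_set \<Gamma>" "stein_near \<epsilon> x z"
    then show "stein_less a z"
      using that assms
      by (cases a; cases x) (auto simp: stein_less_simps \<epsilon>_def split: if_splits)
  qed
qed

lemma dense_between:
  fixes \<Gamma> :: "real set"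
  assumes "closure \<Gamma> = UNIV" "a < b"
  obtains t where "t \<in> \<Gamma>" "a < t" "t < b"
proof -
  have "open {a<..<b}" "{a<..<b} \<noteq> {}" using assms by auto
  then have "\<Gamma> \<inter> {a<..<b} \<noteq> {}"
    using open_Int_closure_eq_empty[of "{a<..<b}" \<Gamma>] assms by auto
  then show ?thesis using that by auto
qed

lemma dense_below:
  fixes \<Gamma> :: "real set"
  assumes "closure \<Gamma> = UNIV" obtains t where "t \<in> \<Gamma>" "t < b"
  using dense_between[OF assms, of "b - 1" b] by auto

lemma dense_above:
  fixes \<Gamma> :: "real set"
  assumes "closure \<Gamma> = UNIV" obtains t where "t \<in> \<Gamma>" "b < t"
  using dense_between[OF assms, of b "b + 1"] by auto

text \<open>Density of \<open>\<Gamma>\<close> supplies, inside every \<open>\<epsilon>\<close>-neighbourhood, points \<open>l\<^sub>+\<close> and \<open>r\<^sub>-\<close> that bound an order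
interval. At \<open>t\<^sub>-\<close> and \<open>t\<^sub>+\<close> the other copy of \<open>t\<close> serves as one of the two bounds.\<close>

lemma openin_stein_space_iff:
  assumes dense: "closure \<Gamma> = UNIV"
  shows "stein_open \<Gamma> U \<longleftrightarrow>
    U \<subseteq> stein_set \<Gamma> \<and> (\<forall>x\<in>U. \<exists>\<epsilon>>0. \<forall>z\<in>stein_set \<Gamma>. stein_near \<epsilon> x z \<longrightarrow> z \<in> U)"
proof (intro iffI conjI)
  assume "stein_open \<Gamma> U"
  then show "U \<subseteq> stein_set \<Gamma>"
    using openin_subset by fastforce
  from \<open>stein_open \<Gamma> U\<close>
  have "generate_topology_on
      (insert (stein_set \<Gamma>) ({{y \<in> stein_set \<Gamma>. stein_less y a} |a. a \<in> stein_set \<Gamma>} \<union>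
         {{y \<in> stein_set \<Gamma>. stein_less a y} |a. a \<in> stein_set \<Gamma>})) U"
    unfolding stein_space_def order_topology_on_def openin_topology_generated_by_iff .
  then show "\<forall>x\<in>U. \<exists>\<epsilon>>0. \<forall>z\<in>stein_set \<Gamma>. stein_near \<epsilon> x z \<longrightarrow> z \<in> U"
  proof induction
    case Empty
    then show ?case by simp
  next
    case (Int a b)
    show ?case
    proof
      fix x assume x: "x \<in> a \<inter> b"
      obtain \<epsilon> where "\<epsilon> > 0" "\<forall>z\<in>stein_set \<Gamma>. stein_near \<epsilon> x z \<longrightarrow> z \<in> a"
        using Int.IH(1) x by blast
      moreover obtain \<delta> where "\<delta> > 0" "\<forall>z\<in>stein_set \<Gamma>. stein_near \<delta> x z \<longrightarrow> z \<in> b"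
        using Int.IH(2) x by blast
      ultimately show "\<exists>\<epsilon>>0. \<forall>z\<in>stein_set \<Gamma>. stein_near \<epsilon> x z \<longrightarrow> z \<in> a \<inter> b"
        using stein_near_mono[of "min \<epsilon> \<delta>" x] by (intro exI[of _ "min \<epsilon> \<delta>"]) auto
    qed
  next
    case (UN K)
    show ?case
    proof
      fix x assume "x \<in> \<Union>K"
      then obtain k where k: "k \<in> K" "x \<in> k" by blast
      then obtain \<epsilon> where "\<epsilon> > 0" "\<forall>z\<in>stein_set \<Gamma>. stein_near \<epsilon> x z \<longrightarrow> z \<in> k"
        using UN.IH by blast
      with k(1) show "\<exists>\<epsilon>>0. \<forall>z\<in>stein_set \<Gamma>. stein_near \<epsilon> x z \<longrightarrow> z \<in> \<Union>K" by blast
    qed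
  next
    case (Basis s)
    show ?case
    proof
      fix x assume x: "x \<in> s"
      consider "s = stein_set \<Gamma>"
        | a where "s = {y \<in> stein_set \<Gamma>. stein_less y a}" "a \<in> stein_set \<Gamma>"
        | a where "s = {y \<in> stein_set \<Gamma>. stein_less a y}" "a \<in> stein_set \<Gamma>"
        using Basis by auto
      then show "\<exists>\<epsilon>>0. \<forall>z\<in>stein_set \<Gamma>. stein_near \<epsilon> x z \<longrightarrow> z \<in> s"
      proof cases
        case 1
        then show ?thesis by (intro exI[of _ 1]) auto
      next
        case 2
        then show ?thesis using stein_ray_near(1)[of x \<Gamma> a] x by auto
      next
        case 3
        then show ?thesis using stein_ray_near(2)[of x \<Gamma> a] x by auto
      qed
    qed
  qed
next
  assume R: "U \<subseteq> stein_set \<Gamma> \<and> (\<forall>x\<in>U. \<exists>\<epsilon>>0. \<forall>z\<in>stein_set \<Gamma>. stein_near \<epsilon> x z \<longrightarrow> z \<in> U)"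
  have left: "stein_open \<Gamma> {y \<in> stein_set \<Gamma>. stein_less y a}" if "a \<in> stein_set \<Gamma>" for a
    unfolding stein_space_def order_topology_on_def
    by (rule topology_generated_by_Basis) (use that in auto)
  have right: "stein_open \<Gamma> {y \<in> stein_set \<Gamma>. stein_less a y}" if "a \<in> stein_set \<Gamma>" for a
    unfolding stein_space_def order_topology_on_def
    by (rule topology_generated_by_Basis) (use that in auto)
  show "stein_open \<Gamma> U"
  proof (subst openin_subopen, intro ballI)
    fix x assume x: "x \<in> U"
    then obtain \<epsilon> where \<epsilon>: "\<epsilon> > 0" "\<forall>z\<in>stein_set \<Gamma>. stein_near \<epsilon> x z \<longrightarrow> z \<in> U"
      using R by blast
    have "\<exists>a b. a \<in> stein_set \<Gamma> \<and> b \<in> stein_set \<Gamma> \<and> stein_less a x \<and> stein_less x b \<and>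
        (\<forall>z\<in>stein_set \<Gamma>. stein_less a z \<longrightarrow> stein_less z b \<longrightarrow> stein_near \<epsilon> x z)"
    proof -
      obtain l where l: "l \<in> \<Gamma>" "stein_proj x - \<epsilon> < l" "l < stein_proj x"
        using dense_between[OF dense, of "stein_proj x - \<epsilon>" "stein_proj x"] \<epsilon> by auto
      obtain r where r: "r \<in> \<Gamma>" "stein_proj x < r" "r < stein_proj x + \<epsilon>"
        using dense_between[OF dense, of "stein_proj x" "stein_proj x + \<epsilon>"] \<epsilon> by auto
      have "x \<in> stein_set \<Gamma>" using x R by auto
      then show ?thesis
      proof (cases rule: stein_set_cases)
        case (1 q)
        then show ?thesis using l r
          by (intro exI[of _ "Plus l"] exI[of _ "Minus r"]) (auto simp: stein_less_simps)
      next
        case (2 t)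
        have "stein_near \<epsilon> x z" if "z \<in> stein_set \<Gamma>" "l < stein_proj z" "stein_less z (Plus t)" for z
          using that l 2 by (auto simp: stein_less_simps)
        then show ?thesis using l r 2
          by (intro exI[of _ "Plus l"] exI[of _ "Plus t"]) (auto simp: stein_less_simps)
      next
        case (3 t)
        have "stein_near \<epsilon> x z" if "z \<in> stein_set \<Gamma>" "stein_less (Minus t) z" "stein_proj z < r" for z
          using that r 3 by (auto simp: stein_less_simps)
        then show ?thesis using l r 3
          by (intro exI[of _ "Minus t"] exI[of _ "Minus r"]) (auto simp: stein_less_simps)
      qed
    qed
    then obtain a b where ab: "a \<in> stein_set \<Gamma>" "b \<in> stein_set \<Gamma>" "stein_less a x" "stein_less x b"
       and *: "\<And>z. z\<in>stein_set \<Gamma> \<Longrightarrow> stein_less a z \<Longrightarrow> stein_less z b \<Longrightarrow> stein_near \<epsilon> x z"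
      by blast
    let ?T = "{y \<in> stein_set \<Gamma>. stein_less a y} \<inter> {y \<in> stein_set \<Gamma>. stein_less y b}"
    have "stein_open \<Gamma> ?T"
      using ab left right by blast
    moreover have "x \<in> ?T" using ab x R by auto
    moreover have "?T \<subseteq> U" using * \<epsilon> by auto
    ultimately show "\<exists>T. stein_open \<Gamma> T \<and> x \<in> T \<and> T \<subseteq> U" by blast
  qed
qed

lemma openin_proj_ball:
  assumes d: "closure \<Gamma> = UNIV"
  shows "stein_open \<Gamma> {y \<in> stein_set \<Gamma>. \<bar>stein_proj y - r\<bar> < 1}" (is "openin _ ?T")
proof -
  have "\<exists>\<epsilon>>0. \<forall>z\<in>stein_set \<Gamma>. stein_near \<epsilon> y z \<longrightarrow> z \<in> ?T" if y: "y \<in> ?T" for y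
  proof (intro exI conjI ballI impI)
    show e: "0 < 1 - \<bar>stein_proj y - r\<bar>" using y by auto
    fix z assume "z \<in> stein_set \<Gamma>" "stein_near (1 - \<bar>stein_proj y - r\<bar>) y z"
    then show "z \<in> ?T" using stein_near_proj[OF _ e, of y z] by auto
  qed
  then show ?thesis by (auto simp: openin_stein_space_iff[OF d])
qed

section \<open>Cells\<close>

text \<open>The compact open interval \<open>[a\<^sub>+, b\<^sub>-]\<close>, which is empty for \<open>a = b\<close>.\<close>

definition cell :: "real set \<Rightarrow> real \<Rightarrow> real \<Rightarrow> stein_point set" where
  "cell \<Gamma> a b = {z \<in> stein_set \<Gamma>. (z = Plus a \<or> a < stein_proj z) \<and> (z = Minus b \<or> stein_proj z < b)}"

lemma cell_empty [simp]: "cell \<Gamma> a a = {}"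
  by (auto simp: cell_def)

lemma cell_subset: "cell \<Gamma> a b \<subseteq> stein_set \<Gamma>"
  by (auto simp: cell_def)

lemma cell_simps [simp]:
  "Pt r \<in> cell \<Gamma> a b \<longleftrightarrow> r \<notin> \<Gamma> \<and> a < r \<and> r < b"
  "Plus r \<in> cell \<Gamma> a b \<longleftrightarrow> r \<in> \<Gamma> \<and> a \<le> r \<and> r < b"
  "Minus r \<in> cell \<Gamma> a b \<longleftrightarrow> r \<in> \<Gamma> \<and> a < r \<and> r \<le> b"
  by (auto simp: cell_def)

lemma cell_split:
  assumes "a \<le> b" "b \<le> c" "b \<in> \<Gamma>"
  shows "cell \<Gamma> a c = cell \<Gamma> a b \<union> cell \<Gamma> b c" "cell \<Gamma> a b \<inter> cell \<Gamma> b c = {}"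
proof -
  have "z \<in> cell \<Gamma> a c \<longleftrightarrow> z \<in> cell \<Gamma> a b \<union> cell \<Gamma> b c" for z
    using assms by (cases z) (auto simp: not_less intro: le_neq_trans)
  then show "cell \<Gamma> a c = cell \<Gamma> a b \<union> cell \<Gamma> b c" by blast
  have "z \<notin> cell \<Gamma> a b \<inter> cell \<Gamma> b c" for z
    by (cases z) auto
  then show "cell \<Gamma> a b \<inter> cell \<Gamma> b c = {}" by blast
qed

lemma cell_proj: "z \<in> cell \<Gamma> a b \<Longrightarrow> a \<le> stein_proj z \<and> stein_proj z \<le> b"
  by (auto simp: cell_def)

lemma stein_near_cell:
  "a \<in> \<Gamma> \<Longrightarrow> b \<in> \<Gamma> \<Longrightarrow> z \<in> cell \<Gamma> a b \<Longrightarrow>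
    \<exists>\<epsilon>>0. \<forall>y\<in>stein_set \<Gamma>. stein_near \<epsilon> z y \<longrightarrow> y \<in> cell \<Gamma> a b"
proof (cases z)
  case (Pt r)
  assume "a \<in> \<Gamma>" "b \<in> \<Gamma>" "z \<in> cell \<Gamma> a b"
  then have "0 < min (r - a) (b - r)" using Pt by auto
  moreover have "\<forall>y\<in>stein_set \<Gamma>. stein_near (min (r - a) (b - r)) z y \<longrightarrow> y \<in> cell \<Gamma> a b"
    using Pt by (auto simp: cell_def)
  ultimately show ?thesis by blast
next
  case (Plus r)
  assume "a \<in> \<Gamma>" "b \<in> \<Gamma>" "z \<in> cell \<Gamma> a b"
  then have "0 < b - r" "\<forall>y\<in>stein_set \<Gamma>. stein_near (b - r) z y \<longrightarrow> y \<in> cell \<Gamma> a b"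
    using Plus by (auto simp: cell_def)
  then show ?thesis by blast
next
  case (Minus r)
  assume "a \<in> \<Gamma>" "b \<in> \<Gamma>" "z \<in> cell \<Gamma> a b"
  then have "0 < r - a" "\<forall>y\<in>stein_set \<Gamma>. stein_near (r - a) z y \<longrightarrow> y \<in> cell \<Gamma> a b"
    using Minus by (auto simp: cell_def)
  then show ?thesis by blast
qed

lemma openin_cell:
  assumes "closure \<Gamma> = UNIV" "a \<in> \<Gamma>" "b \<in> \<Gamma>"
  shows "stein_open \<Gamma> (cell \<Gamma> a b)"
  using assms stein_near_cell cell_subset by (auto simp: openin_stein_space_iff)

lemma openin_cell_compl:
  assumes d: "closure \<Gamma> = UNIV" and ab: "a \<in> \<Gamma>" "b \<in> \<Gamma>" "a \<le> b"
  shows "stein_open \<Gamma> (stein_set \<Gamma> - cell \<Gamma> a b)"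
proof -
  have "\<exists>\<epsilon>>0. \<forall>y\<in>stein_set \<Gamma>. stein_near \<epsilon> z y \<longrightarrow> y \<in> stein_set \<Gamma> - cell \<Gamma> a b"
    if z: "z \<in> stein_set \<Gamma> - cell \<Gamma> a b" for z
  proof -
    obtain l where l: "l \<in> \<Gamma>" "l < min a (stein_proj z)"
      by (rule dense_below[OF d])
    obtain r where r: "r \<in> \<Gamma>" "max b (stein_proj z) < r"
      by (rule dense_above[OF d])
    have "z \<in> cell \<Gamma> l r" using l r z by (auto simp: cell_def)
    moreover have "cell \<Gamma> l r = cell \<Gamma> l a \<union> (cell \<Gamma> a b \<union> cell \<Gamma> b r)"
      using cell_split(1)[of l a r \<Gamma>] cell_split(1)[of a b r \<Gamma>] l r ab by auto
    moreover have "cell \<Gamma> l a \<inter> cell \<Gamma> a b = {}" "cell \<Gamma> a b \<inter> cell \<Gamma> b r = {}"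
      using cell_split(2)[of l a b \<Gamma>] cell_split(2)[of a b r \<Gamma>] l r ab by auto
    ultimately consider "z \<in> cell \<Gamma> l a" "cell \<Gamma> l a \<subseteq> - cell \<Gamma> a b"
      | "z \<in> cell \<Gamma> b r" "cell \<Gamma> b r \<subseteq> - cell \<Gamma> a b"
      using z by blast
    then show ?thesis
      using stein_near_cell[of l \<Gamma> a z] stein_near_cell[of b \<Gamma> r z] ab l r by cases blast+
  qed
  then show ?thesis by (simp add: openin_stein_space_iff[OF d])
qed

lemma bounded_in_cell:
  assumes d: "closure \<Gamma> = UNIV" and S: "S \<subseteq> {y \<in> stein_set \<Gamma>. \<bar>stein_proj y - r\<bar> < 1}"
  obtains a b where "a \<in> \<Gamma>" "b \<in> \<Gamma>" "a \<le> b" "S \<subseteq> cell \<Gamma> a b"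
proof -
  obtain u where u: "u \<in> \<Gamma>" "u < r - 1" by (rule dense_below[OF d])
  obtain w where w: "w \<in> \<Gamma>" "r + 1 < w" by (rule dense_above[OF d])
  have "S \<subseteq> cell \<Gamma> u w" using S u w by (fastforce simp: cell_def)
  then show ?thesis using that[of u w] u w by auto
qed

definition on_small_cells :: "real set \<Rightarrow> stein_point \<Rightarrow> (real \<Rightarrow> real \<Rightarrow> bool) \<Rightarrow> bool" where
  "on_small_cells \<Gamma> x R \<longleftrightarrow> (\<exists>U. stein_open \<Gamma> U \<and> x \<in> U \<and>
    (\<forall>a b. a \<in> \<Gamma> \<longrightarrow> b \<in> \<Gamma> \<longrightarrow> a \<le> b \<longrightarrow> cell \<Gamma> a b \<subseteq> U \<longrightarrow> R a b))"

lemma on_small_cellsI: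
  assumes "stein_open \<Gamma> U" "x \<in> U"
    and "\<And>a b. a \<in> \<Gamma> \<Longrightarrow> b \<in> \<Gamma> \<Longrightarrow> a \<le> b \<Longrightarrow> cell \<Gamma> a b \<subseteq> U \<Longrightarrow> R a b"
  shows "on_small_cells \<Gamma> x R"
  using assms unfolding on_small_cells_def by blast

text \<open>This replaces compactness of cells. A property that passes from two adjacent cells to their union,
and holds for all sufficiently small cells, holds for every cell. It comes from Bolzano's bisection
principle on the real line; since the bisection points need not lie in \<open>\<Gamma>\<close>, the property is carried
along with a margin \<open>\<epsilon>\<close> on both sides, in which a cutting point of \<open>\<Gamma>\<close> can be chosen.\<close>

lemma cell_induct:
  assumes d: "closure \<Gamma> = UNIV"
    and trans: "\<And>a b c. \<lbrakk>a \<in> \<Gamma>; b \<in> \<Gamma>; c \<in> \<Gamma>; a \<le> b; b \<le> c; R a b; R b c\<rbrakk> \<Longrightarrow> R a c"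
    and loc: "\<And>x. x \<in> stein_set \<Gamma> \<Longrightarrow> on_small_cells \<Gamma> x R"
    and ab: "a \<in> \<Gamma>" "b \<in> \<Gamma>" "a \<le> b"
  shows "R a b"
proof -
  define P where "P a b \<longleftrightarrow> (\<exists>\<epsilon>>0. \<forall>a'\<in>\<Gamma>. \<forall>b'\<in>\<Gamma>. a - \<epsilon> < a' \<longrightarrow> b' < b + \<epsilon> \<longrightarrow> a' \<le> b' \<longrightarrow> R a' b')"
    for a b
  have near: "\<exists>\<epsilon>>0. \<forall>a\<in>\<Gamma>. \<forall>b\<in>\<Gamma>. a \<le> b \<longrightarrow> (\<forall>z\<in>cell \<Gamma> a b. stein_near \<epsilon> x z) \<longrightarrow> R a b"
    if x: "x \<in> stein_set \<Gamma>" for x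
  proof -
    obtain U where U: "stein_open \<Gamma> U" "x \<in> U"
       and R: "\<And>a b. a \<in> \<Gamma> \<Longrightarrow> b \<in> \<Gamma> \<Longrightarrow> a \<le> b \<Longrightarrow> cell \<Gamma> a b \<subseteq> U \<Longrightarrow> R a b"
      using loc[OF x] unfolding on_small_cells_def by blast
    obtain \<epsilon> where "\<epsilon> > 0" "\<forall>z\<in>stein_set \<Gamma>. stein_near \<epsilon> x z \<longrightarrow> z \<in> U"
      using U by (auto simp: openin_stein_space_iff[OF d])
    then show ?thesis using R cell_subset by (intro exI[of _ \<epsilon>]) blast
  qed
  have "P a b"
    using ab(3)
  proof (induct rule: Bolzano)
    case (trans a b c)
    obtain \<epsilon> where e: "\<epsilon> > 0" "\<And>a' b'. a'\<in>\<Gamma> \<Longrightarrow> b'\<in>\<Gamma> \<Longrightarrow> a - \<epsilon> < a' \<Longrightarrow> b' < b + \<epsilon> \<Longrightarrow> a' \<le> b' \<Longrightarrow> R a' b'"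
      using trans(1) unfolding P_def by blast
    obtain \<delta> where d': "\<delta> > 0" "\<And>a' b'. a'\<in>\<Gamma> \<Longrightarrow> b'\<in>\<Gamma> \<Longrightarrow> b - \<delta> < a' \<Longrightarrow> b' < c + \<delta> \<Longrightarrow> a' \<le> b' \<Longrightarrow> R a' b'"
      using trans(2) unfolding P_def by blast
    let ?m = "min \<epsilon> \<delta>"
    have m: "?m > 0" using e d' by auto
    obtain t where t: "t \<in> \<Gamma>" "b - ?m < t" "t < b + ?m"
      using m by (rule_tac dense_between[OF d, of "b - ?m" "b + ?m"]) linarith+
    have "R a' c'" if A: "a' \<in> \<Gamma>" "c' \<in> \<Gamma>" "a - ?m < a'" "c' < c + ?m" "a' \<le> c'" for a' c'
    proof -
      consider "c' \<le> t" | "t \<le> a'" | "a' \<le> t" "t \<le> c'" by linarith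
      then show ?thesis
      proof cases
        case 1
        then show ?thesis using e(2)[of a' c'] A t by auto
      next
        case 2
        then show ?thesis using d'(2)[of a' c'] A t by auto
      next
        case 3
        then have "R a' t" "R t c'" using e(2)[of a' t] d'(2)[of t c'] A t by auto
        then show ?thesis using assms(2) A t 3 by blast
      qed
    qed
    then show ?case unfolding P_def using m by (intro exI[of _ ?m]) auto
  next
    case (local x)
    have "\<exists>\<epsilon>>0. \<forall>a\<in>\<Gamma>. \<forall>b\<in>\<Gamma>. x - \<epsilon> < a \<longrightarrow> b < x + \<epsilon> \<longrightarrow> a \<le> b \<longrightarrow> R a b"
    (* A point of \<Gamma> has two copies with separate neighbourhoods, so an interval around it is
       first cut at that point. *)
    proof (cases "x \<in> \<Gamma>")
      case False
      then obtain \<epsilon> where "\<epsilon> > 0"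
        and \<epsilon>: "\<And>a b. a\<in>\<Gamma> \<Longrightarrow> b\<in>\<Gamma> \<Longrightarrow> a \<le> b \<Longrightarrow> (\<forall>z\<in>cell \<Gamma> a b. stein_near \<epsilon> (Pt x) z) \<Longrightarrow> R a b"
        using near[of "Pt x"] by auto
      have "R a b" if "a\<in>\<Gamma>" "b\<in>\<Gamma>" "x - \<epsilon> < a" "b < x + \<epsilon>" "a \<le> b" for a b
        using \<epsilon>[of a b] that cell_proj[of _ \<Gamma> a b] by fastforce
      with \<open>\<epsilon> > 0\<close> show ?thesis by blast
    next
      case True
      then obtain \<epsilon> where "\<epsilon> > 0"
        and \<epsilon>: "\<And>a b. a\<in>\<Gamma> \<Longrightarrow> b\<in>\<Gamma> \<Longrightarrow> a \<le> b \<Longrightarrow> (\<forall>z\<in>cell \<Gamma> a b. stein_near \<epsilon> (Minus x) z) \<Longrightarrow> R a b"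
        using near[of "Minus x"] by auto
      from True obtain \<delta> where "\<delta> > 0"
        and \<delta>: "\<And>a b. a\<in>\<Gamma> \<Longrightarrow> b\<in>\<Gamma> \<Longrightarrow> a \<le> b \<Longrightarrow> (\<forall>z\<in>cell \<Gamma> a b. stein_near \<delta> (Plus x) z) \<Longrightarrow> R a b"
        using near[of "Plus x"] by auto
      have "R a b" if ab: "a\<in>\<Gamma>" "b\<in>\<Gamma>" "x - min \<epsilon> \<delta> < a" "b < x + min \<epsilon> \<delta>" "a \<le> b" for a b
      proof -
        have l: "R a b" if "a\<in>\<Gamma>" "b\<in>\<Gamma>" "x - min \<epsilon> \<delta> < a" "b \<le> x" "a \<le> b" for a b
          by (rule \<epsilon>) (use that in \<open>auto simp: cell_def\<close>)
        have r: "R a b" if "a\<in>\<Gamma>" "b\<in>\<Gamma>" "x \<le> a" "b < x + min \<epsilon> \<delta>" "a \<le> b" for a b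
          by (rule \<delta>) (use that in \<open>auto simp: cell_def\<close>)
        consider "b \<le> x" | "x \<le> a" | "a \<le> x" "x \<le> b" by linarith
        then show ?thesis
        proof cases
          case 1
          then show ?thesis using l ab by auto
        next
          case 2
          then show ?thesis using r ab by auto
        next
          case 3
          then show ?thesis using l[of a x] r[of x b] assms(2)[of a x b] ab True \<open>\<epsilon> > 0\<close> \<open>\<delta> > 0\<close> by auto
        qed
      qed
      with \<open>\<epsilon> > 0\<close> \<open>\<delta> > 0\<close> show ?thesis by (intro exI[of _ "min \<epsilon> \<delta>"]) auto
    qed
    then obtain \<epsilon> where e: "\<epsilon> > 0"
      "\<And>a b. a\<in>\<Gamma> \<Longrightarrow> b\<in>\<Gamma> \<Longrightarrow> x - \<epsilon> < a \<Longrightarrow> b < x + \<epsilon> \<Longrightarrow> a \<le> b \<Longrightarrow> R a b" by blast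
    have "P a b" if "a \<le> x" "x \<le> b" "b - a < \<epsilon> / 2" for a b
      unfolding P_def
    proof (intro exI[of _ "\<epsilon>/2"] conjI ballI impI)
      fix a' b' assume "a' \<in> \<Gamma>" "b' \<in> \<Gamma>" "a - \<epsilon>/2 < a'" "b' < b + \<epsilon>/2" "a' \<le> b'"
      then show "R a' b'" using e(2)[of a' b'] that by linarith
    qed (use e in auto)
    then show ?case using e(1) by (intro exI[of _ "\<epsilon>/2"]) auto
  qed
  then show ?thesis using ab unfolding P_def by fastforce
qed

section \<open>Locally constant functions and their jumps\<close>

definition locally_constant :: "real set \<Rightarrow> (stein_point \<Rightarrow> 'a) \<Rightarrow> bool" where
  "locally_constant \<Gamma> f \<longleftrightarrow>
    (\<forall>x\<in>stein_set \<Gamma>. \<exists>\<epsilon>>0. \<forall>z\<in>stein_set \<Gamma>. stein_near \<epsilon> x z \<longrightarrow> f z = f x)"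

lemma locally_constantD:
  assumes "locally_constant \<Gamma> f" "x \<in> stein_set \<Gamma>"
  obtains \<epsilon> where "\<epsilon> > 0" "\<And>z. z \<in> stein_set \<Gamma> \<Longrightarrow> stein_near \<epsilon> x z \<Longrightarrow> f z = f x"
  using assms unfolding locally_constant_def by blast

lemma locally_constant_const [simp]: "locally_constant \<Gamma> (\<lambda>x. c)"
  by (auto simp: locally_constant_def intro: exI[of _ 1])

lemma locally_constant_compose:
  assumes "locally_constant \<Gamma> f"
  shows "locally_constant \<Gamma> (\<lambda>x. H (f x))"
  unfolding locally_constant_def using assms by (metis locally_constantD)

lemma locally_constant_pair:
  assumes "locally_constant \<Gamma> f" "locally_constant \<Gamma> g"
  shows "locally_constant \<Gamma> (\<lambda>x. (f x, g x))"
  unfolding locally_constant_def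
proof
  fix x assume x: "x \<in> stein_set \<Gamma>"
  obtain \<epsilon> where e: "\<epsilon> > 0" "\<And>z. z \<in> stein_set \<Gamma> \<Longrightarrow> stein_near \<epsilon> x z \<Longrightarrow> f z = f x"
    using locally_constantD[OF assms(1) x] by blast
  obtain \<delta> where d: "\<delta> > 0" "\<And>z. z \<in> stein_set \<Gamma> \<Longrightarrow> stein_near \<delta> x z \<Longrightarrow> g z = g x"
    using locally_constantD[OF assms(2) x] by blast
  show "\<exists>\<epsilon>>0. \<forall>z\<in>stein_set \<Gamma>. stein_near \<epsilon> x z \<longrightarrow> (f z, g z) = (f x, g x)"
    using e d stein_near_mono[of "min \<epsilon> \<delta>" x] by (intro exI[of _ "min \<epsilon> \<delta>"]) auto
qed

lemma locally_constant_compose2: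
  assumes "locally_constant \<Gamma> f" "locally_constant \<Gamma> g"
  shows "locally_constant \<Gamma> (\<lambda>x. H (f x) (g x))"
  using locally_constant_compose[OF locally_constant_pair[OF assms], of "\<lambda>p. H (fst p) (snd p)"] by simp

lemma locally_constant_sum:
  fixes f :: "'i \<Rightarrow> stein_point \<Rightarrow> 'a::comm_monoid_add"
  assumes "\<And>i. i \<in> I \<Longrightarrow> locally_constant \<Gamma> (f i)"
  shows "locally_constant \<Gamma> (\<lambda>x. \<Sum>i\<in>I. f i x)"
  using assms
proof (induction I rule: infinite_finite_induct)
  case (insert i I)
  then show ?case by (simp add: locally_constant_compose2[of \<Gamma> "f i" _ "(+)"])
qed auto

lemma openin_locally_constant:
  assumes "closure \<Gamma> = UNIV" "locally_constant \<Gamma> f"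
  shows "stein_open \<Gamma> {z \<in> stein_set \<Gamma>. P (f z)}"
  unfolding openin_stein_space_iff[OF assms(1)]
proof (intro conjI ballI)
  fix x assume "x \<in> {z \<in> stein_set \<Gamma>. P (f z)}"
  moreover from this obtain \<epsilon> where "\<epsilon> > 0" "\<And>z. z \<in> stein_set \<Gamma> \<Longrightarrow> stein_near \<epsilon> x z \<Longrightarrow> f z = f x"
    using locally_constantD[OF assms(2), of x] by blast
  ultimately have "\<forall>z\<in>stein_set \<Gamma>. stein_near \<epsilon> x z \<longrightarrow> z \<in> {z \<in> stein_set \<Gamma>. P (f z)}"
    by (metis (mono_tags, lifting) mem_Collect_eq)
  with \<open>\<epsilon> > 0\<close> show "\<exists>\<epsilon>>0. \<forall>z\<in>stein_set \<Gamma>. stein_near \<epsilon> x z \<longrightarrow> z \<in> {z \<in> stein_set \<Gamma>. P (f z)}"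
    by blast
qed blast

lemma locally_constant_nbhd:
  assumes "closure \<Gamma> = UNIV" "locally_constant \<Gamma> f" "x \<in> stein_set \<Gamma>"
  obtains U where "stein_open \<Gamma> U" "x \<in> U" "\<And>z. z \<in> U \<Longrightarrow> f z = f x"
proof (rule that)
  show "stein_open \<Gamma> {z \<in> stein_set \<Gamma>. f z = f x}"
    by (rule openin_locally_constant[OF assms(1,2)])
qed (use assms(3) in auto)

definition jump :: "(stein_point \<Rightarrow> real) \<Rightarrow> real \<Rightarrow> real" where
  "jump f u = f (Plus u) - f (Minus u)"

text \<open>A locally constant function changes only at points of \<open>\<Gamma>\<close>, finitely often on a cell, so its values
at the two ends of a cell differ by the sum of the jumps in between.\<close>

lemma jumps_between:
  assumes d: "closure \<Gamma> = UNIV" and f: "locally_constant \<Gamma> f"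
    and ab: "a \<in> \<Gamma>" "b \<in> \<Gamma>" "a < b"
  shows "finite {u \<in> \<Gamma>. a < u \<and> u < b \<and> jump f u \<noteq> 0}" (is "finite (?D a b)")
    and "f (Minus b) = f (Plus a) + (\<Sum>u\<in>{u \<in> \<Gamma>. a < u \<and> u < b \<and> jump f u \<noteq> 0}. jump f u)"
proof -
  define R where "R a b \<longleftrightarrow> a = b \<or>
     finite (?D a b) \<and> f (Minus b) = f (Plus a) + (\<Sum>u\<in>?D a b. jump f u)" for a b
  have "R a b"
  proof (rule cell_induct[OF d, of R])
    fix a b c assume *: "a \<in> \<Gamma>" "b \<in> \<Gamma>" "c \<in> \<Gamma>" "a \<le> b" "b \<le> c" "R a b" "R b c"
    show "R a c"
    proof (cases "a = b \<or> b = c")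
      case True
      then show ?thesis using * by auto
    next
      case False
      then have lt: "a < b" "b < c" using * by auto
      have fin: "finite (?D a b)" "finite (?D b c)" using * lt by (auto simp: R_def)
      have D: "?D a c = ?D a b \<union> ({u. u = b \<and> jump f u \<noteq> 0} \<union> ?D b c)"
        using lt * by (auto simp: not_less)
      have "(\<Sum>u\<in>?D a c. jump f u) =
          (\<Sum>u\<in>?D a b. jump f u) + ((\<Sum>u\<in>{u. u = b \<and> jump f u \<noteq> 0}. jump f u) + (\<Sum>u\<in>?D b c. jump f u))"
      proof -
        have "?D a b \<inter> ({u. u = b \<and> jump f u \<noteq> 0} \<union> ?D b c) = {}" by auto
        moreover have "{u. u = b \<and> jump f u \<noteq> 0} \<inter> ?D b c = {}" by auto
        moreover have "finite {u. u = b \<and> jump f u \<noteq> 0}" by (rule finite_subset[of _ "{b}"]) auto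
        ultimately show ?thesis
          unfolding D using fin by (simp only: sum.union_disjoint finite_Un simp_thms)
      qed
      moreover have "(\<Sum>u\<in>{u. u = b \<and> jump f u \<noteq> 0}. jump f u) = (\<Sum>u\<in>{b}. jump f u)"
        by (rule sum.mono_neutral_left) auto
      ultimately show ?thesis
        using * lt fin unfolding R_def D by (auto simp: jump_def)
    qed
  next
    fix x assume "x \<in> stein_set \<Gamma>"
    then obtain U where U: "stein_open \<Gamma> U" "x \<in> U" "\<And>z. z \<in> U \<Longrightarrow> f z = f x"
      using locally_constant_nbhd[OF d f] by blast
    have "R a b" if ab: "a \<in> \<Gamma>" "b \<in> \<Gamma>" "a \<le> b" "cell \<Gamma> a b \<subseteq> U" for a b
    proof (cases "a = b")
      case False
      then have "a < b" using ab by auto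
      have c: "f z = f x" if "z \<in> cell \<Gamma> a b" for z using that ab(4) U(3) by blast
      have D: "?D a b = {}" using c by (auto simp: jump_def)
      show ?thesis unfolding R_def D using c[of "Plus a"] c[of "Minus b"] ab \<open>a < b\<close> by simp
    qed (simp add: R_def)
    then show "on_small_cells \<Gamma> x R"
      by (rule on_small_cellsI[OF U(1,2)])
  qed (use ab in auto)
  then show "finite (?D a b)" "f (Minus b) = f (Plus a) + (\<Sum>u\<in>?D a b. jump f u)"
    using ab by (auto simp: R_def)
qed

lemma no_jumps_imp_constant:
  assumes d: "closure \<Gamma> = UNIV" and f: "locally_constant \<Gamma> f"
    and j: "\<And>u. u \<in> \<Gamma> \<Longrightarrow> jump f u = 0"
    and x: "x \<in> stein_set \<Gamma>" "y \<in> stein_set \<Gamma>"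
  shows "f x = f y"
proof -
  define R where "R a b \<longleftrightarrow> (\<forall>z\<in>cell \<Gamma> a b. f z = f (Plus a)) \<and> f (Plus b) = f (Plus a)" for a b
  obtain a where a: "a \<in> \<Gamma>" "a < min (stein_proj x) (stein_proj y)" by (rule dense_below[OF d])
  obtain b where b: "b \<in> \<Gamma>" "max (stein_proj x) (stein_proj y) < b" by (rule dense_above[OF d])
  have "R a b"
  proof (rule cell_induct[OF d, of R])
    fix a b c assume "a \<in> \<Gamma>" "b \<in> \<Gamma>" "c \<in> \<Gamma>" "a \<le> b" "b \<le> c" "R a b" "R b c"
    then show "R a c" unfolding R_def cell_split(1)[OF \<open>a \<le> b\<close> \<open>b \<le> c\<close> \<open>b \<in> \<Gamma>\<close>] by (metis UnE)
  next
    fix x assume "x \<in> stein_set \<Gamma>"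
    then obtain U where U: "stein_open \<Gamma> U" "x \<in> U" "\<And>z. z \<in> U \<Longrightarrow> f z = f x"
      using locally_constant_nbhd[OF d f] by blast
    have "R a b" if ab: "a \<in> \<Gamma>" "b \<in> \<Gamma>" "a \<le> b" "cell \<Gamma> a b \<subseteq> U" for a b
    proof (cases "a = b")
      case False
      then have "a < b" using ab by auto
      have c: "f z = f x" if "z \<in> cell \<Gamma> a b" for z using that ab(4) U(3) by blast
      then show ?thesis
        unfolding R_def using c[of "Plus a"] c[of "Minus b"] ab \<open>a < b\<close> j[of b] by (auto simp: jump_def)
    qed (simp add: R_def)
    then show "on_small_cells \<Gamma> x R"
      by (rule on_small_cellsI[OF U(1,2)])
  qed (use a b in auto)
  moreover have "x \<in> cell \<Gamma> a b" "y \<in> cell \<Gamma> a b" using x a b by (auto simp: cell_def)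
  ultimately show ?thesis by (auto simp: R_def)
qed

section \<open>Affine maps of the split line\<close>

abbreviation shift :: "real \<Rightarrow> stein_point \<Rightarrow> stein_point" where
  "shift s \<equiv> stein_action (s, 1)"

lemma stein_proj_action [simp]: "stein_proj (stein_action g x) = snd g * stein_proj x + fst g"
  by (cases x) auto

lemma stein_action_action:
  "stein_action g (stein_action h x) = stein_action (fst g + snd g * fst h, snd g * snd h) x"
  by (cases x) (auto simp: algebra_simps)

lemma stein_action_one [simp]: "stein_action (0, 1) x = x"
  by (cases x) auto

lemma stein_near_action:
  assumes "snd g > 0" "stein_near \<epsilon> x z"
  shows "stein_near (snd g * \<epsilon>) (stein_action g x) (stein_action g z)"
proof (cases x)
  case (Pt r)
  have "\<bar>snd g * stein_proj z - snd g * r\<bar> = snd g * \<bar>stein_proj z - r\<bar>"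
    using assms(1) by (metis abs_mult abs_of_pos right_diff_distrib)
  then show ?thesis using assms Pt by auto
next
  case (Minus t)
  have "snd g * t + fst g - snd g * \<epsilon> = snd g * (t - \<epsilon>) + fst g" by (simp add: algebra_simps)
  then show ?thesis using assms Minus by auto
next
  case (Plus t)
  have "snd g * t + fst g + snd g * \<epsilon> = snd g * (t + \<epsilon>) + fst g" by (simp add: algebra_simps)
  then show ?thesis using assms Plus by auto
qed

lemma locally_constant_precompose:
  assumes f: "locally_constant \<Gamma> f" and g: "snd g > 0"
    and stable: "\<And>x. x \<in> stein_set \<Gamma> \<Longrightarrow> stein_action g x \<in> stein_set \<Gamma>"
  shows "locally_constant \<Gamma> (\<lambda>x. f (stein_action g x))"
  unfolding locally_constant_def
proof
  fix x assume x: "x \<in> stein_set \<Gamma>"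
  obtain \<epsilon> where e: "\<epsilon> > 0" "\<And>z. z \<in> stein_set \<Gamma> \<Longrightarrow> stein_near \<epsilon> (stein_action g x) z \<Longrightarrow>
      f z = f (stein_action g x)"
    using locally_constantD[OF f stable[OF x]] by blast
  have "f (stein_action g z) = f (stein_action g x)"
    if "z \<in> stein_set \<Gamma>" "stein_near (\<epsilon> / snd g) x z" for z
    using e(2)[of "stein_action g z"] stein_near_action[OF g that(2)] stable[OF that(1)] g by auto
  then show "\<exists>\<epsilon>>0. \<forall>z\<in>stein_set \<Gamma>. stein_near \<epsilon> x z \<longrightarrow> f (stein_action g z) = f (stein_action g x)"
    using e(1) g by (intro exI[of _ "\<epsilon> / snd g"]) auto
qed

locale dense_subgroup =
  fixes \<Gamma> :: "real set"
  assumes zero [simp]: "0 \<in> \<Gamma>"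
    and add: "s \<in> \<Gamma> \<Longrightarrow> t \<in> \<Gamma> \<Longrightarrow> s + t \<in> \<Gamma>"
    and minus: "s \<in> \<Gamma> \<Longrightarrow> - s \<in> \<Gamma>"
    and dense: "closure \<Gamma> = UNIV"
begin

lemma diff: "s \<in> \<Gamma> \<Longrightarrow> t \<in> \<Gamma> \<Longrightarrow> s - t \<in> \<Gamma>"
  using add[of s "- t"] minus[of t] by simp

lemma int_mult: "s \<in> \<Gamma> \<Longrightarrow> of_int k * s \<in> \<Gamma>"
proof (induction k rule: int_induct[of _ 0])
  case (step1 i)
  then show ?case using add[of "of_int i * s" s] by (simp add: algebra_simps)
next
  case (step2 i)
  then show ?case using diff[of "of_int i * s" s] by (simp add: algebra_simps)
qed auto

lemma add_cancel: "s \<in> \<Gamma> \<Longrightarrow> t + s \<in> \<Gamma> \<longleftrightarrow> t \<in> \<Gamma>"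
  using add[of t s] diff[of "t + s" s] by auto

lemma shift_in [simp]: "s \<in> \<Gamma> \<Longrightarrow> shift s x \<in> stein_set \<Gamma> \<longleftrightarrow> x \<in> stein_set \<Gamma>"
  by (cases x) (auto simp: add_cancel)

lemma locally_constant_shift:
  assumes "locally_constant \<Gamma> f" "s \<in> \<Gamma>"
  shows "locally_constant \<Gamma> (\<lambda>x. f (shift s x))"
  using locally_constant_precompose[OF assms(1), of "(s, 1)"] assms(2) by simp

end

section \<open>Almost invariant functions on the circle\<close>

lemma int_telescope:
  fixes h :: "int \<Rightarrow> real"
  shows "(\<Sum>k\<in>{a..<a + int m}. h (k + 1) - h k) = h (a + int m) - h a"
proof (induction m)
  case (Suc m)
  have "{a..<a + int (Suc m)} = insert (a + int m) {a..<a + int m}" by auto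
  then show ?case using Suc by (simp add: algebra_simps)
qed simp

lemma finite_int_bounds:
  assumes "finite (A :: int set)"
  obtains K where "K \<ge> 0" "\<And>k. k \<in> A \<Longrightarrow> - K < k \<and> k < K"
proof -
  obtain B where B: "\<And>k. k \<in> A \<Longrightarrow> \<bar>k\<bar> \<le> B"
    using assms finite_nat_set_iff_bounded_le[of "(nat \<circ> abs) ` A"]
    by (auto simp: nat_le_iff)
  show ?thesis by (rule that[of "\<bar>B\<bar> + 1"]) (use B in \<open>fastforce+\<close>)
qed

text \<open>The numbers \<open>e\<close> and \<open>\<alpha>\<close> are rationally independent; modulo \<open>e\<close>, the translation by \<open>\<alpha>\<close> is an
irrational rotation of the circle.\<close>

locale circle_rotation = dense_subgroup +
  fixes e \<alpha> :: real
  assumes e: "e \<in> \<Gamma>" "e > 0" and \<alpha>: "\<alpha> \<in> \<Gamma>"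
    and irrational: "\<And>m n :: int. of_int m * \<alpha> = of_int n * e \<Longrightarrow> m = 0"
begin

text \<open>The representative of \<open>u\<close> modulo \<open>e\<close> in the fundamental domain from \<open>0\<close> to \<open>e\<close>.\<close>

definition red :: "real \<Rightarrow> real" where "red u = u - of_int \<lfloor>u / e\<rfloor> * e"

lemma red_range: "0 \<le> red u" "red u < e"
proof -
  have "of_int \<lfloor>u / e\<rfloor> \<le> u / e" "u / e < of_int \<lfloor>u / e\<rfloor> + 1" by linarith+
  then have "of_int \<lfloor>u / e\<rfloor> * e \<le> u" "u < (of_int \<lfloor>u / e\<rfloor> + 1) * e"
    using e(2) by (simp_all only: pos_le_divide_eq pos_divide_less_eq)
  then show "0 \<le> red u" "red u < e" by (auto simp: red_def algebra_simps)
qed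

lemma red_in: "u \<in> \<Gamma> \<Longrightarrow> red u \<in> \<Gamma>"
  using int_mult[OF e(1)] diff by (auto simp: red_def)

lemma red_id: "0 \<le> u \<Longrightarrow> u < e \<Longrightarrow> red u = u"
proof -
  assume "0 \<le> u" "u < e"
  then have "\<lfloor>u / e\<rfloor> = 0" using e by (simp add: floor_eq_iff)
  then show ?thesis by (simp add: red_def)
qed

lemma red_add_multiple: "red (u + of_int m * e) = red u"
proof -
  have "(u + of_int m * e) / e = u / e + of_int m" using e by (simp add: field_simps)
  then show ?thesis by (simp add: red_def algebra_simps)
qed

lemma red_eq_imp: "red u = red v \<Longrightarrow> \<exists>m::int. u = v + of_int m * e"
  by (rule exI[of _ "\<lfloor>u / e\<rfloor> - \<lfloor>v / e\<rfloor>"]) (simp add: red_def algebra_simps)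

lemma inj_orbit: "inj (\<lambda>k::int. red (v + of_int k * \<alpha>))"
proof (rule injI)
  fix j k :: int assume "red (v + of_int j * \<alpha>) = red (v + of_int k * \<alpha>)"
  then obtain m :: int where "v + of_int j * \<alpha> = v + of_int k * \<alpha> + of_int m * e"
    using red_eq_imp by blast
  then have "of_int (j - k) * \<alpha> = of_int m * e" by (simp add: algebra_simps)
  then show "j = k" using irrational[of "j - k" m] by simp
qed

lemma periodic_multiple:
  fixes n :: "real \<Rightarrow> 'a"
  assumes per: "\<And>u. u \<in> \<Gamma> \<Longrightarrow> n (u + e) = n u" and u: "u \<in> \<Gamma>"
  shows "n (u + of_int k * e) = n u"
proof (induction k rule: int_induct[of _ 0])
  case (step1 i)
  then show ?case using per[of "u + of_int i * e"] u add int_mult e by (simp add: algebra_simps)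
next
  case (step2 i)
  have "u + of_int (i - 1) * e \<in> \<Gamma>" using u add int_mult[OF e(1)] by blast
  from per[OF this] step2 show ?case by (simp add: algebra_simps)
qed auto

text \<open>Let \<open>n\<close> be a function on \<open>\<Gamma>\<close> modulo \<open>e\<close> that every translation changes at finitely many points only.
Along an orbit \<open>v + k \<alpha>\<close>, whose points are distinct modulo \<open>e\<close>, it is eventually constant in both
directions. The two limits \<open>p\<close> and \<open>q\<close> are the same for all orbits, because a translation that
moves one orbit to another changes finitely many values. If \<open>p \<noteq> q\<close>, then each orbit
contains a change, so there are finitely many orbits, and the changes along each of them add
up to \<open>p - q\<close>. Hence the total change under \<open>\<alpha>\<close> is a positive multiple of \<open>p - q\<close>, and its
vanishing forces \<open>p = q\<close>. The exceptional points then lie on finitely many orbits, finitely many on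
each.\<close>

lemma almost_invariant_cofinite:
  fixes n :: "real \<Rightarrow> real"
  assumes per: "\<And>u. u \<in> \<Gamma> \<Longrightarrow> n (u + e) = n u"
    and fin: "\<And>s. s \<in> \<Gamma> \<Longrightarrow> finite {u \<in> \<Gamma>. 0 \<le> u \<and> u < e \<and> n (u + s) \<noteq> n u}"
    and sum0: "(\<Sum>u | u \<in> \<Gamma> \<and> 0 \<le> u \<and> u < e \<and> n (u + \<alpha>) \<noteq> n u. n (u + \<alpha>) - n u) = 0"
  obtains p where "finite {u \<in> \<Gamma>. 0 \<le> u \<and> u < e \<and> n u \<noteq> p}"
proof -
  have perk: "n (u + of_int k * e) = n u" if "u \<in> \<Gamma>" for u k
    by (rule periodic_multiple[of n, OF per that])
  have nred: "n (red u) = n u" if "u \<in> \<Gamma>" for u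
    using perk[OF that, of "- \<lfloor>u / e\<rfloor>"] by (simp add: red_def)
  have nred2: "n (red u + s) = n (u + s)" if "u \<in> \<Gamma>" "s \<in> \<Gamma>" for u s
    using perk[of "u + s" "- \<lfloor>u / e\<rfloor>"] that add by (simp add: red_def algebra_simps)
  have orb: "v + of_int k * \<alpha> \<in> \<Gamma>" if "v \<in> \<Gamma>" for v k
    using that add int_mult \<alpha> by blast
  have finorb: "finite {k::int. n (v + of_int k * \<alpha> + s) \<noteq> n (v + of_int k * \<alpha>)}" (is "finite ?A")
    if v: "v \<in> \<Gamma>" and s: "s \<in> \<Gamma>" for v s
  proof -
    have "(\<lambda>k::int. red (v + of_int k * \<alpha>)) ` ?A \<subseteq> {u \<in> \<Gamma>. 0 \<le> u \<and> u < e \<and> n (u + s) \<noteq> n u}"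
      using red_range red_in orb v s nred nred2 by auto
    then show ?thesis
      using fin[OF s] finite_imageD[of "\<lambda>k::int. red (v + of_int k * \<alpha>)" ?A]
        inj_on_subset[OF inj_orbit] finite_subset by blast
  qed
  obtain K0 where K0: "K0 \<ge> 0" and K0': "\<And>k::int. k \<le> - K0 \<or> K0 \<le> k \<Longrightarrow> n (of_int (k + 1) * \<alpha>) = n (of_int k * \<alpha>)"
  proof -
    obtain K where "K \<ge> 0" "\<And>k. n (0 + of_int k * \<alpha> + \<alpha>) \<noteq> n (0 + of_int k * \<alpha>) \<Longrightarrow> - K < k \<and> k < K"
      using finite_int_bounds[OF finorb[OF zero \<alpha>]] by auto
    then show ?thesis by (intro that[of K]) (auto simp: algebra_simps, force+)
  qed
  define p where "p = n (of_int K0 * \<alpha>)"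
  define q where "q = n (of_int (- K0) * \<alpha>)"
  have p0: "n (of_int k * \<alpha>) = p" if "k \<ge> K0" for k
    using that
  proof (induction rule: int_ge_induct)
    case (step i)
    then show ?case using K0'[of i] by simp
  qed (simp add: p_def)
  have q0: "n (of_int k * \<alpha>) = q" if "k \<le> - K0" for k
    using that
  proof (induction rule: int_le_induct)
    case (step i)
    then show ?case using K0'[of "i - 1"] by simp
  qed (simp add: q_def)
  have ends: "\<exists>K\<ge>0. (\<forall>k\<ge>K. n (v + of_int k * \<alpha>) = p) \<and> (\<forall>k\<le>- K. n (v + of_int k * \<alpha>) = q)"
    if v: "v \<in> \<Gamma>" for v
  proof -
    obtain K where K: "K \<ge> 0" "\<And>k. n (0 + of_int k * \<alpha> + v) \<noteq> n (0 + of_int k * \<alpha>) \<Longrightarrow> - K < k \<and> k < K"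
      using finite_int_bounds[OF finorb[OF zero v]] by auto
    have "n (v + of_int k * \<alpha>) = p" if "k \<ge> max K K0" for k
      using K(2)[of k] p0[of k] that by (auto simp: add.commute)
    moreover have "n (v + of_int k * \<alpha>) = q" if "k \<le> - max K K0" for k
    proof -
      have "k \<le> - K" "k \<le> - K0" using that by linarith+
      then show ?thesis using K(2)[of k] q0[of k] by (auto simp: add.commute)
    qed
    ultimately show ?thesis using K by (intro exI[of _ "max K K0"]) auto
  qed
  (* The points at which \<alpha> changes n, and their division into orbits under \<alpha>. *)
  define D where "D = {u \<in> \<Gamma>. 0 \<le> u \<and> u < e \<and> n (u + \<alpha>) \<noteq> n u}"
  have finD: "finite D" unfolding D_def using fin[OF \<alpha>] .
  define cls where "cls d = {v \<in> D. \<exists>k m::int. v = d + of_int k * \<alpha> + of_int m * e}" for d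
  have cls_self: "d \<in> cls d" if "d \<in> D" for d
    using that unfolding cls_def by (auto intro!: exI[of _ 0])
  have cls_eq: "{v \<in> D. cls v = cls d} = cls d" if d: "d \<in> D" for d
  proof -
    have "cls v = cls d" if v: "v \<in> cls d" for v
    proof -
      obtain k m :: int where km: "v = d + of_int k * \<alpha> + of_int m * e" using v by (auto simp: cls_def)
      show ?thesis
      proof (intro equalityI subsetI)
        fix w assume "w \<in> cls v"
        then obtain k' m' :: int where "w \<in> D" "w = v + of_int k' * \<alpha> + of_int m' * e"
          by (auto simp: cls_def)
        then have "w = d + of_int (k + k') * \<alpha> + of_int (m + m') * e" using km by (simp add: algebra_simps)
        then show "w \<in> cls d" using \<open>w \<in> D\<close> unfolding cls_def by blast
      next
        fix w assume "w \<in> cls d"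
        then obtain k' m' :: int where "w \<in> D" "w = d + of_int k' * \<alpha> + of_int m' * e"
          by (auto simp: cls_def)
        then have "w = v + of_int (k' - k) * \<alpha> + of_int (m' - m) * e" using km by (simp add: algebra_simps)
        then show "w \<in> cls v" using \<open>w \<in> D\<close> unfolding cls_def by blast
      qed
    qed
    moreover have "v \<in> D" if "v \<in> cls d" for v using that by (simp add: cls_def)
    ultimately show ?thesis using cls_self by blast
  qed
  have cls_sum: "(\<Sum>v\<in>cls d. n (v + \<alpha>) - n v) = p - q" if d: "d \<in> D" for d
  proof -
    have d': "d \<in> \<Gamma>" using d by (simp add: D_def)
    obtain K where K: "K \<ge> 0" "\<And>k. k \<ge> K \<Longrightarrow> n (d + of_int k * \<alpha>) = p"
        "\<And>k. k \<le> - K \<Longrightarrow> n (d + of_int k * \<alpha>) = q"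
      using ends[OF d'] by blast
    let ?g = "\<lambda>k::int. n (d + of_int (k + 1) * \<alpha>) - n (d + of_int k * \<alpha>)"
    let ?S = "{k. ?g k \<noteq> 0}"
    have S: "?S \<subseteq> {- K..<K}"
    proof
      fix k assume "k \<in> ?S"
      then have "\<not> k \<ge> K" "\<not> k + 1 \<le> - K" using K(2)[of k] K(2)[of "k + 1"] K(3)[of k] K(3)[of "k + 1"] by auto
      then show "k \<in> {- K..<K}" by auto
    qed
    have gred: "n (red (d + of_int k * \<alpha>) + \<alpha>) - n (red (d + of_int k * \<alpha>)) = ?g k" for k
      using nred2[OF orb[OF d', of k] \<alpha>] nred[OF orb[OF d', of k]] by (simp add: algebra_simps)
    have bij: "bij_betw (\<lambda>k. red (d + of_int k * \<alpha>)) ?S (cls d)"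
      unfolding bij_betw_def
    proof (intro conjI equalityI subsetI)
      show "inj_on (\<lambda>k. red (d + of_int k * \<alpha>)) ?S"
        using inj_on_subset[OF inj_orbit] by blast
    next
      fix v assume "v \<in> (\<lambda>k. red (d + of_int k * \<alpha>)) ` ?S"
      then obtain k where k: "k \<in> ?S" "v = red (d + of_int k * \<alpha>)" by auto
      have "v \<in> D" using k red_range red_in[OF orb[OF d']] gred[of k] by (auto simp: D_def)
      moreover have "v = d + of_int k * \<alpha> + of_int (- \<lfloor>(d + of_int k * \<alpha>) / e\<rfloor>) * e"
        using k by (simp add: red_def)
      ultimately show "v \<in> cls d" unfolding cls_def by blast
    next
      fix v assume v: "v \<in> cls d"
      then obtain k m :: int where km: "v = d + of_int k * \<alpha> + of_int m * e" "v \<in> D" by (auto simp: cls_def)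
      then have "red (d + of_int k * \<alpha>) = red v" using red_add_multiple[of "d + of_int k * \<alpha>" m] by simp
      also have "\<dots> = v" using km by (intro red_id) (auto simp: D_def)
      finally have r: "v = red (d + of_int k * \<alpha>)" ..
      then have "k \<in> ?S" using gred[of k] km(2) by (auto simp: D_def)
      then show "v \<in> (\<lambda>k. red (d + of_int k * \<alpha>)) ` ?S" using r by blast
    qed
    have "(\<Sum>v\<in>cls d. n (v + \<alpha>) - n v) = (\<Sum>k\<in>?S. ?g k)"
      using sum.reindex_bij_betw[OF bij, of "\<lambda>v. n (v + \<alpha>) - n v"] gred by simp
    also have "\<dots> = (\<Sum>k\<in>{- K..<K}. ?g k)"
      by (rule sum.mono_neutral_left) (use S in auto)
    also have "{- K..<K} = {- K..<- K + int (nat (2 * K))}" using K(1) by auto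
    also have "(\<Sum>k\<in>\<dots>. ?g k) = n (d + of_int (- K + int (nat (2 * K))) * \<alpha>) - n (d + of_int (- K) * \<alpha>)"
      by (rule int_telescope)
    also have "- K + int (nat (2 * K)) = K" using K(1) by auto
    finally show ?thesis using K(2)[of K] K(3)[of "- K"] by simp
  qed
  have pq: "p = q"
  proof (cases "D = {}")
    case True
    have step: "n (of_int (k + 1) * \<alpha>) = n (of_int k * \<alpha>)" for k :: int
    proof (rule ccontr)
      assume "\<not> ?thesis"
      then have "n (red (of_int k * \<alpha>) + \<alpha>) \<noteq> n (red (of_int k * \<alpha>))"
        using nred2[of "of_int k * \<alpha>" \<alpha>] nred[of "of_int k * \<alpha>"] int_mult[OF \<alpha>] \<alpha>
        by (simp add: algebra_simps)
      then have "red (of_int k * \<alpha>) \<in> D"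
        using red_range red_in int_mult[OF \<alpha>] by (auto simp: D_def)
      then show False using True by auto
    qed
    have "n (of_int k * \<alpha>) = n (of_int (- K0) * \<alpha>)" if "k \<ge> - K0" for k
      using that by (induction rule: int_ge_induct) (use step in auto)
    from this[of K0] show ?thesis using K0 by (simp add: p_def q_def)
  next
    case False
    have "0 = (\<Sum>v\<in>D. n (v + \<alpha>) - n v)" using sum0 by (simp add: D_def)
    also have "\<dots> = (\<Sum>C\<in>cls ` D. \<Sum>v\<in>{v\<in>D. cls v = C}. n (v + \<alpha>) - n v)"
      by (rule sum.group[symmetric]) (use finD in auto)
    also have "\<dots> = (\<Sum>C\<in>cls ` D. p - q)"
      by (rule sum.cong) (use cls_eq cls_sum in auto)
    also have "\<dots> = card (cls ` D) * (p - q)" by simp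
    finally show ?thesis using False finD by auto
  qed
  (* Moving forward from an exceptional point one must meet a change, since the limit is p; moving
     backward from that change one reaches the limit q = p after finitely many steps. *)
  have "{u \<in> \<Gamma>. 0 \<le> u \<and> u < e \<and> n u \<noteq> p} \<subseteq>
     (\<Union>d\<in>D. (\<lambda>k. red (d + of_int k * \<alpha>)) ` {k. k \<le> 0 \<and> n (d + of_int k * \<alpha>) \<noteq> p})"
  proof
    fix u assume u: "u \<in> {u \<in> \<Gamma>. 0 \<le> u \<and> u < e \<and> n u \<noteq> p}"
    obtain K where K: "K \<ge> 0" "\<And>k. k \<ge> K \<Longrightarrow> n (u + of_int k * \<alpha>) = p"
      using ends[of u] u by blast
    have "\<exists>k\<ge>0. n (u + of_int (k + 1) * \<alpha>) \<noteq> n (u + of_int k * \<alpha>)"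
    proof (rule ccontr)
      assume "\<not> ?thesis"
      then have step: "n (u + of_int (k + 1) * \<alpha>) = n (u + of_int k * \<alpha>)" if "k \<ge> 0" for k :: int
        using that by auto
      have "n (u + of_int k * \<alpha>) = n (u + of_int 0 * \<alpha>)" if "k \<ge> 0" for k
        using that by (induction rule: int_ge_induct) (use step in auto)
      from this[of K] show False using K u by auto
    qed
    then obtain k :: int where k: "k \<ge> 0" "n (u + of_int (k + 1) * \<alpha>) \<noteq> n (u + of_int k * \<alpha>)" by blast
    define d where "d = red (u + of_int k * \<alpha>)"
    have uk: "u + of_int k * \<alpha> \<in> \<Gamma>" using orb u by auto
    have "d \<in> D"
      using red_range red_in[OF uk] nred[OF uk] nred2[OF uk \<alpha>] k(2)
      by (auto simp: D_def d_def algebra_simps)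
    moreover obtain m :: int where dm: "d + of_int (- k) * \<alpha> = u + of_int m * e"
      by (rule that[of "- \<lfloor>(u + of_int k * \<alpha>) / e\<rfloor>"]) (simp add: d_def red_def)
    moreover have "red (d + of_int (- k) * \<alpha>) = u"
      unfolding dm red_add_multiple using red_id u by auto
    moreover have "n (d + of_int (- k) * \<alpha>) \<noteq> p" unfolding dm using perk u by auto
    ultimately show "u \<in> (\<Union>d\<in>D. (\<lambda>k. red (d + of_int k * \<alpha>)) ` {k. k \<le> 0 \<and> n (d + of_int k * \<alpha>) \<noteq> p})"
      using k(1) by (intro UN_I[of d] image_eqI[of _ _ "- k"]) auto
  qed
  moreover have "finite {k. k \<le> 0 \<and> n (d + of_int k * \<alpha>) \<noteq> p}" if d: "d \<in> D" for d
  proof -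
    obtain K where K: "\<And>k. k \<le> - K \<Longrightarrow> n (d + of_int k * \<alpha>) = q"
      using ends[of d] d unfolding D_def by blast
    have "{k. k \<le> 0 \<and> n (d + of_int k * \<alpha>) \<noteq> p} \<subseteq> {- K..0}"
      using K pq by (auto simp: not_le[symmetric]) (meson linear)
    then show ?thesis using finite_subset by blast
  qed
  ultimately have "finite {u \<in> \<Gamma>. 0 \<le> u \<and> u < e \<and> n u \<noteq> p}"
    using finD by (auto intro: finite_subset)
  then show ?thesis by (rule that)
qed

end

section \<open>Trivialising real cocycles over the translations\<close>

context dense_subgroup
begin

definition translation_cocycle :: "(real \<Rightarrow> stein_point \<Rightarrow> real) \<Rightarrow> bool" where
  "translation_cocycle b \<longleftrightarrow> (\<forall>s\<in>\<Gamma>. locally_constant \<Gamma> (b s)) \<and>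
    (\<forall>s\<in>\<Gamma>. \<forall>t\<in>\<Gamma>. \<forall>x\<in>stein_set \<Gamma>. b (s + t) x = b s (shift t x) + b t x)"

lemma translation_cocycle_diff_coboundary:
  assumes b: "translation_cocycle b" and F: "locally_constant \<Gamma> F"
  shows "translation_cocycle (\<lambda>s x. b s x - (F (shift s x) - F x))"
  unfolding translation_cocycle_def
proof (intro conjI ballI)
  fix s assume s: "s \<in> \<Gamma>"
  have "locally_constant \<Gamma> (\<lambda>x. F (shift s x) - F x)"
    using locally_constant_compose2[OF locally_constant_shift[OF F s] F, of "(-)"] .
  then show "locally_constant \<Gamma> (\<lambda>x. b s x - (F (shift s x) - F x))"
    using b s locally_constant_compose2[of \<Gamma> "b s" _ "(-)"] by (auto simp: translation_cocycle_def)
next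
  fix s t x assume "s \<in> \<Gamma>" "t \<in> \<Gamma>" "x \<in> stein_set \<Gamma>"
  then have "b (s + t) x = b s (shift t x) + b t x"
    using b by (auto simp: translation_cocycle_def)
  then show "b (s + t) x - (F (stein_action (s + t, 1) x) - F x) =
      b s (shift t x) - (F (shift s (shift t x)) - F (shift t x)) +
      (b t x - (F (shift t x) - F x))"
    by (simp add: stein_action_action)
qed

end

context circle_rotation
begin

text \<open>The number of the period \<open>[k e, (k + 1) e]\<close> that contains a point. A multiple of \<open>e\<close> ends one
period with its lower copy and begins the next with its upper copy, hence the value at \<open>t\<^sub>-\<close>.\<close>

primrec turn :: "stein_point \<Rightarrow> int" where
  "turn (Pt r) = \<lfloor>r / e\<rfloor>"
| "turn (Minus t) = \<lceil>t / e\<rceil> - 1"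
| "turn (Plus t) = \<lfloor>t / e\<rfloor>"

lemma turn_iff:
  assumes "x \<in> stein_set \<Gamma>"
  shows "turn x = k \<longleftrightarrow> x \<in> cell \<Gamma> (of_int k * e) (of_int (k + 1) * e)"
  using assms
proof (cases rule: stein_set_cases)
  case (1 r)
  have "r \<noteq> of_int k * e" using 1 int_mult[OF e(1), of k] by auto
  then show ?thesis using 1 e(2) by (auto simp: floor_eq_iff field_simps)
next
  case (2 t)
  have "turn x = k \<longleftrightarrow> \<lceil>t / e\<rceil> = k + 1" using 2 by auto
  also have "\<dots> \<longleftrightarrow> of_int k * e < t \<and> t \<le> of_int (k + 1) * e"
    unfolding ceiling_eq_iff using e(2) by (auto simp: field_simps)
  finally show ?thesis using 2 by simp
next
  case (3 t)
  have "turn x = k \<longleftrightarrow> of_int k * e \<le> t \<and> t < of_int (k + 1) * e"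
    using 3 e(2) by (auto simp: floor_eq_iff field_simps)
  then show ?thesis using 3 by simp
qed

lemma locally_constant_turn: "locally_constant \<Gamma> turn"
  unfolding locally_constant_def
proof
  fix x assume x: "x \<in> stein_set \<Gamma>"
  then have "x \<in> cell \<Gamma> (of_int (turn x) * e) (of_int (turn x + 1) * e)"
    using turn_iff by blast
  then obtain \<epsilon> where "\<epsilon> > 0"
    "\<forall>y\<in>stein_set \<Gamma>. stein_near \<epsilon> x y \<longrightarrow> y \<in> cell \<Gamma> (of_int (turn x) * e) (of_int (turn x + 1) * e)"
    using stein_near_cell[OF int_mult[OF e(1)] int_mult[OF e(1)]] by blast
  then show "\<exists>\<epsilon>>0. \<forall>z\<in>stein_set \<Gamma>. stein_near \<epsilon> x z \<longrightarrow> turn z = turn x"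
    using turn_iff by blast
qed

lemma turn_shift: "turn (stein_action (of_int m * e, 1) x) = turn x + m"
proof -
  have "(r + of_int m * e) / e = r / e + of_int m" for r using e(2) by (simp add: field_simps)
  then show ?thesis by (cases x) simp_all
qed

lemma jump_turn: "jump (\<lambda>x. of_int (turn x)) u = (if \<exists>m::int. u = of_int m * e then 1 else 0)"
proof (cases "\<exists>m::int. u = of_int m * e")
  case True
  then obtain m :: int where "u = of_int m * e" by blast
  then have "u / e = of_int m" using e(2) by simp
  then show ?thesis using True by (simp add: jump_def)
next
  case False
  have "u / e \<notin> \<int>"
  proof
    assume "u / e \<in> \<int>"
    then obtain m where "u / e = of_int m" by (auto elim: Ints_cases)
    then show False using False e(2) by (auto simp: field_simps)
  qed
  then have "\<lceil>u / e\<rceil> = \<lfloor>u / e\<rfloor> + 1" by (metis Ints_of_int ceiling_altdef) 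
  then show ?thesis using False by (simp add: jump_def)
qed

text \<open>A periodic function returns to its value after one turn around the circle, so its jumps cancel.\<close>

lemma periodic_jumps:
  assumes f: "locally_constant \<Gamma> f"
    and per: "\<And>x. x \<in> stein_set \<Gamma> \<Longrightarrow> f (shift e x) = f x"
  shows "finite {u \<in> \<Gamma>. 0 \<le> u \<and> u < e \<and> jump f u \<noteq> 0}"
    and "(\<Sum>u | u \<in> \<Gamma> \<and> 0 \<le> u \<and> u < e \<and> jump f u \<noteq> 0. jump f u) = 0"
proof -
  let ?D = "{u \<in> \<Gamma>. 0 < u \<and> u < e \<and> jump f u \<noteq> 0}"
  have fin: "finite ?D" and f0: "f (Minus e) = f (Plus 0) + (\<Sum>u\<in>?D. jump f u)"
    using jumps_between[OF dense f zero e] by auto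
  have D: "{u \<in> \<Gamma>. 0 \<le> u \<and> u < e \<and> jump f u \<noteq> 0} = {u. u = 0 \<and> jump f u \<noteq> 0} \<union> ?D"
    using e by auto
  have fin0: "finite {u. u = 0 \<and> jump f u \<noteq> 0}" by (rule finite_subset[of _ "{0}"]) auto
  show "finite {u \<in> \<Gamma>. 0 \<le> u \<and> u < e \<and> jump f u \<noteq> 0}"
    unfolding D using fin fin0 by simp
  have "f (Minus e) = f (Minus 0)" using per[of "Minus 0"] by simp
  then have "jump f 0 + (\<Sum>u\<in>?D. jump f u) = 0" using f0 by (simp add: jump_def)
  moreover have "(\<Sum>u\<in>{u. u = 0 \<and> jump f u \<noteq> 0}. jump f u) = (\<Sum>u\<in>{0}. jump f u)"
    by (rule sum.mono_neutral_left) auto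
  moreover have "(\<Sum>u\<in>{u. u = 0 \<and> jump f u \<noteq> 0} \<union> ?D. jump f u) =
      (\<Sum>u\<in>{u. u = 0 \<and> jump f u \<noteq> 0}. jump f u) + (\<Sum>u\<in>?D. jump f u)"
    by (rule sum.union_disjoint) (use fin fin0 in auto)
  ultimately show "(\<Sum>u | u \<in> \<Gamma> \<and> 0 \<le> u \<and> u < e \<and> jump f u \<noteq> 0. jump f u) = 0"
    unfolding D by simp
qed

text \<open>The function vanishes on the first period and is continued to the others by the cocycle equation.
It is written in terms of the cocycle evaluated at the number of turns.\<close>

lemma normalise_period:
  assumes b: "translation_cocycle b"
  obtains F where "locally_constant \<Gamma> F"
    "\<And>x. x \<in> stein_set \<Gamma> \<Longrightarrow> b e x = F (shift e x) - F x"
proof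
  define F where "F x = - b (- of_int (turn x) * e) x" for x
  have me: "of_int k * e \<in> \<Gamma>" for k using int_mult[OF e(1)] .
  have lcb: "locally_constant \<Gamma> (b s)" if "s \<in> \<Gamma>" for s
    using b that by (auto simp: translation_cocycle_def)
  show "locally_constant \<Gamma> F"
    unfolding locally_constant_def
  proof
    fix x assume x: "x \<in> stein_set \<Gamma>"
    have "locally_constant \<Gamma> (\<lambda>z. (turn z, b (- of_int (turn x) * e) z))"
      using me[of "- turn x"] by (intro locally_constant_pair locally_constant_turn lcb) simp
    then obtain \<epsilon> where "\<epsilon> > 0" "\<And>z. z \<in> stein_set \<Gamma> \<Longrightarrow> stein_near \<epsilon> x z \<Longrightarrow>
       (turn z, b (- of_int (turn x) * e) z) = (turn x, b (- of_int (turn x) * e) x)"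
      using locally_constantD[OF _ x] by blast
    then show "\<exists>\<epsilon>>0. \<forall>z\<in>stein_set \<Gamma>. stein_near \<epsilon> x z \<longrightarrow> F z = F x"
      unfolding F_def by (intro exI[of _ \<epsilon>]) auto
  qed
  fix x assume x: "x \<in> stein_set \<Gamma>"
  have coc: "b (s + t) x = b s (shift t x) + b t x" if "s \<in> \<Gamma>" "t \<in> \<Gamma>" for s t
    using b x that by (auto simp: translation_cocycle_def)
  have "turn (shift e x) = turn x + 1" using turn_shift[of 1 x] by simp
  then have "F (shift e x) = - b (- of_int (turn x + 1) * e) (shift e x)"
    by (simp add: F_def)
  moreover have "b (- of_int (turn x + 1) * e + e) x =
      b (- of_int (turn x + 1) * e) (shift e x) + b e x"
    using me[of "- (turn x + 1)"] by (intro coc e) simp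
  moreover have "- of_int (turn x + 1) * e + e = - of_int (turn x) * e" by (simp add: algebra_simps)
  ultimately show "b e x = F (shift e x) - F x" by (simp add: F_def)
qed

text \<open>Up to coboundaries, a cocycle over the translations is a homomorphism \<open>\<rho>\<close>. After the period
\<open>e\<close> has been normalised, the cocycle consists of functions on a circle, and its jumps satisfy
\<open>J\<^sub>s(u) = n(u + s) - n(u)\<close> with \<open>n(u) = J\<^sub>u(0)\<close>. Since the jumps around the circle cancel,
\<open>n\<close> equals a constant \<open>p\<close> outside a finite set modulo \<open>e\<close>. A locally constant function with jumps \<open>n - p\<close> therefore
exists; subtracting its coboundary leaves functions without jumps, which are constants.\<close>

theorem translation_cocycle_trivial:
  assumes b: "translation_cocycle b"
  obtains F \<rho> where "locally_constant \<Gamma> F"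
    "\<And>s x. s \<in> \<Gamma> \<Longrightarrow> x \<in> stein_set \<Gamma> \<Longrightarrow> b s x = F (shift s x) - F x + \<rho> s"
proof -
  obtain F0 where F0: "locally_constant \<Gamma> F0"
    "\<And>x. x \<in> stein_set \<Gamma> \<Longrightarrow> b e x = F0 (shift e x) - F0 x"
    using normalise_period[OF b] by blast
  define c where "c s x = b s x - (F0 (shift s x) - F0 x)" for s x
  have "translation_cocycle c"
    using translation_cocycle_diff_coboundary[OF b F0(1)] unfolding c_def .
  then have lcc: "locally_constant \<Gamma> (c s)" if "s \<in> \<Gamma>" for s
    using that by (auto simp: translation_cocycle_def)
  have coc: "c (s + t) x = c s (shift t x) + c t x"
    if "s \<in> \<Gamma>" "t \<in> \<Gamma>" "x \<in> stein_set \<Gamma>" for s t x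
    using \<open>translation_cocycle c\<close> that by (auto simp: translation_cocycle_def)
  have ce: "c e x = 0" if "x \<in> stein_set \<Gamma>" for x using F0(2)[OF that] by (simp add: c_def)
  have per: "c s (shift e x) = c s x" if "s \<in> \<Gamma>" "x \<in> stein_set \<Gamma>" for s x
    using coc[OF that(1) e(1) that(2)] coc[OF e(1) that(1) that(2)] ce[of x] ce[of "shift s x"] that
    by (simp add: add.commute)
  define n where "n u = jump (c u) 0" for u
  have J: "jump (c s) u = n (u + s) - n u" if "s \<in> \<Gamma>" "u \<in> \<Gamma>" for s u
    using coc[OF that, of "Plus 0"] coc[OF that, of "Minus 0"]
    by (simp add: n_def jump_def add.commute)
  have n_per: "n (u + e) = n u" if "u \<in> \<Gamma>" for u
    using J[OF e(1) that] ce[of "Plus u"] ce[of "Minus u"] that by (simp add: jump_def)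
  have D: "{u \<in> \<Gamma>. 0 \<le> u \<and> u < e \<and> n (u + s) \<noteq> n u} = {u \<in> \<Gamma>. 0 \<le> u \<and> u < e \<and> jump (c s) u \<noteq> 0}"
    if "s \<in> \<Gamma>" for s using J[OF that] by auto
  have fin: "finite {u \<in> \<Gamma>. 0 \<le> u \<and> u < e \<and> n (u + s) \<noteq> n u}" if "s \<in> \<Gamma>" for s
    unfolding D[OF that] using periodic_jumps(1)[OF lcc per] that by blast
  have "(\<Sum>u | u \<in> \<Gamma> \<and> 0 \<le> u \<and> u < e \<and> n (u + \<alpha>) \<noteq> n u. n (u + \<alpha>) - n u) =
      (\<Sum>u | u \<in> \<Gamma> \<and> 0 \<le> u \<and> u < e \<and> jump (c \<alpha>) u \<noteq> 0. jump (c \<alpha>) u)"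
    using D[OF \<alpha>] J[OF \<alpha>] by (intro sum.cong) auto
  also have "\<dots> = 0" using periodic_jumps(2)[OF lcc per] \<alpha> by blast
  finally obtain p where finp: "finite {u \<in> \<Gamma>. 0 \<le> u \<and> u < e \<and> n u \<noteq> p}"
    using almost_invariant_cofinite[OF n_per fin] by blast
  define S where "S = {u \<in> \<Gamma>. 0 \<le> u \<and> u < e \<and> n u \<noteq> p}"
  (* Each summand is a staircase with jump n d - p at the points congruent to d modulo e. *)
  define F1 where "F1 x = (\<Sum>d\<in>S. (n d - p) * of_int (turn (stein_action (- d, 1) x)))" for x
  have "locally_constant \<Gamma> (\<lambda>x. (n d - p) * of_int (turn (stein_action (- d, 1) x)))" if "d \<in> S" for d
    using locally_constant_compose[OF locally_constant_shift[OF locally_constant_turn minus],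
        of d "\<lambda>k. (n d - p) * of_int k"] that by (simp add: S_def)
  then have lcF1: "locally_constant \<Gamma> F1"
    unfolding F1_def by (rule locally_constant_sum)
  have nk: "n (u + of_int k * e) = n u" if "u \<in> \<Gamma>" for u k
    by (rule periodic_multiple[of n, OF n_per that])
  have jF1: "jump F1 u = n u - p" if u: "u \<in> \<Gamma>" for u
  proof -
    have "jump F1 u = (\<Sum>d\<in>S. (n d - p) * jump (\<lambda>x. of_int (turn x)) (u - d))"
      by (simp add: F1_def jump_def sum_subtractf[symmetric] right_diff_distrib)
    also have "\<dots> = (\<Sum>d\<in>S. if d = red u then n u - p else 0)"
    proof (rule sum.cong[OF refl])
      fix d assume d: "d \<in> S"
      have "(\<exists>m::int. u - d = of_int m * e) \<longleftrightarrow> d = red u"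
      proof
        assume "\<exists>m::int. u - d = of_int m * e"
        then obtain m :: int where "u = d + of_int m * e" by (auto simp: algebra_simps)
        then show "d = red u" using red_add_multiple[of d m] red_id[of d] d by (simp add: S_def)
      qed (auto simp: red_def)
      moreover have "n d = n u" if "d = red u"
        using nk[OF u, of "- \<lfloor>u / e\<rfloor>"] that by (simp add: red_def)
      ultimately show "(n d - p) * jump (\<lambda>x. of_int (turn x)) (u - d) = (if d = red u then n u - p else 0)"
        by (auto simp: jump_turn)
    qed
    also have "\<dots> = (if red u \<in> S then n u - p else 0)"
      using finp by (simp add: S_def sum.delta)
    also have "\<dots> = n u - p"
      using nk[OF u, of "- \<lfloor>u / e\<rfloor>"] red_range[of u] red_in[OF u] by (simp add: S_def red_def)
    finally show ?thesis .
  qed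
  define \<rho> where "\<rho> s = c s (Plus 0) - (F1 (shift s (Plus 0)) - F1 (Plus 0))" for s
  show ?thesis
  proof (rule that)
    show "locally_constant \<Gamma> (\<lambda>x. F0 x + F1 x)"
      by (rule locally_constant_compose2[OF F0(1) lcF1])
    fix s x assume s: "s \<in> \<Gamma>" and x: "x \<in> stein_set \<Gamma>"
    let ?r = "\<lambda>x. c s x - (F1 (shift s x) - F1 x)"
    have "?r x = ?r (Plus 0)"
    proof (rule no_jumps_imp_constant[OF dense _ _ x])
      show "locally_constant \<Gamma> ?r"
        using translation_cocycle_diff_coboundary[OF \<open>translation_cocycle c\<close> lcF1] s
        by (auto simp: translation_cocycle_def)
      fix u assume u: "u \<in> \<Gamma>"
      have "jump ?r u = jump (c s) u - (jump F1 (u + s) - jump F1 u)" by (simp add: jump_def)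
      then show "jump ?r u = 0" using J[OF s u] jF1[OF u] jF1[OF add[OF u s]] by simp
    qed simp
    then show "b s x = F0 (shift s x) + F1 (shift s x) - (F0 x + F1 x) + \<rho> s"
      by (simp add: \<rho>_def c_def)
  qed
qed

end

section \<open>Lebesgue measure on the split line\<close>

text \<open>Lebesgue measure of a subset of the split line. The split points are left out; they lie over a
countable set, and omitting them turns disjoint unions into disjoint unions.\<close>

definition trace_measure :: "stein_point set \<Rightarrow> ennreal" where
  "trace_measure T = emeasure lborel {y. Pt y \<in> T}"

lemma trace_borel:
  assumes d: "closure \<Gamma> = UNIV" and c: "countable \<Gamma>" and T: "stein_open \<Gamma> T"
  shows "{y. Pt y \<in> T} \<in> sets borel"
proof -
  have sub: "T \<subseteq> stein_set \<Gamma>"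
    and nb: "\<And>x. x \<in> T \<Longrightarrow> \<exists>\<epsilon>>0. \<forall>z\<in>stein_set \<Gamma>. stein_near \<epsilon> x z \<longrightarrow> z \<in> T"
    using T by (auto simp: openin_stein_space_iff[OF d])
  have "{y. Pt y \<in> T} = interior {y. y \<in> \<Gamma> \<or> Pt y \<in> T} - \<Gamma>"
  proof (intro equalityI subsetI)
    fix y assume y: "y \<in> {y. Pt y \<in> T}"
    then obtain \<epsilon> where e: "\<epsilon> > 0" "\<forall>z\<in>stein_set \<Gamma>. stein_near \<epsilon> (Pt y) z \<longrightarrow> z \<in> T"
      using nb by blast
    have "ball y \<epsilon> \<subseteq> {y. y \<in> \<Gamma> \<or> Pt y \<in> T}"
    proof
      fix z assume "z \<in> ball y \<epsilon>"
      then have "stein_near \<epsilon> (Pt y) (Pt z)" by (simp add: dist_real_def abs_minus_commute)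
      then show "z \<in> {y. y \<in> \<Gamma> \<or> Pt y \<in> T}" using e(2)[rule_format, of "Pt z"] by auto
    qed
    then have "y \<in> interior {y. y \<in> \<Gamma> \<or> Pt y \<in> T}"
      using e(1) by (meson centre_in_ball mem_interior)
    moreover have "y \<notin> \<Gamma>" using y sub by auto
    ultimately show "y \<in> interior {y. y \<in> \<Gamma> \<or> Pt y \<in> T} - \<Gamma>" by simp
  next
    fix y assume "y \<in> interior {y. y \<in> \<Gamma> \<or> Pt y \<in> T} - \<Gamma>"
    then show "y \<in> {y. Pt y \<in> T}" using interior_subset by auto
  qed
  moreover have "\<Gamma> \<in> sets borel" by (rule sets.countable) (use c in auto)
  ultimately show ?thesis by auto
qed

lemma trace_measurable:
  fixes G :: "stein_point \<Rightarrow> real"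
  assumes d: "closure \<Gamma> = UNIV" and c: "countable \<Gamma>" and G: "locally_constant \<Gamma> G"
  shows "(\<lambda>y. G (Pt y)) \<in> borel_measurable borel"
proof (rule measurableI)
  fix B :: "real set"
  have "(\<lambda>y. G (Pt y)) -` B \<inter> space borel =
      {y. Pt y \<in> {z \<in> stein_set \<Gamma>. G z \<in> B}} \<union> {y \<in> \<Gamma>. G (Pt y) \<in> B}" by auto
  moreover have "{y. Pt y \<in> {z \<in> stein_set \<Gamma>. G z \<in> B}} \<in> sets borel"
    by (rule trace_borel[OF d c openin_locally_constant[OF d G]])
  moreover have "countable {y \<in> \<Gamma>. G (Pt y) \<in> B}"
    using c by (rule countable_subset[rotated]) auto
  then have "{y \<in> \<Gamma>. G (Pt y) \<in> B} \<in> sets borel"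
    by (rule sets.countable[rotated]) auto
  ultimately show "(\<lambda>y. G (Pt y)) -` B \<inter> space borel \<in> sets borel"
    by (simp only: sets.Un)
qed auto

lemma trace_measure_cell:
  assumes c: "countable \<Gamma>" and "a \<le> b"
  shows "trace_measure (cell \<Gamma> a b) = ennreal (b - a)"
proof -
  have "{y. Pt y \<in> cell \<Gamma> a b} = {a<..<b} - \<Gamma>" by auto
  moreover have "\<Gamma> \<in> null_sets lborel" using c countable_imp_null_set_lborel by blast
  ultimately show ?thesis
    using assms emeasure_Diff_null_set[of \<Gamma> lborel "{a<..<b}"] by (simp add: trace_measure_def)
qed

lemma trace_measure_pos:
  assumes d: "closure \<Gamma> = UNIV" and c: "countable \<Gamma>" and T: "stein_open \<Gamma> T" "x \<in> T"
  shows "trace_measure T > 0"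
proof -
  obtain \<epsilon> where e: "\<epsilon> > 0" "\<And>z. z \<in> stein_set \<Gamma> \<Longrightarrow> stein_near \<epsilon> x z \<Longrightarrow> z \<in> T"
    using T by (auto simp: openin_stein_space_iff[OF d])
  obtain u v where uv: "u < v" "\<And>y. u < y \<Longrightarrow> y < v \<Longrightarrow> stein_near \<epsilon> x (Pt y)"
  proof (cases x)
    case (Pt r)
    show ?thesis by (rule that[of r "r + \<epsilon>"]) (use e Pt in auto)
  next
    case (Minus r)
    show ?thesis by (rule that[of "r - \<epsilon>" r]) (use e Minus in auto)
  next
    case (Plus r)
    show ?thesis by (rule that[of r "r + \<epsilon>"]) (use e Plus in auto)
  qed
  have "{u<..<v} - \<Gamma> \<subseteq> {y. Pt y \<in> T}" using uv e by auto
  then have "emeasure lborel ({u<..<v} - \<Gamma>) \<le> trace_measure T"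
    unfolding trace_measure_def using trace_borel[OF d c T(1)] by (intro emeasure_mono) auto
  moreover have "\<Gamma> \<in> null_sets lborel" using c countable_imp_null_set_lborel by blast
  then have "emeasure lborel ({u<..<v} - \<Gamma>) = ennreal (v - u)"
    using uv emeasure_Diff_null_set[of \<Gamma> lborel "{u<..<v}"] by simp
  ultimately show ?thesis using uv(1) by (metis diff_gt_0_iff_gt ennreal_less_zero_iff order_less_le_trans)
qed

lemma trace_measure_action:
  assumes "{y. Pt y \<in> T} \<in> sets borel" "snd g > 0"
  shows "trace_measure (stein_action g ` T) = ennreal (snd g) * trace_measure T"
proof -
  have eq: "Pt (fst g + snd g * y) \<in> stein_action g ` T \<longleftrightarrow> Pt y \<in> T" for y
  proof
    assume "Pt (fst g + snd g * y) \<in> stein_action g ` T"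
    then obtain z where "z \<in> T" "Pt (fst g + snd g * y) = stein_action g z" by auto
    then show "Pt y \<in> T" using assms(2) by (cases z) auto
  next
    assume "Pt y \<in> T"
    then show "Pt (fst g + snd g * y) \<in> stein_action g ` T"
      by (intro image_eqI[of _ _ "Pt y"]) auto
  qed
  have "{y. Pt y \<in> stein_action g ` T} = (\<lambda>y. (y - fst g) / snd g) -` {y. Pt y \<in> T} \<inter> space borel"
    using eq[of "(_ - fst g) / snd g"] assms(2) by auto
  also have "\<dots> \<in> sets borel"
    by (rule measurable_sets[OF _ assms(1)]) simp
  finally have m: "{y. Pt y \<in> stein_action g ` T} \<in> sets borel" .
  have "trace_measure (stein_action g ` T) =
      (\<integral>\<^sup>+y. indicator {y. Pt y \<in> stein_action g ` T} y \<partial>lborel)"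
    using m by (simp add: trace_measure_def)
  also have "\<dots> = \<bar>snd g\<bar> * (\<integral>\<^sup>+y. indicator {y. Pt y \<in> stein_action g ` T} (fst g + snd g * y) \<partial>lborel)"
    using m assms(2) by (intro nn_integral_real_affine) auto
  also have "(\<lambda>y. indicator {y. Pt y \<in> stein_action g ` T} (fst g + snd g * y) :: ennreal) = indicator {y. Pt y \<in> T}"
    using eq by (auto simp: indicator_def fun_eq_iff)
  finally show ?thesis using assms by (simp add: trace_measure_def)
qed

section \<open>Additive set functions\<close>

text \<open>Clopen bounded sets are finite unions of cells. Hence, if a finitely additive set function takes
values in \<open>k \<Gamma>\<close> on cells, it does so on these sets as well. The decomposition is left
implicit: the claim is proved for the intersections with cells, by induction over cells.\<close>

lemma clopen_value:
  fixes \<mu> :: "stein_point set \<Rightarrow> ennreal"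
  assumes "dense_subgroup \<Gamma>"
    and T: "stein_open \<Gamma> T" "stein_open \<Gamma> (stein_set \<Gamma> - T)"
    and \<mu>: "\<And>S S'. stein_open \<Gamma> S \<Longrightarrow> stein_open \<Gamma> S' \<Longrightarrow> S \<inter> S' = {} \<Longrightarrow>
        \<mu> (S \<union> S') = \<mu> S + \<mu> S'"
    and empty: "\<mu> {} = 0"
    and cell: "\<And>a b. a \<in> \<Gamma> \<Longrightarrow> b \<in> \<Gamma> \<Longrightarrow> a \<le> b \<Longrightarrow> \<mu> (cell \<Gamma> a b) = ennreal (k * (b - a))"
    and k: "k \<ge> 0"
    and ab: "a \<in> \<Gamma>" "b \<in> \<Gamma>" "a \<le> b" and sub: "T \<subseteq> cell \<Gamma> a b"
  obtains v where "v \<in> \<Gamma>" "v \<ge> 0" "\<mu> T = ennreal (k * v)"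
proof -
  interpret dense_subgroup \<Gamma> by fact
  define R where "R a b \<longleftrightarrow> (\<exists>v\<in>\<Gamma>. v \<ge> 0 \<and> \<mu> (T \<inter> cell \<Gamma> a b) = ennreal (k * v))" for a b
  have "R a b"
  proof (rule cell_induct[OF dense, of R])
    fix a b c assume *: "a \<in> \<Gamma>" "b \<in> \<Gamma>" "c \<in> \<Gamma>" "a \<le> b" "b \<le> c" "R a b" "R b c"
    then obtain v v' where v: "v \<in> \<Gamma>" "v \<ge> 0" "\<mu> (T \<inter> cell \<Gamma> a b) = ennreal (k * v)"
        "v' \<in> \<Gamma>" "v' \<ge> 0" "\<mu> (T \<inter> cell \<Gamma> b c) = ennreal (k * v')" by (auto simp: R_def)
    have "T \<inter> cell \<Gamma> a c = (T \<inter> cell \<Gamma> a b) \<union> (T \<inter> cell \<Gamma> b c)"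
      using cell_split(1)[of a b c \<Gamma>] * by blast
    then have "\<mu> (T \<inter> cell \<Gamma> a c) = \<mu> (T \<inter> cell \<Gamma> a b) + \<mu> (T \<inter> cell \<Gamma> b c)"
      using cell_split(2)[of a b c \<Gamma>] * T openin_cell[OF dense] by (simp add: \<mu> openin_Int disjoint_iff)
    also have "\<dots> = ennreal (k * (v + v'))"
      using v k by (simp add: distrib_left)
    finally show "R a c" unfolding R_def using v add by (intro bexI[of _ "v + v'"]) auto
  next
    fix x assume x: "x \<in> stein_set \<Gamma>"
    show "on_small_cells \<Gamma> x R"
    proof (cases "x \<in> T")
      case True
      have "R a b" if "a \<in> \<Gamma>" "b \<in> \<Gamma>" "a \<le> b" "cell \<Gamma> a b \<subseteq> T" for a b
        unfolding R_def using that cell[of a b] diff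
        by (intro bexI[of _ "b - a"]) (auto simp: Int_absorb1)
      then show ?thesis by (rule on_small_cellsI[OF T(1) True])
    next
      case False
      have "R a b" if "cell \<Gamma> a b \<subseteq> stein_set \<Gamma> - T" for a b
      proof -
        have "T \<inter> cell \<Gamma> a b = {}" using that by blast
        then show ?thesis unfolding R_def using empty by (intro bexI[of _ 0]) auto
      qed
      moreover have "x \<in> stein_set \<Gamma> - T" using False x by blast
      ultimately show ?thesis by (intro on_small_cellsI[OF T(2)])
    qed
  qed (use ab in auto)
  then show ?thesis using that sub by (auto simp: R_def Int_absorb2)
qed

text \<open>Comparing \<open>n t\<close> with the neighbouring multiples of \<open>e\<close> bounds \<open>n\<close> times the deviation from linearity by
\<open>f e\<close>, for every \<open>n\<close>.\<close>

lemma additive_imp_linear: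
  fixes f :: "real \<Rightarrow> real"
  assumes "dense_subgroup \<Gamma>"
    and add: "\<And>s t. s \<in> \<Gamma> \<Longrightarrow> t \<in> \<Gamma> \<Longrightarrow> s \<ge> 0 \<Longrightarrow> t \<ge> 0 \<Longrightarrow> f (s + t) = f s + f t"
    and nonneg: "\<And>t. t \<in> \<Gamma> \<Longrightarrow> t \<ge> 0 \<Longrightarrow> f t \<ge> 0"
    and e: "e \<in> \<Gamma>" "e > 0" and t: "t \<in> \<Gamma>" "t \<ge> 0"
  shows "f t = f e / e * t"
proof -
  interpret dense_subgroup \<Gamma> by fact
  have mult: "real m * s \<in> \<Gamma>" "f (real m * s) = real m * f s" if "s \<in> \<Gamma>" "s \<ge> 0" for s m
  proof -
    show in_\<Gamma>: "real m * s \<in> \<Gamma>" for m using int_mult[OF that(1), of "int m"] by simp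
    show "f (real m * s) = real m * f s"
    proof (induction m)
      case 0
      have "f (0 + 0) = f 0 + f 0" by (rule assms(2)) auto
      then show ?case by simp
    next
      case (Suc m)
      then show ?case using assms(2)[OF in_\<Gamma>[of m] that(1)] that by (simp add: algebra_simps)
    qed
  qed
  have mono: "f s \<le> f t" if "s \<in> \<Gamma>" "t \<in> \<Gamma>" "0 \<le> s" "s \<le> t" for s t
    using assms(2)[of s "t - s"] nonneg[of "t - s"] diff[of t s] that by simp
  have "\<bar>f t - f e / e * t\<bar> = 0"
  proof (rule real_archimedian_rdiv_eq_0[of _ "f e"])
    fix n :: nat assume "n > 0"
    define m where "m = nat \<lfloor>real n * t / e\<rfloor>"
    have m: "real m \<le> real n * t / e" "real n * t / e < real m + 1"
      using t e by (auto simp: m_def)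
    then have m': "real m * e \<le> real n * t" "real n * t \<le> real (Suc m) * e"
      using e by (auto simp: field_simps)
    have "real m * f e \<le> real n * f t" "real n * f t \<le> real (Suc m) * f e"
      using mono[OF mult(1)[of e m] mult(1)[of t n]] mono[OF mult(1)[of t n] mult(1)[of e "Suc m"]]
        m' e t mult(2)[of e m] mult(2)[of t n] mult(2)[of e "Suc m"] by auto
    moreover have "real m * f e \<le> (real n * t / e) * f e" "(real n * t / e) * f e \<le> real (Suc m) * f e"
      using m nonneg[OF e(1)] e(2) mult_right_mono[of "real m" "real n * t / e" "f e"]
        mult_right_mono[of "real n * t / e" "real (Suc m)" "f e"] by auto
    ultimately have "\<bar>real n * f t - (real n * t / e) * f e\<bar> \<le> f e"
      by (simp add: algebra_simps abs_le_iff)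
    moreover have "real n * f t - (real n * t / e) * f e = real n * (f t - f e / e * t)"
      by (simp add: algebra_simps)
    ultimately show "real n * \<bar>f t - f e / e * t\<bar> \<le> f e"
      by (simp add: abs_mult)
  qed simp
  then show ?thesis by simp
qed

text \<open>Division with remainder by a small element of \<open>\<Gamma>\<close> shows that small elements generate \<open>\<Gamma>\<close>.\<close>

lemma (in dense_subgroup) generated_by_small:
  assumes "\<epsilon> > 0" and small: "\<And>a. a \<in> \<Gamma> \<Longrightarrow> 0 < a \<Longrightarrow> a < \<epsilon> \<Longrightarrow> P a"
    and P0: "P 0" and Padd: "\<And>a b. P a \<Longrightarrow> P b \<Longrightarrow> P (a + b)" and Pminus: "\<And>a. P a \<Longrightarrow> P (- a)"
    and a: "a \<in> \<Gamma>"
  shows "P a"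
proof -
  obtain d where d: "d \<in> \<Gamma>" "0 < d" "d < \<epsilon>" using dense_between[OF dense \<open>\<epsilon> > 0\<close>] by blast
  have "P (of_int k * d)" for k
  proof (induction k rule: int_induct[of _ 0])
    case (step1 i)
    have "P (of_int i * d + d)" by (rule Padd[OF step1(2) small[OF d]])
    then show ?case by (simp add: algebra_simps)
  next
    case (step2 i)
    have "P (of_int i * d + - d)" by (rule Padd[OF step2(2) Pminus[OF small[OF d]]])
    then show ?case by (simp add: algebra_simps)
  qed (use P0 in auto)
  moreover define r where "r = a - of_int \<lfloor>a / d\<rfloor> * d"
  have "of_int \<lfloor>a / d\<rfloor> * d \<le> a" "a < (of_int \<lfloor>a / d\<rfloor> + 1) * d"
    using d(2) by (simp_all only: pos_le_divide_eq[symmetric] pos_divide_less_eq[symmetric]) linarith+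
  then have "0 \<le> r" "r < d" by (auto simp: r_def algebra_simps)
  moreover have "r \<in> \<Gamma>" using a d int_mult diff by (auto simp: r_def)
  ultimately have "P r" using small[of r] P0 d by (cases "r = 0") auto
  then have "P (r + of_int \<lfloor>a / d\<rfloor> * d)" using Padd \<open>\<And>k. P (of_int k * d)\<close> by blast
  then show ?thesis by (simp add: r_def)
qed

section \<open>Orbit maps\<close>

definition affine_inverse :: "real \<times> real \<Rightarrow> real \<times> real" where
  "affine_inverse g = (- (inverse (snd g) * fst g), inverse (snd g))"

locale stein_system = dense_subgroup +
  fixes \<Lambda> :: "real set"
  assumes \<Lambda>_pos: "l \<in> \<Lambda> \<Longrightarrow> l > 0"
    and \<Lambda>_one [simp]: "1 \<in> \<Lambda>"
    and \<Lambda>_mult: "l \<in> \<Lambda> \<Longrightarrow> m \<in> \<Lambda> \<Longrightarrow> l * m \<in> \<Lambda>"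
    and \<Lambda>_inverse: "l \<in> \<Lambda> \<Longrightarrow> inverse l \<in> \<Lambda>"
    and scale: "l \<in> \<Lambda> \<Longrightarrow> t \<in> \<Gamma> \<Longrightarrow> l * t \<in> \<Gamma>"
    and count: "countable \<Gamma>"
begin

lemma scale_iff: "l \<in> \<Lambda> \<Longrightarrow> l * t \<in> \<Gamma> \<longleftrightarrow> t \<in> \<Gamma>"
  using scale[of l t] scale[OF \<Lambda>_inverse, of l "l * t"] \<Lambda>_pos[of l]
  by (auto simp: mult.assoc[symmetric])

lemma action_in [simp]:
  "g \<in> \<Gamma> \<times> \<Lambda> \<Longrightarrow> stein_action g x \<in> stein_set \<Gamma> \<longleftrightarrow> x \<in> stein_set \<Gamma>"
  by (cases x) (auto simp: add_cancel scale_iff)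

lemma affine_inverse_in: "g \<in> \<Gamma> \<times> \<Lambda> \<Longrightarrow> affine_inverse g \<in> \<Gamma> \<times> \<Lambda>"
  by (auto simp: affine_inverse_def \<Lambda>_inverse scale minus)

lemma action_affine_inverse [simp]:
  "g \<in> \<Gamma> \<times> \<Lambda> \<Longrightarrow> stein_action (affine_inverse g) (stein_action g x) = x"
  "g \<in> \<Gamma> \<times> \<Lambda> \<Longrightarrow> stein_action g (stein_action (affine_inverse g) x) = x"
  using \<Lambda>_pos[of "snd g"] by (cases x; auto simp: affine_inverse_def field_simps)+

lemma locally_constant_action:
  assumes "locally_constant \<Gamma> f" "g \<in> \<Gamma> \<times> \<Lambda>"
  shows "locally_constant \<Gamma> (\<lambda>x. f (stein_action g x))"
  using locally_constant_precompose[OF assms(1), of g] assms(2) \<Lambda>_pos[of "snd g"] by auto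

lemma openin_action_image:
  assumes "stein_open \<Gamma> S" "g \<in> \<Gamma> \<times> \<Lambda>"
  shows "stein_open \<Gamma> (stein_action g ` S)"
proof -
  have g: "snd g > 0" using assms(2) \<Lambda>_pos by auto
  have S: "S \<subseteq> stein_set \<Gamma>" "\<And>x. x \<in> S \<Longrightarrow> \<exists>\<epsilon>>0. \<forall>z\<in>stein_set \<Gamma>. stein_near \<epsilon> x z \<longrightarrow> z \<in> S"
    using assms(1) by (auto simp: openin_stein_space_iff[OF dense])
  have "\<exists>\<epsilon>>0. \<forall>z\<in>stein_set \<Gamma>. stein_near \<epsilon> (stein_action g x) z \<longrightarrow> z \<in> stein_action g ` S" if x: "x \<in> S" for x
  proof -
    obtain \<epsilon> where e: "\<epsilon> > 0" "\<And>z. z \<in> stein_set \<Gamma> \<Longrightarrow> stein_near \<epsilon> x z \<Longrightarrow> z \<in> S"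
      using S(2)[OF x] by blast
    let ?i = "affine_inverse g"
    have i: "?i \<in> \<Gamma> \<times> \<Lambda>" "snd ?i > 0" using affine_inverse_in[OF assms(2)] \<Lambda>_pos by auto
    have "z \<in> stein_action g ` S" if "z \<in> stein_set \<Gamma>" "stein_near (\<epsilon> / snd ?i) (stein_action g x) z" for z
    proof -
      have "stein_near \<epsilon> x (stein_action ?i z)"
        using stein_near_action[OF i(2) that(2)] i(2) assms(2) by simp
      then have "stein_action ?i z \<in> S" using e(2) that(1) action_in[OF i(1), of z] by blast
      then show ?thesis using assms(2) by (metis action_affine_inverse(2) imageI)
    qed
    then show ?thesis using e(1) i(2) by (intro exI[of _ "\<epsilon> / snd ?i"]) auto
  qed
  then show ?thesis using S(1) assms(2) by (auto simp: openin_stein_space_iff[OF dense])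
qed

lemma cell_action:
  assumes "g \<in> \<Gamma> \<times> \<Lambda>"
  shows "stein_action g ` cell \<Gamma> a b = cell \<Gamma> (snd g * a + fst g) (snd g * b + fst g)"
proof -
  have g: "snd g > 0" using assms \<Lambda>_pos by auto
  have *: "stein_action g x \<in> cell \<Gamma> (snd g * a + fst g) (snd g * b + fst g) \<longleftrightarrow> x \<in> cell \<Gamma> a b" for x
    using action_in[OF assms, of x] g by (cases x) auto
  show ?thesis
  proof (intro equalityI subsetI)
    fix z assume "z \<in> cell \<Gamma> (snd g * a + fst g) (snd g * b + fst g)"
    then have "stein_action (affine_inverse g) z \<in> cell \<Gamma> a b"
      using *[of "stein_action (affine_inverse g) z"] assms by simp
    then show "z \<in> stein_action g ` cell \<Gamma> a b" using assms by (metis action_affine_inverse(2) imageI)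
  qed (use * in auto)
qed

end

text \<open>What an isomorphism of Stein groupoids amounts to: a homeomorphism \<open>h\<close> that maps orbits to orbits,
with a locally constant cocycle \<open>C\<close> that says which element of the second group realises the
motion. Only the dilation component of \<open>C\<close> is required to be multiplicative, since only this
component enters the change of the measure.\<close>

locale orbit_map = A: stein_system \<Gamma> \<Lambda> + B: stein_system \<Gamma>' \<Lambda>'
  for \<Gamma> \<Lambda> \<Gamma>' \<Lambda>' +
  fixes h p :: "stein_point \<Rightarrow> stein_point" and C :: "real \<times> real \<Rightarrow> stein_point \<Rightarrow> real \<times> real"
  assumes homeo: "homeomorphic_maps (stein_space \<Gamma>) (stein_space \<Gamma>') h p"
    and C_in: "g \<in> \<Gamma> \<times> \<Lambda> \<Longrightarrow> x \<in> stein_set \<Gamma> \<Longrightarrow> C g x \<in> \<Gamma>' \<times> \<Lambda>'"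
    and equivariant: "g \<in> \<Gamma> \<times> \<Lambda> \<Longrightarrow> x \<in> stein_set \<Gamma> \<Longrightarrow>
      h (stein_action g x) = stein_action (C g x) (h x)"
    and C_locally_constant: "g \<in> \<Gamma> \<times> \<Lambda> \<Longrightarrow> locally_constant \<Gamma> (C g)"
    and C_cocycle: "g \<in> \<Gamma> \<times> \<Lambda> \<Longrightarrow> g' \<in> \<Gamma> \<times> \<Lambda> \<Longrightarrow> x \<in> stein_set \<Gamma> \<Longrightarrow>
      snd (C (fst g + snd g * fst g', snd g * snd g') x) = snd (C g (stein_action g' x)) * snd (C g' x)"
begin

lemma h_in: "x \<in> stein_set \<Gamma> \<Longrightarrow> h x \<in> stein_set \<Gamma>'"
  and p_in: "y \<in> stein_set \<Gamma>' \<Longrightarrow> p y \<in> stein_set \<Gamma>"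
  and p_h [simp]: "x \<in> stein_set \<Gamma> \<Longrightarrow> p (h x) = x"
  and h_p [simp]: "y \<in> stein_set \<Gamma>' \<Longrightarrow> h (p y) = y"
  using homeo continuous_map_funspace[of "stein_space \<Gamma>" "stein_space \<Gamma>'" h]
    continuous_map_funspace[of "stein_space \<Gamma>'" "stein_space \<Gamma>" p]
  by (auto simp: homeomorphic_maps_def)

lemma h_image_eq: "S \<subseteq> stein_set \<Gamma> \<Longrightarrow> h ` S = {y \<in> stein_set \<Gamma>'. p y \<in> S}"
  using h_in p_h h_p by (force simp: image_iff)

lemma p_image_eq: "S \<subseteq> stein_set \<Gamma>' \<Longrightarrow> p ` S = {y \<in> stein_set \<Gamma>. h y \<in> S}"
  using p_in p_h h_p by (force simp: image_iff)

lemma h_image_compl: "S \<subseteq> stein_set \<Gamma> \<Longrightarrow> stein_set \<Gamma>' - h ` S = h ` (stein_set \<Gamma> - S)"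
  by (subst (1 2) h_image_eq) (auto intro: p_in)

lemma p_image_compl: "S \<subseteq> stein_set \<Gamma>' \<Longrightarrow> stein_set \<Gamma> - p ` S = p ` (stein_set \<Gamma>' - S)"
  by (subst (1 2) p_image_eq) (auto intro: h_in)

lemma open_sub1: "stein_open \<Gamma> S \<Longrightarrow> S \<subseteq> stein_set \<Gamma>"
  using openin_subset by fastforce

lemma open_sub2: "stein_open \<Gamma>' S \<Longrightarrow> S \<subseteq> stein_set \<Gamma>'"
  using openin_subset by fastforce

lemma openin_h_image: "stein_open \<Gamma> S \<Longrightarrow> stein_open \<Gamma>' (h ` S)"
  using homeo open_sub1[of S] openin_continuous_map_preimage[of "stein_space \<Gamma>'" "stein_space \<Gamma>" p S]
  by (simp add: h_image_eq homeomorphic_maps_def)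

lemma openin_p_image: "stein_open \<Gamma>' S \<Longrightarrow> stein_open \<Gamma> (p ` S)"
  using homeo open_sub2[of S] openin_continuous_map_preimage[of "stein_space \<Gamma>" "stein_space \<Gamma>'" h S]
  by (simp add: p_image_eq homeomorphic_maps_def)

lemma locally_constant_p:
  assumes "locally_constant \<Gamma> F"
  shows "locally_constant \<Gamma>' (\<lambda>y. F (p y))"
  unfolding locally_constant_def
proof
  fix y assume y: "y \<in> stein_set \<Gamma>'"
  have "stein_open \<Gamma>' (h ` {x \<in> stein_set \<Gamma>. F x = F (p y)})"
    by (rule openin_h_image[OF openin_locally_constant[OF A.dense assms]])
  moreover have "y \<in> h ` {x \<in> stein_set \<Gamma>. F x = F (p y)}" using y p_in h_p by (force simp: image_iff)
  ultimately have "\<exists>\<epsilon>>0. \<forall>z\<in>stein_set \<Gamma>'. stein_near \<epsilon> y z \<longrightarrow>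
      z \<in> h ` {x \<in> stein_set \<Gamma>. F x = F (p y)}"
    unfolding openin_stein_space_iff[OF B.dense] by blast
  moreover have "F (p z) = F (p y)" if "z \<in> h ` {x \<in> stein_set \<Gamma>. F x = F (p y)}" for z
    using that by auto
  ultimately show "\<exists>\<epsilon>>0. \<forall>z\<in>stein_set \<Gamma>'. stein_near \<epsilon> y z \<longrightarrow> F (p z) = F (p y)"
    by blast
qed

text \<open>Lebesgue measure on the second space, pulled back along \<open>h\<close> and given the density \<open>exp (- F)\<close>.\<close>

definition weighted_measure :: "(stein_point \<Rightarrow> real) \<Rightarrow> stein_point set \<Rightarrow> ennreal" where
  "weighted_measure F S =
    (\<integral>\<^sup>+y. ennreal (exp (- F (p (Pt y)))) * indicator {y. Pt y \<in> h ` S} y \<partial>lborel)"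

context
  fixes F :: "stein_point \<Rightarrow> real"
  assumes F: "locally_constant \<Gamma> F"
begin

abbreviation "\<nu> \<equiv> weighted_measure F"

lemma image_trace_borel: "stein_open \<Gamma> S \<Longrightarrow> {y. Pt y \<in> h ` S} \<in> sets borel"
  using trace_borel[OF B.dense B.count openin_h_image] .

lemma weight_measurable: "(\<lambda>y. ennreal (exp (- F (p (Pt y))))) \<in> borel_measurable borel"
  using trace_measurable[OF B.dense B.count locally_constant_p[OF F]] by measurable

lemma \<nu>_empty [simp]: "\<nu> {} = 0"
  by (simp add: weighted_measure_def)

lemma \<nu>_union:
  assumes "stein_open \<Gamma> S" "stein_open \<Gamma> S'" "S \<inter> S' = {}"
  shows "\<nu> (S \<union> S') = \<nu> S + \<nu> S'"
proof -
  have "h ` S \<inter> h ` S' = {}"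
    using assms open_sub1 h_image_eq by (auto simp: disjoint_iff)
  then have "indicator {y. Pt y \<in> h ` (S \<union> S')} y =
      (indicator {y. Pt y \<in> h ` S} y + indicator {y. Pt y \<in> h ` S'} y :: ennreal)" for y
    by (auto simp: indicator_def)
  then show ?thesis
    unfolding weighted_measure_def
    using image_trace_borel[OF assms(1)] image_trace_borel[OF assms(2)] weight_measurable
    by (simp add: distrib_left nn_integral_add)
qed

lemma \<nu>_mono: "S \<subseteq> S' \<Longrightarrow> \<nu> S \<le> \<nu> S'"
  unfolding weighted_measure_def
  by (intro nn_integral_mono mult_left_mono) (auto simp: indicator_def)

lemma \<nu>_const:
  assumes S: "stein_open \<Gamma> S" and c: "\<And>x. x \<in> S \<Longrightarrow> F x = c"
  shows "\<nu> S = ennreal (exp (- c)) * trace_measure (h ` S)"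
proof -
  have "ennreal (exp (- F (p (Pt y)))) * indicator {y. Pt y \<in> h ` S} y =
      ennreal (exp (- c)) * indicator {y. Pt y \<in> h ` S} y" for y
  proof (cases "Pt y \<in> h ` S")
    case True
    then obtain x where "x \<in> S" "Pt y = h x" by auto
    then have "F (p (Pt y)) = c" using c open_sub1[OF S] by auto
    then show ?thesis by simp
  qed simp
  then have "\<nu> S = (\<integral>\<^sup>+y. ennreal (exp (- c)) * indicator {y. Pt y \<in> h ` S} y \<partial>lborel)"
    by (simp add: weighted_measure_def)
  also have "\<dots> = ennreal (exp (- c)) * trace_measure (h ` S)"
    using image_trace_borel[OF S] by (simp add: nn_integral_cmult trace_measure_def)
  finally show ?thesis .
qed

text \<open>On a small open set an element \<open>g\<close> acts, through \<open>h\<close>, as the single affine map \<open>C g x\<close>. So it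
multiplies Lebesgue measure by the dilation factor of \<open>C g x\<close>, while the density changes by
\<open>exp (F x - F (g x))\<close>.\<close>

lemma \<nu>_action_local:
  assumes g: "g \<in> \<Gamma> \<times> \<Lambda>" and S: "stein_open \<Gamma> S" and x: "x \<in> stein_set \<Gamma>"
    and c: "\<And>z. z \<in> S \<Longrightarrow> (F z, F (stein_action g z), C g z) = (F x, F (stein_action g x), C g x)"
  shows "\<nu> (stein_action g ` S) = ennreal (snd (C g x) * exp (F x - F (stein_action g x))) * \<nu> S"
proof -
  have sub: "S \<subseteq> stein_set \<Gamma>" using open_sub1[OF S] .
  have pos: "snd (C g x) > 0" using C_in[OF g x] B.\<Lambda>_pos by auto
  have im: "h ` stein_action g ` S = stein_action (C g x) ` h ` S"
    using equivariant[OF g] c sub by (force simp: image_iff)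
  have "\<nu> (stein_action g ` S) = ennreal (exp (- F (stein_action g x))) * trace_measure (stein_action (C g x) ` h ` S)"
    unfolding im[symmetric] by (rule \<nu>_const[OF A.openin_action_image[OF S g]]) (use c in auto)
  also have "\<dots> = ennreal (exp (- F (stein_action g x))) * (ennreal (snd (C g x)) * trace_measure (h ` S))"
    by (subst trace_measure_action[OF image_trace_borel[OF S] pos]) simp
  also have "\<dots> = ennreal (exp (- F (stein_action g x)) * snd (C g x) * exp (F x)) *
      (ennreal (exp (- F x)) * trace_measure (h ` S))"
    using pos by (simp add: ennreal_mult[symmetric] mult.assoc[symmetric]) (simp add: exp_minus field_simps)
  also have "ennreal (exp (- F x)) * trace_measure (h ` S) = \<nu> S"
    by (rule \<nu>_const[OF S, symmetric]) (use c in auto)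
  also have "exp (- F (stein_action g x)) * snd (C g x) * exp (F x) = snd (C g x) * exp (F x - F (stein_action g x))"
    by (simp add: exp_diff exp_minus field_simps)
  finally show ?thesis .
qed

lemma action_nbhd:
  assumes g: "g \<in> \<Gamma> \<times> \<Lambda>" and x: "x \<in> stein_set \<Gamma>"
  obtains U where "stein_open \<Gamma> U" "x \<in> U"
    "\<And>z. z \<in> U \<Longrightarrow> (F z, F (stein_action g z), C g z) = (F x, F (stein_action g x), C g x)"
  using locally_constant_nbhd[OF A.dense
      locally_constant_pair[OF F locally_constant_pair[OF A.locally_constant_action[OF F g] C_locally_constant[OF g]]] x]
  by blast

lemma \<nu>_split:
  assumes "a \<in> \<Gamma>" "b \<in> \<Gamma>" "c \<in> \<Gamma>" "a \<le> b" "b \<le> c"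
  shows "\<nu> (cell \<Gamma> a c) = \<nu> (cell \<Gamma> a b) + \<nu> (cell \<Gamma> b c)"
  using \<nu>_union[OF openin_cell openin_cell, OF A.dense _ _ A.dense, of a b b c] cell_split[of a b c \<Gamma>] assms by simp

lemma \<nu>_action_cell:
  assumes g: "g \<in> \<Gamma> \<times> \<Lambda>"
    and r: "\<And>x. x \<in> stein_set \<Gamma> \<Longrightarrow> snd (C g x) * exp (F x - F (stein_action g x)) = r"
    and ab: "a \<in> \<Gamma>" "b \<in> \<Gamma>" "a \<le> b"
  shows "\<nu> (stein_action g ` cell \<Gamma> a b) = ennreal r * \<nu> (cell \<Gamma> a b)"
proof (rule cell_induct[OF A.dense, where R = "\<lambda>a b. \<nu> (stein_action g ` cell \<Gamma> a b) = ennreal r * \<nu> (cell \<Gamma> a b)"])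
  fix a b c assume *: "a \<in> \<Gamma>" "b \<in> \<Gamma>" "c \<in> \<Gamma>" "a \<le> b" "b \<le> c"
    "\<nu> (stein_action g ` cell \<Gamma> a b) = ennreal r * \<nu> (cell \<Gamma> a b)"
    "\<nu> (stein_action g ` cell \<Gamma> b c) = ennreal r * \<nu> (cell \<Gamma> b c)"
  have gpos: "snd g > 0" using g A.\<Lambda>_pos by auto
  have "snd g * t + fst g \<in> \<Gamma>" if "t \<in> \<Gamma>" for t
    using A.add[OF A.scale[of "snd g" t], of "fst g"] g that by auto
  then have "\<nu> (stein_action g ` cell \<Gamma> a c) = \<nu> (stein_action g ` cell \<Gamma> a b) + \<nu> (stein_action g ` cell \<Gamma> b c)"
    unfolding A.cell_action[OF g] using * gpos by (intro \<nu>_split) auto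
  also have "\<dots> = ennreal r * \<nu> (cell \<Gamma> a c)"
    using * \<nu>_split[of a b c] by (simp add: distrib_left)
  finally show "\<nu> (stein_action g ` cell \<Gamma> a c) = ennreal r * \<nu> (cell \<Gamma> a c)" .
next
  fix x assume x: "x \<in> stein_set \<Gamma>"
  obtain U where U: "stein_open \<Gamma> U" "x \<in> U"
    "\<And>z. z \<in> U \<Longrightarrow> (F z, F (stein_action g z), C g z) = (F x, F (stein_action g x), C g x)"
    using action_nbhd[OF g x] by blast
  have "\<nu> (stein_action g ` cell \<Gamma> a b) = ennreal r * \<nu> (cell \<Gamma> a b)"
    if "a \<in> \<Gamma>" "b \<in> \<Gamma>" "cell \<Gamma> a b \<subseteq> U" for a b
    using \<nu>_action_local[OF g openin_cell[OF A.dense that(1,2)] x] U(3) that(3) r[OF x] by (metis subsetD)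
  then show "on_small_cells \<Gamma> x
      (\<lambda>a b. \<nu> (stein_action g ` cell \<Gamma> a b) = ennreal r * \<nu> (cell \<Gamma> a b))"
    by (rule on_small_cellsI[OF U(1,2)])
qed (use ab in auto)

lemma bounded_nbhd:
  assumes x: "x \<in> stein_set \<Gamma>"
  obtains U where "stein_open \<Gamma> U" "x \<in> U" "\<And>z. z \<in> U \<Longrightarrow> F z = F x"
    "\<And>z. z \<in> U \<Longrightarrow> \<bar>stein_proj (h z) - stein_proj (h x)\<bar> < 1"
proof -
  let ?T = "{y \<in> stein_set \<Gamma>'. \<bar>stein_proj y - stein_proj (h x)\<bar> < 1}"
  have o: "stein_open \<Gamma> (p ` ?T \<inter> {z \<in> stein_set \<Gamma>. F z = F x})"
    by (intro openin_Int openin_p_image openin_proj_ball openin_locally_constant[OF A.dense F] B.dense)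
  show ?thesis
    by (rule that[OF o]) (use x h_in p_image_eq[of ?T] in auto)
qed

lemma \<nu>_finite:
  assumes "a \<in> \<Gamma>" "b \<in> \<Gamma>" "a \<le> b"
  shows "\<nu> (cell \<Gamma> a b) < \<infinity>"
proof (rule cell_induct[OF A.dense, where R = "\<lambda>a b. \<nu> (cell \<Gamma> a b) < \<infinity>"])
  fix x assume x: "x \<in> stein_set \<Gamma>"
  obtain U where U: "stein_open \<Gamma> U" "x \<in> U" "\<And>z. z \<in> U \<Longrightarrow> F z = F x"
    "\<And>z. z \<in> U \<Longrightarrow> \<bar>stein_proj (h z) - stein_proj (h x)\<bar> < 1" using bounded_nbhd[OF x] by blast
  have "\<nu> (cell \<Gamma> a b) < \<infinity>" if "cell \<Gamma> a b \<subseteq> U" for a b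
  proof -
    let ?r = "stein_proj (h x)"
    have "\<nu> (cell \<Gamma> a b) \<le> \<nu> U" using that by (rule \<nu>_mono)
    also have "\<nu> U = ennreal (exp (- F x)) * trace_measure (h ` U)"
      using \<nu>_const[OF U(1)] U(3) by blast
    also have "trace_measure (h ` U) \<le> emeasure lborel {?r - 1..?r + 1}"
      unfolding trace_measure_def
    proof (rule emeasure_mono)
      show "{y. Pt y \<in> h ` U} \<subseteq> {?r - 1..?r + 1}"
      proof
        fix y assume "y \<in> {y. Pt y \<in> h ` U}"
        then obtain z where "z \<in> U" "h z = Pt y" by auto
        then show "y \<in> {?r - 1..?r + 1}" using U(4)[of z] by auto
      qed
    qed auto
    finally have "\<nu> (cell \<Gamma> a b) \<le> ennreal (exp (- F x)) * emeasure lborel {?r - 1..?r + 1}"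
      by (simp add: mult_left_mono)
    also have "\<dots> < \<infinity>" by (simp add: ennreal_mult_less_top)
    finally show ?thesis .
  qed
  then show "on_small_cells \<Gamma> x (\<lambda>a b. \<nu> (cell \<Gamma> a b) < \<infinity>)"
    by (rule on_small_cellsI[OF U(1,2)])
next
  fix a b c assume "a \<in> \<Gamma>" "b \<in> \<Gamma>" "c \<in> \<Gamma>" "a \<le> b" "b \<le> c"
    "\<nu> (cell \<Gamma> a b) < \<infinity>" "\<nu> (cell \<Gamma> b c) < \<infinity>"
  then show "\<nu> (cell \<Gamma> a c) < \<infinity>" using \<nu>_split[of a b c] by simp
qed (use assms in auto)

lemma \<nu>_pos:
  assumes "a \<in> \<Gamma>" "b \<in> \<Gamma>" "a < b"
  shows "\<nu> (cell \<Gamma> a b) > 0"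
proof -
  let ?S = "cell \<Gamma> a b \<inter> {z \<in> stein_set \<Gamma>. F z = F (Plus a)}"
  have S: "stein_open \<Gamma> ?S" "Plus a \<in> ?S"
    using openin_cell[OF A.dense assms(1,2)] openin_locally_constant[OF A.dense F, of "\<lambda>v. v = F (Plus a)"] assms by auto
  have "trace_measure (h ` ?S) > 0"
    using S by (intro trace_measure_pos[OF B.dense B.count openin_h_image[OF S(1)], of "h (Plus a)"]) auto
  then have "\<nu> ?S > 0"
    by (subst \<nu>_const[OF S(1), of "F (Plus a)"]) (auto simp: ennreal_zero_less_mult_iff)
  also have "\<nu> ?S \<le> \<nu> (cell \<Gamma> a b)" by (rule \<nu>_mono) auto
  finally show ?thesis .
qed

end

end

section \<open>Rigidity of orbit maps\<close>

lemma (in dense_subgroup) small_cell: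
  assumes "stein_open \<Gamma> U" "Plus 0 \<in> U"
  obtains \<epsilon> where "\<epsilon> > 0" "\<And>a. a < \<epsilon> \<Longrightarrow> cell \<Gamma> 0 a \<subseteq> U"
proof -
  obtain \<epsilon> where e: "\<epsilon> > 0" "\<And>z. z \<in> stein_set \<Gamma> \<Longrightarrow> stein_near \<epsilon> (Plus 0) z \<Longrightarrow> z \<in> U"
    using assms unfolding openin_stein_space_iff[OF dense] by blast
  have "cell \<Gamma> 0 a \<subseteq> U" if "a < \<epsilon>" for a
  proof
    fix z assume "z \<in> cell \<Gamma> 0 a"
    then have "z \<in> stein_set \<Gamma>" "stein_near \<epsilon> (Plus 0) z" using that by (auto simp: cell_def)
    then show "z \<in> U" by (rule e(2))
  qed
  then show ?thesis using e(1) that by blast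
qed

lemma Plus_near:
  assumes d: "closure \<Gamma> = UNIV" and x: "x \<in> stein_set \<Gamma>" and e: "\<epsilon> > 0"
  obtains s where "s \<in> \<Gamma>" "stein_near \<epsilon> x (Plus s)"
  using x
proof (cases rule: stein_set_cases)
  case (1 r)
  obtain s where "s \<in> \<Gamma>" "r < s" "s < r + \<epsilon>" using dense_between[OF d, of r "r + \<epsilon>"] e by auto
  then show ?thesis using that[of s] 1 by auto
next
  case (2 t)
  obtain s where "s \<in> \<Gamma>" "t - \<epsilon> < s" "s < t" using dense_between[OF d, of "t - \<epsilon>" t] e by auto
  then show ?thesis using that[of s] 2 by auto
next
  case (3 t)
  then show ?thesis using that[of t] by auto
qed

context orbit_map
begin

text \<open>The dilation cocycle over the translations, split into the coboundary of a logarithmic weight \<open>F\<close>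
and a homomorphism \<open>\<rho>\<close>, the drift of the weighted measure.\<close>

definition drift_weight :: "(stein_point \<Rightarrow> real) \<Rightarrow> (real \<Rightarrow> real) \<Rightarrow> bool" where
  "drift_weight F \<rho> \<longleftrightarrow> locally_constant \<Gamma> F \<and> (\<forall>s\<in>\<Gamma>. \<forall>x\<in>stein_set \<Gamma>.
    snd (C (s, 1) x) = exp (F (shift s x) - F x + \<rho> s))"

lemma drift_weightD:
  assumes "drift_weight F \<rho>"
  shows "locally_constant \<Gamma> F"
    and "s \<in> \<Gamma> \<Longrightarrow> x \<in> stein_set \<Gamma> \<Longrightarrow>
      snd (C (s, 1) x) = exp (F (shift s x) - F x + \<rho> s)"
  using assms by (auto simp: drift_weight_def)

lemma translation_weight_law:
  assumes weight: "drift_weight F \<rho>"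
    and s: "s \<in> \<Gamma>" and ab: "a \<in> \<Gamma>" "b \<in> \<Gamma>" "a \<le> b"
  shows "weighted_measure F (cell \<Gamma> (a + s) (b + s)) = ennreal (exp (\<rho> s)) * weighted_measure F (cell \<Gamma> a b)"
proof -
  note F = drift_weightD(1)[OF weight] and \<rho> = drift_weightD(2)[OF weight]
  have g: "(s, 1) \<in> \<Gamma> \<times> \<Lambda>" using s by simp
  have "weighted_measure F (shift s ` cell \<Gamma> a b) =
      ennreal (exp (\<rho> s)) * weighted_measure F (cell \<Gamma> a b)"
  proof (rule \<nu>_action_cell[OF F g _ ab])
    fix x assume "x \<in> stein_set \<Gamma>"
    then show "snd (C (s, 1) x) * exp (F x - F (shift s x)) = exp (\<rho> s)"
      using \<rho>[OF s] by (simp add: exp_add[symmetric])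
  qed
  then show ?thesis using A.cell_action[OF g] by simp
qed

lemma drift_additive:
  assumes weight: "drift_weight F \<rho>"
    and st: "s \<in> \<Gamma>" "t \<in> \<Gamma>"
  shows "\<rho> (s + t) = \<rho> s + \<rho> t"
proof -
  note F = drift_weightD(1)[OF weight] and \<rho> = drift_weightD(2)[OF weight]
  have "snd (C (s + t, 1) (Plus 0)) = snd (C (s, 1) (shift t (Plus 0))) * snd (C (t, 1) (Plus 0))"
    using C_cocycle[of "(s, 1)" "(t, 1)" "Plus 0"] st by simp
  then have "exp (F (Plus (s + t)) - F (Plus 0) + \<rho> (s + t)) =
      exp ((F (Plus (s + t)) - F (Plus t) + \<rho> s) + (F (Plus t) - F (Plus 0) + \<rho> t))"
    using \<rho>[of "s + t" "Plus 0"] \<rho>[of s "Plus t"] \<rho>[of t "Plus 0"] st A.add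
    by (simp add: exp_add[symmetric] add.commute)
  then show ?thesis by simp
qed

text \<open>The element \<open>(l s, l)\<close> is both \<open>(0, l) (s, 1)\<close> and \<open>(l s, 1) (0, l)\<close>. Evaluating the cocycle at \<open>0\<^sub>+\<close>
in both ways gives the claim if \<open>s\<close> is so small that nothing changes between \<open>0\<^sub>+\<close> and \<open>s\<^sub>+\<close>.\<close>

lemma drift_dilation_invariant:
  assumes weight: "drift_weight F \<rho>"
    and l: "l \<in> \<Lambda>" and s: "s \<in> \<Gamma>"
  shows "\<rho> (l * s) = \<rho> s"
proof -
  note F = drift_weightD(1)[OF weight] and \<rho> = drift_weightD(2)[OF weight]
  have add: "\<rho> (s + t) = \<rho> s + \<rho> t" if "s \<in> \<Gamma>" "t \<in> \<Gamma>" for s t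
    using drift_additive[OF weight] that by blast
  have \<rho>0: "\<rho> 0 = 0" using add[of 0 0] by simp
  have neg: "\<rho> (- s) = - \<rho> s" if "s \<in> \<Gamma>" for s
    using add[OF that A.minus[OF that]] \<rho>0 by simp
  have g: "(0, l) \<in> \<Gamma> \<times> \<Lambda>" using l by simp
  have P0: "Plus 0 \<in> stein_set \<Gamma>" by simp
  obtain U where U: "stein_open \<Gamma> U" "Plus 0 \<in> U"
    "\<And>z. z \<in> U \<Longrightarrow> (F z, F (stein_action (0, l) z), C (0, l) z) =
      (F (Plus 0), F (stein_action (0, l) (Plus 0)), C (0, l) (Plus 0))"
    using action_nbhd[OF F g P0] by blast
  obtain \<epsilon> where e: "\<epsilon> > 0" "\<And>a. a < \<epsilon> \<Longrightarrow> cell \<Gamma> 0 a \<subseteq> U" using A.small_cell[OF U(1,2)] by blast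
  have small: "\<rho> (l * s) = \<rho> s" if s: "s \<in> \<Gamma>" "0 < s" "s < \<epsilon>" for s
  proof -
    have "Plus s \<in> U" using e(2)[of "(s + \<epsilon>) / 2"] s by auto
    then have c: "F (Plus s) = F (Plus 0)" "F (Plus (l * s)) = F (Plus 0)" "C (0, l) (Plus s) = C (0, l) (Plus 0)"
      using U(3)[of "Plus s"] by auto
    have ls: "l * s \<in> \<Gamma>" using A.scale[OF l s(1)] .
    have pos: "snd (C (0, l) (Plus 0)) > 0" using C_in[OF g P0] B.\<Lambda>_pos by auto
    have "snd (C (l * s, l) (Plus 0)) = snd (C (0, l) (Plus s)) * snd (C (s, 1) (Plus 0))"
      using C_cocycle[OF g, of "(s, 1)" "Plus 0"] s by simp
    moreover have "snd (C (l * s, l) (Plus 0)) = snd (C (l * s, 1) (Plus 0)) * snd (C (0, l) (Plus 0))"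
      using C_cocycle[of "(l * s, 1)" "(0, l)" "Plus 0"] l ls by simp
    ultimately have "snd (C (s, 1) (Plus 0)) = snd (C (l * s, 1) (Plus 0))" using c pos by simp
    then show ?thesis using \<rho>[OF s(1) P0] \<rho>[OF ls P0] c by simp
  qed
  have "s \<in> \<Gamma> \<and> \<rho> (l * s) = \<rho> s"
  proof (rule A.generated_by_small[OF e(1), where P = "\<lambda>s. s \<in> \<Gamma> \<and> \<rho> (l * s) = \<rho> s"])
    fix a b assume "a \<in> \<Gamma> \<and> \<rho> (l * a) = \<rho> a" "b \<in> \<Gamma> \<and> \<rho> (l * b) = \<rho> b"
    then show "a + b \<in> \<Gamma> \<and> \<rho> (l * (a + b)) = \<rho> (a + b)"
      using add[of a b] add[of "l * a" "l * b"] A.scale[OF l] A.add by (simp add: distrib_left)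
  next
    fix a assume "a \<in> \<Gamma> \<and> \<rho> (l * a) = \<rho> a"
    then show "- a \<in> \<Gamma> \<and> \<rho> (l * - a) = \<rho> (- a)"
      using neg[of a] neg[of "l * a"] A.scale[OF l] A.minus by simp
  qed (use small s \<rho>0 in auto)
  then show ?thesis by simp
qed

text \<open>By invariance, \<open>\<rho>\<close> vanishes on \<open>(l - 1) \<Gamma>\<close>, which is dense. So every multiple \<open>n r\<close> can be moved into
a bounded range without changing \<open>\<rho>\<close>. If \<open>\<rho> r > 0\<close>, these bounded translations enlarge the measure of a
fixed cell by the factors \<open>exp (n \<rho> r)\<close>, although all translates lie in one cell of finite measure.\<close>

lemma drift_zero:
  assumes weight: "drift_weight F \<rho>"
    and l: "l \<in> \<Lambda>" "l \<noteq> 1" and s: "s \<in> \<Gamma>"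
  shows "\<rho> s = 0"
proof (rule ccontr)
  note F = drift_weightD(1)[OF weight] and \<rho> = drift_weightD(2)[OF weight]
  assume nz: "\<rho> s \<noteq> 0"
  have add: "\<rho> (s + t) = \<rho> s + \<rho> t" if "s \<in> \<Gamma>" "t \<in> \<Gamma>" for s t
    using drift_additive[OF weight] that by blast
  have \<rho>0: "\<rho> 0 = 0" using add[of 0 0] by simp
  have neg: "\<rho> (- s) = - \<rho> s" if "s \<in> \<Gamma>" for s
    using add[OF that A.minus[OF that]] \<rho>0 by simp
  obtain r where r: "r \<in> \<Gamma>" "\<rho> r > 0"
    using nz s neg[OF s] A.minus[OF s] by (cases "\<rho> s > 0") auto
  have mult: "real n * r \<in> \<Gamma> \<and> \<rho> (real n * r) = real n * \<rho> r" for n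
  proof (induction n)
    case (Suc n)
    then show ?case using add[of "real n * r" r] A.add r(1) by (simp add: algebra_simps)
  qed (simp add: \<rho>0)
  obtain b where b: "b \<in> \<Gamma>" "0 < b" "b < 1" using dense_between[OF A.dense, of 0 1] by auto
  obtain u where u: "u \<in> \<Gamma>" "u < -1" by (rule dense_below[OF A.dense])
  obtain w where w: "w \<in> \<Gamma>" "2 < w" by (rule dense_above[OF A.dense])
  define v where "v = enn2real (weighted_measure F (cell \<Gamma> 0 b))"
  define M where "M = enn2real (weighted_measure F (cell \<Gamma> u w))"
  have v: "weighted_measure F (cell \<Gamma> 0 b) = ennreal v" "v > 0"
    using \<nu>_finite[OF F A.zero b(1)] \<nu>_pos[OF F A.zero b(1)] b
    by (auto simp: v_def less_top enn2real_positive_iff)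
  have M: "weighted_measure F (cell \<Gamma> u w) = ennreal M"
    using \<nu>_finite[OF F u(1) w(1)] u w by (auto simp: M_def less_top)
  have bound: "exp (real n * \<rho> r) * v \<le> M" for n
  proof -
    define c where "c = - (real n * r) / (l - 1)"
    obtain d where d: "d \<in> \<Gamma>" "c < d" "d < c + 1 / \<bar>l - 1\<bar>"
      using dense_between[OF A.dense, of c "c + 1 / \<bar>l - 1\<bar>"] l(2) by auto
    define s' where "s' = real n * r + (l * d + - d)"
    have ld: "l * d \<in> \<Gamma>" using A.scale[OF l(1) d(1)] .
    have s': "s' \<in> \<Gamma>" unfolding s'_def using mult A.add A.minus ld d(1) by blast
    have "\<rho> s' = real n * \<rho> r"
      unfolding s'_def
      using mult[of n] add[of "real n * r" "l * d + - d"] add[OF ld A.minus[OF d(1)]]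
        A.add[OF ld A.minus[OF d(1)]] neg[OF d(1)] drift_dilation_invariant[OF weight l(1) d(1)] by simp
    have "s' = (l - 1) * (d - c)" using l(2) by (simp add: s'_def c_def field_simps)
    then have "\<bar>s'\<bar> = \<bar>l - 1\<bar> * \<bar>d - c\<bar>" by (simp add: abs_mult)
    also have "\<dots> < \<bar>l - 1\<bar> * (1 / \<bar>l - 1\<bar>)"
      using d l(2) by (intro mult_strict_left_mono) auto
    also have "\<dots> = 1" using l(2) by simp
    finally have s1: "\<bar>s'\<bar> < 1" .
    have "cell \<Gamma> (0 + s') (b + s') \<subseteq> cell \<Gamma> u w"
      using s1 b u w by (auto simp: cell_def)
    then have "weighted_measure F (cell \<Gamma> (0 + s') (b + s')) \<le> weighted_measure F (cell \<Gamma> u w)"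
      by (rule \<nu>_mono[OF F])
    then have "ennreal (exp (\<rho> s') * v) \<le> ennreal M"
      using translation_weight_law[OF weight s' A.zero b(1)] b v M by (simp add: ennreal_mult')
    moreover have "exp (\<rho> s') * v > 0" using v by simp
    ultimately have "exp (\<rho> s') * v \<le> M"
      by (metis ennreal_le_iff2 less_le_not_le)
    then show ?thesis using \<open>\<rho> s' = _\<close> by simp
  qed
  obtain n where n: "M / v / \<rho> r < real n" using reals_Archimedean2 by blast
  have "M < real n * \<rho> r * v" using n r v by (simp add: field_simps)
  also have "\<dots> \<le> exp (real n * \<rho> r) * v"
    using exp_ge_add_one_self[of "real n * \<rho> r"] v by (intro mult_right_mono) linarith+
  finally show False using bound[of n] by simp
qed

text \<open>
If \<open>\<Lambda>'\<close> is trivial, the dilation components of \<open>C\<close> are all \<open>1\<close>. Otherwise their logarithms form a real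
cocycle over the translations, which is trivial up to the drift, and the drift vanishes because the
first group contains a proper dilation.\<close>

lemma weight_exists:
  assumes cr: "circle_rotation \<Gamma> e \<alpha>" and \<Lambda>: "\<Lambda>' = {1} \<or> \<Lambda> \<noteq> {1}"
  obtains F where "drift_weight F (\<lambda>_. 0)"
proof (cases "\<Lambda>' = {1}")
  case True
  have "snd (C (s, 1) x) = 1" if "s \<in> \<Gamma>" "x \<in> stein_set \<Gamma>" for s x
    using C_in[of "(s, 1)" x] that True by auto
  then show ?thesis using that[of "\<lambda>x. 0"] by (simp add: drift_weight_def)
next
  case False
  then obtain l where l: "l \<in> \<Lambda>" "l \<noteq> 1" using \<Lambda> A.\<Lambda>_one by blast
  interpret circle_rotation \<Gamma> e \<alpha> by fact
  define b where "b s x = ln (snd (C (s, 1) x))" for s x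
  have pos: "snd (C (s, 1) x) > 0" if "s \<in> \<Gamma>" "x \<in> stein_set \<Gamma>" for s x
    using C_in[of "(s, 1)" x] that B.\<Lambda>_pos by auto
  have "A.translation_cocycle b"
    unfolding A.translation_cocycle_def
  proof (intro conjI ballI)
    fix s assume s: "s \<in> \<Gamma>"
    show "locally_constant \<Gamma> (b s)"
      unfolding b_def using locally_constant_compose[OF C_locally_constant[of "(s, 1)"], of "\<lambda>g. ln (snd g)"] s by simp
  next
    fix s t x assume *: "s \<in> \<Gamma>" "t \<in> \<Gamma>" "x \<in> stein_set \<Gamma>"
    then show "b (s + t) x = b s (shift t x) + b t x"
      using C_cocycle[of "(s, 1)" "(t, 1)" x] pos[of t x] pos[of s "shift t x"]
      by (simp add: b_def ln_mult)
  qed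
  then obtain F \<rho> where F: "locally_constant \<Gamma> F"
    and b: "\<And>s x. s \<in> \<Gamma> \<Longrightarrow> x \<in> stein_set \<Gamma> \<Longrightarrow> b s x = F (shift s x) - F x + \<rho> s"
    using translation_cocycle_trivial by blast
  have "snd (C (s, 1) x) = exp (F (shift s x) - F x + \<rho> s)"
    if "s \<in> \<Gamma>" "x \<in> stein_set \<Gamma>" for s x
    using b[OF that] pos[OF that] unfolding b_def by (metis exp_ln)
  then have w: "drift_weight F \<rho>" using F by (simp add: drift_weight_def)
  have "drift_weight F (\<lambda>_. 0)"
    using w drift_zero[OF w l] by (simp add: drift_weight_def)
  then show ?thesis by (rule that)
qed

text \<open>With the weight \<open>exp (- F)\<close> the pulled back measure is invariant under translations, so it gives every
cell \<open>k\<close> times its length. A dilation \<open>l\<close> fixes \<open>0\<^sub>+\<close> and multiplies the measure of small cells at \<open>0\<^sub>+\<close> by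
\<open>l\<close>; as the density is constant there, \<open>l\<close> is the dilation component of \<open>C (0, l) 0\<^sub>+\<close>. Small cells at
\<open>0\<^sub>+\<close> are mapped by \<open>h\<close> to bounded clopen sets, whose Lebesgue measure lies in \<open>\<Gamma>'\<close>; this yields
\<open>k' \<Gamma> \<subseteq> \<Gamma>'\<close>, where \<open>k'\<close> is \<open>k\<close> corrected by the density at \<open>0\<^sub>+\<close>. The converse inclusion
uses small cells of the second space in the same way. Their preimages lie near another point \<open>x\<close>,
and the densities at \<open>x\<close> and \<open>0\<^sub>+\<close> differ by an element of \<open>\<Lambda>'\<close>, which \<open>\<Gamma>\<close> absorbs
if \<open>\<Lambda>' \<subseteq> \<Lambda>\<close>.\<close>

theorem rigidity:
  assumes weight: "drift_weight F (\<lambda>_. 0)"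
  shows "\<Lambda> \<subseteq> \<Lambda>'"
    and "\<exists>k>0. (\<forall>a\<in>\<Gamma>. k * a \<in> \<Gamma>') \<and> (\<Lambda>' \<subseteq> \<Lambda> \<longrightarrow> (\<forall>c\<in>\<Gamma>'. \<exists>a\<in>\<Gamma>. c = k * a))"
proof -
  note F = drift_weightD(1)[OF weight] and coboundary = drift_weightD(2)[OF weight, simplified]
  let ?\<nu> = "weighted_measure F"
  have P0: "Plus 0 \<in> stein_set \<Gamma>" by simp
  define f where "f t = enn2real (?\<nu> (cell \<Gamma> 0 t))" for t
  have f0: "f t \<ge> 0" for t by (simp add: f_def)
  have f: "?\<nu> (cell \<Gamma> 0 t) = ennreal (f t)" if "t \<in> \<Gamma>" "0 \<le> t" for t
    using \<nu>_finite[OF F A.zero that] by (simp add: f_def less_top)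
  have transl: "?\<nu> (cell \<Gamma> (a + s) (b + s)) = ?\<nu> (cell \<Gamma> a b)"
    if "s \<in> \<Gamma>" "a \<in> \<Gamma>" "b \<in> \<Gamma>" "a \<le> b" for s a b
    using translation_weight_law[OF weight that] by simp
  obtain e where e: "e \<in> \<Gamma>" "0 < e" using dense_above[OF A.dense] .
  define k where "k = f e / e"
  have "f e > 0" using \<nu>_pos[OF F A.zero e] f[OF e(1)] e by (simp add: ennreal_less_zero_iff)
  then have k: "k > 0" using e by (simp add: k_def)
  have lin: "f t = k * t" if t: "t \<in> \<Gamma>" "t \<ge> 0" for t
    unfolding k_def
  proof (rule additive_imp_linear[OF A.dense_subgroup_axioms _ _ e t])
    fix s t assume st: "s \<in> \<Gamma>" "t \<in> \<Gamma>" "0 \<le> s" "0 \<le> t"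
    have "?\<nu> (cell \<Gamma> 0 (s + t)) = ?\<nu> (cell \<Gamma> 0 s) + ?\<nu> (cell \<Gamma> s (s + t))"
      using st A.add by (intro \<nu>_split[OF F]) auto
    also have "?\<nu> (cell \<Gamma> s (s + t)) = ?\<nu> (cell \<Gamma> 0 t)"
      using transl[OF st(1) A.zero st(2,4)] by (simp add: add.commute)
    finally have "ennreal (f (s + t)) = ennreal (f s + f t)"
      using f[OF A.add[OF st(1,2)]] f[OF st(1,3)] f[OF st(2,4)] st f0 by simp
    then show "f (s + t) = f s + f t"
      using f0 by (subst (asm) ennreal_inj) auto
  qed (rule f0)
  have cells: "?\<nu> (cell \<Gamma> a b) = ennreal (k * (b - a))" if "a \<in> \<Gamma>" "b \<in> \<Gamma>" "a \<le> b" for a b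
    using transl[of "- a" a b] f[of "b - a"] lin[of "b - a"] that A.minus A.diff by simp
  show \<Lambda>: "\<Lambda> \<subseteq> \<Lambda>'"
  proof
    fix l assume l: "l \<in> \<Lambda>"
    then have g: "(0, l) \<in> \<Gamma> \<times> \<Lambda>" by simp
    obtain U where U: "stein_open \<Gamma> U" "Plus 0 \<in> U"
      "\<And>z. z \<in> U \<Longrightarrow> (F z, F (stein_action (0, l) z), C (0, l) z) =
        (F (Plus 0), F (stein_action (0, l) (Plus 0)), C (0, l) (Plus 0))"
      using action_nbhd[OF F g P0] by blast
    obtain \<epsilon> where \<epsilon>: "\<epsilon> > 0" "\<And>a. a < \<epsilon> \<Longrightarrow> cell \<Gamma> 0 a \<subseteq> U" using A.small_cell[OF U(1,2)] by blast
    obtain a where a: "a \<in> \<Gamma>" "0 < a" "a < \<epsilon>" using dense_between[OF A.dense \<epsilon>(1)] .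
    have c: "(F z, F (stein_action (0, l) z), C (0, l) z) =
        (F (Plus 0), F (stein_action (0, l) (Plus 0)), C (0, l) (Plus 0))" if "z \<in> cell \<Gamma> 0 a" for z
      using U(3)[of z] \<epsilon>(2)[OF a(3)] that by blast
    have CL: "snd (C (0, l) (Plus 0)) \<in> \<Lambda>'" using C_in[OF g P0] by auto
    have la: "l * a \<in> \<Gamma>" "0 \<le> l * a" using A.scale[OF l a(1)] A.\<Lambda>_pos[OF l] a by auto
    have "?\<nu> (cell \<Gamma> 0 (l * a)) = ennreal (snd (C (0, l) (Plus 0))) * ?\<nu> (cell \<Gamma> 0 a)"
      using \<nu>_action_local[OF F g openin_cell[OF A.dense A.zero a(1)] P0 c] A.cell_action[OF g, of 0 a] by simp
    then have "ennreal (k * (l * a)) = ennreal (snd (C (0, l) (Plus 0)) * (k * a))"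
      using cells[OF A.zero la] cells[OF A.zero a(1)] a B.\<Lambda>_pos[OF CL] by (simp add: ennreal_mult')
    then have "k * (l * a) = snd (C (0, l) (Plus 0)) * (k * a)"
      using k la a B.\<Lambda>_pos[OF CL] by (subst (asm) ennreal_inj) auto
    then show "l \<in> \<Lambda>'" using k a CL by simp
  qed
  define k' where "k' = k * exp (F (Plus 0))"
  have k': "k' > 0" using k by (simp add: k'_def)
  have tm_add: "trace_measure (S \<union> S') = trace_measure S + trace_measure S'"
    if "stein_open \<Gamma>' S" "stein_open \<Gamma>' S'" "S \<inter> S' = {}" for S S'
  proof -
    have "{y. Pt y \<in> S \<union> S'} = {y. Pt y \<in> S} \<union> {y. Pt y \<in> S'}" by auto
    moreover have "{y. Pt y \<in> S} \<inter> {y. Pt y \<in> S'} = {}" using that by auto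
    ultimately show ?thesis
      unfolding trace_measure_def
      using plus_emeasure[of "{y. Pt y \<in> S}" lborel "{y. Pt y \<in> S'}"] that
        trace_borel[OF B.dense B.count that(1)] trace_borel[OF B.dense B.count that(2)] by auto
  qed
  have into: "k' * a \<in> \<Gamma>'" if a: "a \<in> \<Gamma>" for a
  proof -
    obtain U where U: "stein_open \<Gamma> U" "Plus 0 \<in> U" "\<And>z. z \<in> U \<Longrightarrow> F z = F (Plus 0)"
      "\<And>z. z \<in> U \<Longrightarrow> \<bar>stein_proj (h z) - stein_proj (h (Plus 0))\<bar> < 1"
      using bounded_nbhd[OF F P0] by blast
    obtain \<epsilon> where \<epsilon>: "\<epsilon> > 0" "\<And>a. a < \<epsilon> \<Longrightarrow> cell \<Gamma> 0 a \<subseteq> U" using A.small_cell[OF U(1,2)] by blast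
    show ?thesis
    proof (rule A.generated_by_small[OF \<epsilon>(1), where P = "\<lambda>a. k' * a \<in> \<Gamma>'"])
      fix a assume a: "a \<in> \<Gamma>" "0 < a" "a < \<epsilon>"
      let ?S = "cell \<Gamma> 0 a"
      have S: "stein_open \<Gamma> ?S" "stein_open \<Gamma> (stein_set \<Gamma> - ?S)" "?S \<subseteq> U"
        using openin_cell[OF A.dense A.zero a(1)] openin_cell_compl[OF A.dense A.zero a(1)] \<epsilon>(2)[OF a(3)] a by auto
      have compl: "stein_set \<Gamma>' - h ` ?S = h ` (stein_set \<Gamma> - ?S)"
        by (rule h_image_compl[OF cell_subset])
      have "h ` ?S \<subseteq> {y \<in> stein_set \<Gamma>'. \<bar>stein_proj y - stein_proj (h (Plus 0))\<bar> < 1}"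
      proof
        fix y assume "y \<in> h ` ?S"
        then obtain z where "z \<in> ?S" "y = h z" by blast
        then show "y \<in> {y \<in> stein_set \<Gamma>'. \<bar>stein_proj y - stein_proj (h (Plus 0))\<bar> < 1}"
          using S(3) U(4)[of z] h_in[of z] cell_subset[of \<Gamma> 0 a] by auto
      qed
      then obtain u w where uw: "u \<in> \<Gamma>'" "w \<in> \<Gamma>'" "u \<le> w" "h ` ?S \<subseteq> cell \<Gamma>' u w"
        using bounded_in_cell[OF B.dense] by blast
      have tc: "trace_measure (cell \<Gamma>' a b) = ennreal (1 * (b - a))"
        if "a \<in> \<Gamma>'" "b \<in> \<Gamma>'" "a \<le> b" for a b
        using trace_measure_cell[OF B.count that(3)] by simp
      have o: "stein_open \<Gamma>' (stein_set \<Gamma>' - h ` ?S)"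
        unfolding compl by (rule openin_h_image[OF S(2)])
      have te: "trace_measure {} = 0" by (simp add: trace_measure_def)
      obtain v where v: "v \<in> \<Gamma>'" "v \<ge> 0" "trace_measure (h ` ?S) = ennreal (1 * v)"
        by (rule clopen_value[where \<mu> = trace_measure and k = 1,
              OF B.dense_subgroup_axioms openin_h_image[OF S(1)] o tm_add te tc zero_le_one uw])
      have "ennreal (k * a) = ennreal (exp (- F (Plus 0))) * trace_measure (h ` ?S)"
      proof -
        have "?\<nu> ?S = ennreal (exp (- F (Plus 0))) * trace_measure (h ` ?S)"
          by (rule \<nu>_const[OF F S(1)]) (use U(3) S(3) in blast)
        then show ?thesis using cells[OF A.zero a(1)] a(2) by simp
      qed
      then have "ennreal (k * a) = ennreal (exp (- F (Plus 0)) * v)"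
        using v by (simp add: ennreal_mult')
      then have "k * a = exp (- F (Plus 0)) * v" using k a v by (subst (asm) ennreal_inj) auto
      then have "k' * a = v" by (simp add: k'_def exp_minus field_simps)
      then show "k' * a \<in> \<Gamma>'" using v by simp
    qed (use a B.add B.minus in \<open>auto simp: distrib_left\<close>)
  qed
  have onto: "\<exists>a\<in>\<Gamma>. c = k' * a" if sub: "\<Lambda>' \<subseteq> \<Lambda>" and c: "c \<in> \<Gamma>'" for c
  proof -
    define x where "x = p (Plus 0)"
    have x: "x \<in> stein_set \<Gamma>" "h x = Plus 0" using p_in h_p by (auto simp: x_def)
    let ?U = "{z \<in> stein_set \<Gamma>. \<bar>stein_proj z - stein_proj x\<bar> < 1} \<inter> {z \<in> stein_set \<Gamma>. F z = F x}"
    have U: "stein_open \<Gamma> ?U"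
      by (intro openin_Int openin_proj_ball openin_locally_constant[OF A.dense F] A.dense)
    have "Plus 0 \<in> h ` ?U" using x by (force simp: image_iff)
    then obtain \<epsilon> where \<epsilon>: "\<epsilon> > 0" "\<And>a. a < \<epsilon> \<Longrightarrow> cell \<Gamma>' 0 a \<subseteq> h ` ?U"
      using B.small_cell[OF openin_h_image[OF U]] by blast
    (* The translates of 0+ are dense, so one of them has the density of x; the ratio to the density
       at 0+ is then a value of the dilation cocycle. *)
    obtain \<delta> where \<delta>: "\<delta> > 0" "\<And>z. z \<in> stein_set \<Gamma> \<Longrightarrow> stein_near \<delta> x z \<Longrightarrow> F z = F x"
      using locally_constantD[OF F x(1)] by blast
    obtain s where s: "s \<in> \<Gamma>" "stein_near \<delta> x (Plus s)" using Plus_near[OF A.dense x(1) \<delta>(1)] .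
    define l where "l = exp (F x - F (Plus 0))"
    have "l = snd (C (s, 1) (Plus 0))"
      using coboundary[OF s(1) P0] \<delta>(2)[of "Plus s"] s by (simp add: l_def)
    then have l: "l \<in> \<Lambda>" using C_in[of "(s, 1)" "Plus 0"] s sub by auto
    show ?thesis
    proof (rule B.generated_by_small[OF \<epsilon>(1), where P = "\<lambda>c. \<exists>a\<in>\<Gamma>. c = k' * a"])
      fix c assume c: "c \<in> \<Gamma>'" "0 < c" "c < \<epsilon>"
      let ?T = "cell \<Gamma>' 0 c"
      have T: "stein_open \<Gamma>' ?T" "stein_open \<Gamma>' (stein_set \<Gamma>' - ?T)" "?T \<subseteq> h ` ?U"
        using openin_cell[OF B.dense B.zero c(1)] openin_cell_compl[OF B.dense B.zero c(1)] \<epsilon>(2)[OF c(3)] c by auto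
      let ?S = "p ` ?T"
      have hS: "h ` ?S = ?T" using cell_subset[of \<Gamma>' 0 c] by (force simp: image_iff)
      have SU: "?S \<subseteq> ?U" using T(3) by auto
      have compl: "stein_set \<Gamma> - ?S = p ` (stein_set \<Gamma>' - ?T)"
        by (rule p_image_compl[OF cell_subset])
      obtain u w where uw: "u \<in> \<Gamma>" "w \<in> \<Gamma>" "u \<le> w" "?S \<subseteq> cell \<Gamma> u w"
        using bounded_in_cell[OF A.dense, of ?S "stein_proj x"] SU by blast
      have o: "stein_open \<Gamma> (stein_set \<Gamma> - ?S)"
        unfolding compl by (rule openin_p_image[OF T(2)])
      obtain v where v: "v \<in> \<Gamma>" "v \<ge> 0" "?\<nu> ?S = ennreal (k * v)"
        by (rule clopen_value[where \<mu> = ?\<nu> and k = k,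
              OF A.dense_subgroup_axioms openin_p_image[OF T(1)] o \<nu>_union[OF F] \<nu>_empty[OF F]
                cells less_imp_le[OF k] uw])
      have "?\<nu> ?S = ennreal (exp (- F x)) * trace_measure ?T"
      proof -
        have "?\<nu> ?S = ennreal (exp (- F x)) * trace_measure (h ` ?S)"
          by (rule \<nu>_const[OF F openin_p_image[OF T(1)]]) (use SU in blast)
        then show ?thesis by (simp only: hS)
      qed
      then have "ennreal (k * v) = ennreal (exp (- F x) * c)"
        using trace_measure_cell[OF B.count, of 0 c] c v by (simp add: ennreal_mult')
      then have "k * v = exp (- F x) * c" using k c v by (subst (asm) ennreal_inj) auto
      then have "c = k * exp (F x) * v" by (simp add: exp_minus field_simps)
      also have "\<dots> = k' * (l * v)" by (simp add: k'_def l_def exp_diff)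
      finally show "\<exists>a\<in>\<Gamma>. c = k' * a" using A.scale[OF l v(1)] by blast
    next
      fix a b assume "\<exists>a'\<in>\<Gamma>. a = k' * a'" "\<exists>a'\<in>\<Gamma>. b = k' * a'"
      then show "\<exists>a'\<in>\<Gamma>. a + b = k' * a'" using A.add by (metis distrib_left)
    next
      fix a assume "\<exists>a'\<in>\<Gamma>. a = k' * a'"
      then show "\<exists>a'\<in>\<Gamma>. - a = k' * a'" using A.minus by (metis mult_minus_right)
    qed (use c in \<open>auto intro!: bexI[of _ 0]\<close>)
  qed
  show "\<exists>k>0. (\<forall>a\<in>\<Gamma>. k * a \<in> \<Gamma>') \<and> (\<Lambda>' \<subseteq> \<Lambda> \<longrightarrow> (\<forall>c\<in>\<Gamma>'. \<exists>a\<in>\<Gamma>. c = k * a))"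
    using k' into onto by blast
qed

end

section \<open>Rank at least two\<close>

lemma field_rat_ring: "field rat_ring"
proof -
  have "cring rat_ring"
  proof (rule cringI)
    show "abelian_group rat_ring"
      by (rule abelian_groupI) (auto simp: rat_ring_def intro: exI[of _ "- _"] add.left_inverse)
    show "Group.comm_monoid rat_ring"
      by (rule comm_monoidI) (auto simp: rat_ring_def)
  qed (auto simp: rat_ring_def distrib_right)
  then show ?thesis
  proof (rule cring.cring_fieldI)
    have "\<exists>y. x * y = 1" if "x \<noteq> 0" for x :: rat using that by (intro exI[of _ "inverse x"]) simp
    then show "Units rat_ring = carrier rat_ring - {\<zero>\<^bsub>rat_ring\<^esub>}"
      by (auto simp: Units_def rat_ring_def mult.commute)
  qed
qed

context
  fixes A :: "('a, 'm) monoid_scheme"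
  assumes A: "Group.monoid A"
begin

abbreviation (input) "FG \<equiv> free_Abelian_group (carrier A \<times> (UNIV :: rat set))"
abbreviation (input) "TK \<equiv> tensor_kernel A (additive_group :: rat monoid)"
abbreviation (input) "supported (f :: ('a \<times> rat) \<Rightarrow>\<^sub>0 int) \<equiv> Poly_Mapping.keys f \<subseteq> carrier A \<times> UNIV"
abbreviation (input) "scale_frag q \<equiv> frag_extend (\<lambda>(a, r). frag_of (a, q * r :: rat))"

lemma tensor_relations_subset: "tensor_relations A (additive_group :: rat monoid) \<subseteq> carrier FG"
  using monoid.m_closed[OF A] unfolding tensor_relations_def
  by (auto simp: additive_group_def dest!: subsetD[OF keys_diff])

lemma TK_eq: "TK = generate FG (tensor_relations A (additive_group :: rat monoid))"
  by (simp add: tensor_kernel_def additive_group_def)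

lemma TK_subgroup: "subgroup TK FG"
  unfolding TK_eq by (rule group.generate_is_subgroup[OF group_free_Abelian_group tensor_relations_subset])

lemma TK_keys: "x \<in> TK \<Longrightarrow> supported x"
  using subgroup.mem_carrier[OF TK_subgroup] by auto

lemma TK_zero: "0 \<in> TK"
  using subgroup.one_closed[OF TK_subgroup] by simp

lemma TK_add: "x \<in> TK \<Longrightarrow> y \<in> TK \<Longrightarrow> x + y \<in> TK"
  using subgroup.m_closed[OF TK_subgroup] by simp

lemma TK_minus: "x \<in> TK \<Longrightarrow> - x \<in> TK"
  using subgroup.m_inv_closed[OF TK_subgroup, of x] TK_keys[of x] by simp

lemma TK_diff: "x \<in> TK \<Longrightarrow> y \<in> TK \<Longrightarrow> x - y \<in> TK"
  using TK_add[of x "- y"] TK_minus[of y] by simp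

lemma TK_left:
  "a \<in> carrier A \<Longrightarrow> a' \<in> carrier A \<Longrightarrow> frag_of (a \<otimes>\<^bsub>A\<^esub> a', r) - frag_of (a, r) - frag_of (a', r) \<in> TK"
  unfolding TK_eq by (rule generate.incl) (auto simp: tensor_relations_def additive_group_def)

lemma TK_right:
  "a \<in> carrier A \<Longrightarrow> frag_of (a, r + r') - frag_of (a, r) - frag_of (a, r') \<in> TK"
  unfolding TK_eq tensor_relations_def
  by (rule generate.incl, rule UnI2, rule CollectI, rule exI[of _ a], rule exI[of _ r], rule exI[of _ r'])
    (simp add: additive_group_def)

lemma mem_coset: "x \<in> TK #>\<^bsub>FG\<^esub> f \<longleftrightarrow> x - f \<in> TK"
  by (auto simp: r_coset_def) (metis diff_add_cancel)

lemma coset_eq: "TK #>\<^bsub>FG\<^esub> f = TK #>\<^bsub>FG\<^esub> g \<longleftrightarrow> f - g \<in> TK"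
proof
  assume "TK #>\<^bsub>FG\<^esub> f = TK #>\<^bsub>FG\<^esub> g"
  moreover have "f \<in> TK #>\<^bsub>FG\<^esub> f" by (simp add: mem_coset TK_zero)
  ultimately show "f - g \<in> TK" by (simp add: mem_coset)
next
  assume fg: "f - g \<in> TK"
  have "x - f \<in> TK \<longleftrightarrow> x - g \<in> TK" for x
    using TK_add[OF _ fg, of "x - f"] TK_diff[OF _ fg, of "x - g"] by auto
  then show "TK #>\<^bsub>FG\<^esub> f = TK #>\<^bsub>FG\<^esub> g" by (auto simp: mem_coset)
qed

lemma coset_add: "(TK #>\<^bsub>FG\<^esub> f) <#>\<^bsub>FG\<^esub> (TK #>\<^bsub>FG\<^esub> g) = TK #>\<^bsub>FG\<^esub> (f + g)"
proof (intro equalityI subsetI)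
  fix x assume "x \<in> (TK #>\<^bsub>FG\<^esub> f) <#>\<^bsub>FG\<^esub> (TK #>\<^bsub>FG\<^esub> g)"
  then obtain y z where "y - f \<in> TK" "z - g \<in> TK" "x = y + z"
    by (auto simp: set_mult_def mem_coset)
  then show "x \<in> TK #>\<^bsub>FG\<^esub> (f + g)"
    using TK_add[of "y - f" "z - g"] by (simp add: mem_coset algebra_simps)
next
  fix x assume "x \<in> TK #>\<^bsub>FG\<^esub> (f + g)"
  then have 1: "x - g \<in> TK #>\<^bsub>FG\<^esub> f" and 2: "g \<in> TK #>\<^bsub>FG\<^esub> g"
    by (auto simp: mem_coset TK_zero algebra_simps)
  show "x \<in> (TK #>\<^bsub>FG\<^esub> f) <#>\<^bsub>FG\<^esub> (TK #>\<^bsub>FG\<^esub> g)"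
    unfolding set_mult_def by (rule UN_I[OF 1], rule UN_I[OF 2]) simp
qed

lemma scale_frag_TK: "x \<in> TK \<Longrightarrow> scale_frag q x \<in> TK"
proof -
  assume "x \<in> TK"
  then have "x \<in> generate FG (tensor_relations A (additive_group :: rat monoid))" by (simp add: TK_eq)
  then show "scale_frag q x \<in> TK"
  proof induction
    case one
    then show ?case by (simp add: TK_zero)
  next
    case (incl h)
    then show ?case
      using TK_left TK_right
      by (auto simp: tensor_relations_def frag_extend_diff additive_group_def distrib_left)
  next
    case (inv h)
    then have "scale_frag q h \<in> TK"
      using TK_left TK_right
      by (auto simp: tensor_relations_def frag_extend_diff additive_group_def distrib_left)
    moreover have "inv\<^bsub>FG\<^esub> h = - h"
      using subsetD[OF tensor_relations_subset inv] by (intro inv_free_Abelian_group) simp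
    ultimately show ?case by (simp add: frag_extend_minus TK_minus)
  next
    case (eng h1 h2)
    then show ?case by (simp add: frag_extend_add TK_add)
  qed
qed

lemma scale_frag_keys:
  "supported f \<Longrightarrow> supported (scale_frag q f)"
  by (rule order_trans[OF keys_frag_extend]) (auto split: prod.splits)

lemma carrier_rationalization:
  "carrier (rationalization A) = {TK #>\<^bsub>FG\<^esub> f |f. supported f}"
  by (auto simp: rationalization_def tensor_group_def FactGroup_def RCOSETS_def additive_group_def)

lemma rationalization_simps:
  "\<zero>\<^bsub>rationalization A\<^esub> = TK #>\<^bsub>FG\<^esub> 0"
  "(TK #>\<^bsub>FG\<^esub> f) \<oplus>\<^bsub>rationalization A\<^esub> (TK #>\<^bsub>FG\<^esub> g) = TK #>\<^bsub>FG\<^esub> (f + g)"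
  "q \<odot>\<^bsub>rationalization A\<^esub> (TK #>\<^bsub>FG\<^esub> f) = TK #>\<^bsub>FG\<^esub> scale_frag q f"
proof -
  have "x \<in> TK #>\<^bsub>FG\<^esub> 0 \<longleftrightarrow> x \<in> TK" for x by (simp add: mem_coset)
  then show "\<zero>\<^bsub>rationalization A\<^esub> = TK #>\<^bsub>FG\<^esub> 0"
    by (auto simp: rationalization_def tensor_group_def FactGroup_def additive_group_def)
  show "(TK #>\<^bsub>FG\<^esub> f) \<oplus>\<^bsub>rationalization A\<^esub> (TK #>\<^bsub>FG\<^esub> g) = TK #>\<^bsub>FG\<^esub> (f + g)"
    using coset_add by (simp add: rationalization_def tensor_group_def FactGroup_def additive_group_def)
  have "TK #>\<^bsub>FG\<^esub> scale_frag q g = TK #>\<^bsub>FG\<^esub> scale_frag q f" if "g \<in> TK #>\<^bsub>FG\<^esub> f" for g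
    using that scale_frag_TK[of "g - f" q] by (simp add: coset_eq mem_coset frag_extend_diff)
  moreover have "f \<in> TK #>\<^bsub>FG\<^esub> f" by (simp add: mem_coset TK_zero)
  ultimately have "(\<Union>g\<in>TK #>\<^bsub>FG\<^esub> f. TK #>\<^bsub>FG\<^esub> scale_frag q g) = TK #>\<^bsub>FG\<^esub> scale_frag q f"
    by blast
  then show "q \<odot>\<^bsub>rationalization A\<^esub> (TK #>\<^bsub>FG\<^esub> f) = TK #>\<^bsub>FG\<^esub> scale_frag q f"
    by (simp add: rationalization_def additive_group_def)
qed

text \<open>The dimension functions of vector spaces say something about \<open>A \<otimes> \<rat>\<close> only once it is known to be a
vector space. Each law holds for representatives in the free abelian group, either literally or
modulo the biadditivity relations in the rational argument.\<close>

lemma vectorspace_rationalization: "vectorspace rat_ring (rationalization A)"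
proof -
  let ?V = "rationalization A"
  interpret rat_ring: field rat_ring by (rule field_rat_ring)
  have keys_add: "supported (f + g)"
    if "supported f" "supported g"
    for f g :: "'a \<times> rat \<Rightarrow>\<^sub>0 int"
    using keys_add[of f g] that by blast
  have dist: "scale_frag (q + q') f - (scale_frag q f + scale_frag q' f) \<in> TK"
    if "supported f" for q q' f
    using that
  proof (induction f rule: free_Abelian_group_induct[consumes 1])
    case 1
    then show ?case by (simp add: TK_zero)
  next
    case (2 x y)
    then show ?case using TK_diff[OF 2(3,4)] by (simp add: frag_extend_diff algebra_simps)
  next
    case (3 a)
    then show ?case using TK_right[of "fst a" "q * snd a" "q' * snd a"]
      by (auto simp: distrib_right algebra_simps)
  qed
  have compat: "scale_frag (q * q') f = scale_frag q (scale_frag q' f)"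
    if "supported f" for q q' f
    using that
    by (induction f rule: free_Abelian_group_induct[consumes 1]) (auto simp: frag_extend_diff mult.assoc)
  have unit: "scale_frag 1 f = f" if "supported f" for f
    using that by (induction f rule: free_Abelian_group_induct[consumes 1]) (auto simp: frag_extend_diff)
  have "module rat_ring ?V"
  proof (rule module_criteria)
    show "cring rat_ring" ..
    show "\<zero>\<^bsub>?V\<^esub> \<in> carrier ?V"
      unfolding carrier_rationalization rationalization_simps by force
    show "\<forall>v w. v \<in> carrier ?V \<and> w \<in> carrier ?V \<longrightarrow> v \<oplus>\<^bsub>?V\<^esub> w \<in> carrier ?V"
      unfolding carrier_rationalization using keys_add by (auto simp: rationalization_simps) blast
    show "\<forall>v\<in>carrier ?V. \<exists>w\<in>carrier ?V. v \<oplus>\<^bsub>?V\<^esub> w = \<zero>\<^bsub>?V\<^esub>"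
    proof
      fix v assume "v \<in> carrier ?V"
      then obtain f where f: "v = TK #>\<^bsub>FG\<^esub> f" "supported f"
        by (auto simp: carrier_rationalization)
      then have "TK #>\<^bsub>FG\<^esub> (- f) \<in> carrier ?V" "v \<oplus>\<^bsub>?V\<^esub> (TK #>\<^bsub>FG\<^esub> (- f)) = \<zero>\<^bsub>?V\<^esub>"
        unfolding carrier_rationalization by (auto simp: rationalization_simps intro!: exI[of _ "- f"])
      then show "\<exists>w\<in>carrier ?V. v \<oplus>\<^bsub>?V\<^esub> w = \<zero>\<^bsub>?V\<^esub>" by blast
    qed
    show "\<forall>c v. c \<in> carrier rat_ring \<and> v \<in> carrier ?V \<longrightarrow> c \<odot>\<^bsub>?V\<^esub> v \<in> carrier ?V"
      unfolding carrier_rationalization using scale_frag_keys by (auto simp: rationalization_simps) blast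
    show "\<forall>v w. v \<in> carrier ?V \<and> w \<in> carrier ?V \<longrightarrow> v \<oplus>\<^bsub>?V\<^esub> w = w \<oplus>\<^bsub>?V\<^esub> v"
      unfolding carrier_rationalization by (auto simp: rationalization_simps add.commute)
    show "\<forall>v w x. v \<in> carrier ?V \<and> w \<in> carrier ?V \<and> x \<in> carrier ?V \<longrightarrow>
        v \<oplus>\<^bsub>?V\<^esub> w \<oplus>\<^bsub>?V\<^esub> x = v \<oplus>\<^bsub>?V\<^esub> (w \<oplus>\<^bsub>?V\<^esub> x)"
      unfolding carrier_rationalization by (auto simp: rationalization_simps add.assoc)
    show "\<forall>v\<in>carrier ?V. v \<oplus>\<^bsub>?V\<^esub> \<zero>\<^bsub>?V\<^esub> = v"
      unfolding carrier_rationalization by (auto simp: rationalization_simps)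
    show "\<forall>a b v. a \<in> carrier rat_ring \<and> b \<in> carrier rat_ring \<and> v \<in> carrier ?V \<longrightarrow>
        (a \<otimes>\<^bsub>rat_ring\<^esub> b) \<odot>\<^bsub>?V\<^esub> v = a \<odot>\<^bsub>?V\<^esub> (b \<odot>\<^bsub>?V\<^esub> v)"
      unfolding carrier_rationalization
      by (auto simp: rationalization_simps rat_ring_def compat)
    show "\<forall>v\<in>carrier ?V. \<one>\<^bsub>rat_ring\<^esub> \<odot>\<^bsub>?V\<^esub> v = v"
    proof
      fix v assume "v \<in> carrier ?V"
      then obtain f where f: "v = TK #>\<^bsub>FG\<^esub> f" "supported f"
        by (auto simp: carrier_rationalization)
      show "\<one>\<^bsub>rat_ring\<^esub> \<odot>\<^bsub>?V\<^esub> v = v"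
        unfolding f(1) rationalization_simps(3) using unit[OF f(2)] by (simp only: rat_ring_def monoid.simps)
    qed
    show "\<forall>a b v. a \<in> carrier rat_ring \<and> b \<in> carrier rat_ring \<and> v \<in> carrier ?V \<longrightarrow>
        (a \<oplus>\<^bsub>rat_ring\<^esub> b) \<odot>\<^bsub>?V\<^esub> v = a \<odot>\<^bsub>?V\<^esub> v \<oplus>\<^bsub>?V\<^esub> b \<odot>\<^bsub>?V\<^esub> v"
    proof (intro allI impI)
      fix a b v assume "a \<in> carrier rat_ring \<and> b \<in> carrier rat_ring \<and> v \<in> carrier ?V"
      then obtain f where f: "v = TK #>\<^bsub>FG\<^esub> f" "supported f"
        by (auto simp: carrier_rationalization)
      have "a \<oplus>\<^bsub>rat_ring\<^esub> b = a + b" by (simp add: rat_ring_def)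
      then show "(a \<oplus>\<^bsub>rat_ring\<^esub> b) \<odot>\<^bsub>?V\<^esub> v = a \<odot>\<^bsub>?V\<^esub> v \<oplus>\<^bsub>?V\<^esub> b \<odot>\<^bsub>?V\<^esub> v"
        unfolding f(1) rationalization_simps coset_eq using dist[OF f(2)] by simp
    qed
    show "\<forall>a v w. a \<in> carrier rat_ring \<and> v \<in> carrier ?V \<and> w \<in> carrier ?V \<longrightarrow>
        a \<odot>\<^bsub>?V\<^esub> (v \<oplus>\<^bsub>?V\<^esub> w) = a \<odot>\<^bsub>?V\<^esub> v \<oplus>\<^bsub>?V\<^esub> a \<odot>\<^bsub>?V\<^esub> w"
      unfolding carrier_rationalization by (auto simp: rationalization_simps frag_extend_add)
  qed
  then show ?thesis
    unfolding vectorspace_def using field_rat_ring by blast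
qed

end

text \<open>If every element of \<open>\<Gamma>\<close> is commensurable with \<open>e\<close>, then \<open>e \<otimes> 1\<close> spans: from \<open>m a = n e\<close> one gets
\<open>a \<otimes> m s = m a \<otimes> s = n e \<otimes> s = e \<otimes> n s\<close>.\<close>

lemma (in dense_subgroup) module_rank_le_one:
  assumes e: "e \<in> \<Gamma>"
    and comm: "\<And>a. a \<in> \<Gamma> \<Longrightarrow> \<exists>m n :: int. m \<noteq> 0 \<and> of_int m * a = of_int n * e"
  shows "module_rank \<Gamma> \<le> 1"
proof -
  let ?A = "(additive_group :: real monoid)\<lparr>carrier := \<Gamma>\<rparr>"
  let ?FG = "free_Abelian_group (carrier ?A \<times> (UNIV :: rat set))"
  let ?K = "tensor_kernel ?A (additive_group :: rat monoid)"
  let ?V = "rationalization ?A"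
  have A: "Group.monoid ?A"
    by (rule monoidI) (auto simp: additive_group_def add)
  note K_add = TK_add[OF A]
    and K_diff = TK_diff[OF A] and K_minus = TK_minus[OF A] and K_zero = TK_zero[OF A]
  interpret V: vectorspace rat_ring ?V by (rule vectorspace_rationalization[OF A])
  have left: "frag_of (a + a', r) - frag_of (a, r) - frag_of (a', r) \<in> ?K" if "a \<in> \<Gamma>" "a' \<in> \<Gamma>" for a a' r
    using TK_left[OF A, of a a' r] that by (simp add: additive_group_def)
  have right: "frag_of (a, r + r') - frag_of (a, r) - frag_of (a, r') \<in> ?K" if "a \<in> \<Gamma>" for a r r'
    using TK_right[OF A, of a r r'] that by simp
  have balanced: "frag_of (of_int m * a, r) - frag_of (a, of_int m * r) \<in> ?K" if a: "a \<in> \<Gamma>" for m a r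
  proof (induction m rule: int_induct[of _ 0])
    case base
    have "frag_of (0, r) \<in> ?K" using K_minus[OF left[of 0 0 r]] by simp
    moreover have "frag_of (a, 0) \<in> ?K" using K_minus[OF right[OF a, of 0 0]] by simp
    ultimately show ?case using K_diff by simp
  next
    case (step1 i)
    have "(frag_of (of_int i * a + a, r) - frag_of (of_int i * a, r) - frag_of (a, r)) +
        (frag_of (of_int i * a, r) - frag_of (a, of_int i * r)) -
        (frag_of (a, of_int i * r + r) - frag_of (a, of_int i * r) - frag_of (a, r)) \<in> ?K"
      by (intro K_add K_diff left right step1 int_mult a)
    then show ?case by (simp add: algebra_simps)
  next
    case (step2 i)
    have "(frag_of (of_int i * a, r) - frag_of (a, of_int i * r)) -
        (frag_of (of_int (i - 1) * a + a, r) - frag_of (of_int (i - 1) * a, r) - frag_of (a, r)) +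
        (frag_of (a, of_int (i - 1) * r + r) - frag_of (a, of_int (i - 1) * r) - frag_of (a, r)) \<in> ?K"
      by (intro K_add K_diff left right step2 int_mult a)
    moreover have "of_int (i - 1) * a + a = of_int i * a" "of_int (i - 1) * r + r = of_int i * r"
      by (simp_all add: algebra_simps)
    ultimately show ?case by (simp only:) (simp add: algebra_simps)
  qed
  have span: "\<exists>q. f - frag_of (e, q) \<in> ?K" if "Poly_Mapping.keys f \<subseteq> \<Gamma> \<times> UNIV" for f
    using that
  proof (induction f rule: free_Abelian_group_induct[consumes 1])
    case 1
    have "- frag_of (e, 0) \<in> ?K" using right[OF e, of 0 0] by simp
    then show ?case by auto
  next
    case (2 x y)
    then obtain q q' where q: "x - frag_of (e, q) \<in> ?K" "y - frag_of (e, q') \<in> ?K" by blast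
    have "(x - frag_of (e, q)) - (y - frag_of (e, q')) +
        (frag_of (e, (q - q') + q') - frag_of (e, q - q') - frag_of (e, q')) \<in> ?K"
      by (intro K_add K_diff q right e)
    then have "x - y - frag_of (e, q - q') \<in> ?K" by (simp add: algebra_simps)
    then show ?case by blast
  next
    case (3 x)
    then obtain a r where x: "x = (a, r)" "a \<in> \<Gamma>" by auto
    obtain m n :: int where mn: "m \<noteq> 0" "of_int m * a = of_int n * e" using comm[OF x(2)] by blast
    define s where "s = r / of_int m"
    have r: "r = of_int m * s" using mn by (simp add: s_def)
    have "(frag_of (of_int n * e, s) - frag_of (e, of_int n * s)) -
        (frag_of (of_int m * a, s) - frag_of (a, of_int m * s)) \<in> ?K"
      by (intro K_diff balanced e x)
    then have "frag_of x - frag_of (e, of_int n * s) \<in> ?K" using mn r x by simp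
    then show ?case by blast
  qed
  let ?v = "?K #>\<^bsub>?FG\<^esub> frag_of (e, 1)"
  have v: "?v \<in> carrier ?V"
    unfolding carrier_rationalization[OF A] using e by (intro CollectI exI[of _ "frag_of (e, 1)"]) auto
  have gen: "V.span {?v} = carrier ?V"
  proof
    show "V.span {?v} \<subseteq> carrier ?V" using v by (intro V.span_is_subset2) auto
    show "carrier ?V \<subseteq> V.span {?v}"
    proof
      fix w assume "w \<in> carrier ?V"
      then obtain f where f: "w = ?K #>\<^bsub>?FG\<^esub> f" "Poly_Mapping.keys f \<subseteq> \<Gamma> \<times> UNIV"
        unfolding carrier_rationalization[OF A] by auto
      obtain q where q: "f - frag_of (e, q) \<in> ?K" using span[OF f(2)] by blast
      have "w = q \<odot>\<^bsub>?V\<^esub> ?v"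
        unfolding f(1) rationalization_simps(3)[OF A] coset_eq[OF A] using q by simp
      also have "\<dots> = V.lincomb (\<lambda>_. q) {?v}"
        using v V.smult_closed[of q ?v] by (simp add: V.lincomb_def rat_ring_def)
      also have "\<dots> \<in> V.span {?v}"
        unfolding V.span_def by (auto simp: rat_ring_def intro!: exI[of _ "\<lambda>_. q"] exI[of _ "{?v}"])
      finally show "w \<in> V.span {?v}" .
    qed
  qed
  have fd: "V.fin_dim"
    unfolding V.fin_dim_def using gen v by (intro exI[of _ "{?v}"]) auto
  have "V.dim \<le> 1"
    unfolding V.dim_def using gen v by (intro Least_le exI[of _ "{?v}"]) auto
  then show ?thesis
    using fd by (simp add: module_rank_def abelian_rank_def one_enat_def)
qed

lemma (in dense_subgroup) rank_ge_two_imp_rotation: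
  assumes "module_rank \<Gamma> \<ge> 2"
  obtains e \<alpha> where "circle_rotation \<Gamma> e \<alpha>"
proof -
  obtain e where e: "e \<in> \<Gamma>" "e > 0" using dense_above[OF dense] .
  have "\<exists>\<alpha>\<in>\<Gamma>. \<forall>m n :: int. of_int m * \<alpha> = of_int n * e \<longrightarrow> m = 0"
  proof (rule ccontr)
    assume "\<not> ?thesis"
    then have "module_rank \<Gamma> \<le> 1"
      using e by (intro module_rank_le_one[of e]) (auto, blast)
    then have "(2 :: enat) \<le> 1" using assms by (rule order_trans[rotated])
    then show False by (simp add: one_enat_def numeral_eq_enat)
  qed
  then obtain \<alpha> where "\<alpha> \<in> \<Gamma>" "\<And>m n :: int. of_int m * \<alpha> = of_int n * e \<Longrightarrow> m = 0" by blast
  then have "circle_rotation \<Gamma> e \<alpha>" using e by unfold_locales auto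
  then show ?thesis by (rule that)
qed

section \<open>From groupoid isomorphisms to orbit maps\<close>

lemma group_positive_reals: "group positive_reals"
proof (rule groupI)
  fix x assume "x \<in> carrier positive_reals"
  then show "\<exists>y\<in>carrier positive_reals. y \<otimes>\<^bsub>positive_reals\<^esub> x = \<one>\<^bsub>positive_reals\<^esub>"
    by (intro bexI[of _ "inverse x"]) (auto simp: positive_reals_def)
qed (auto simp: positive_reals_def)

lemma group_additive_group: "group (additive_group :: 'a::ab_group_add monoid)"
proof (rule groupI)
  fix x :: 'a assume "x \<in> carrier additive_group"
  show "\<exists>y\<in>carrier additive_group. y \<otimes>\<^bsub>additive_group\<^esub> x = \<one>\<^bsub>additive_group\<^esub>"
    by (intro bexI[of _ "- x"]) (auto simp: additive_group_def)
qed (auto simp: additive_group_def add.assoc)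

lemma stein_systemI:
  assumes \<Lambda>: "subgroup \<Lambda> positive_reals" and \<Gamma>: "is_Z\<Lambda>_module \<Lambda> \<Gamma>"
    and "countable \<Gamma>" "closure \<Gamma> = UNIV"
  shows "stein_system \<Gamma> \<Lambda>"
proof
  have sub: "subgroup \<Gamma> additive_group"
    using \<Gamma> by (auto simp: is_Z\<Lambda>_module_def)
  show "0 \<in> \<Gamma>" using subgroup.one_closed[OF sub] by (simp add: additive_group_def)
  show "s + t \<in> \<Gamma>" if "s \<in> \<Gamma>" "t \<in> \<Gamma>" for s t
    using subgroup.m_closed[OF sub that] by (simp add: additive_group_def)
  show "- s \<in> \<Gamma>" if "s \<in> \<Gamma>" for s
  proof -
    have "inv\<^bsub>additive_group\<^esub> s = - s"
      by (rule group.inv_equality[OF group_additive_group]) (auto simp: additive_group_def)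
    then show ?thesis using subgroup.m_inv_closed[OF sub that] by simp
  qed
  show pos: "l > 0" if "l \<in> \<Lambda>" for l
    using subgroup.mem_carrier[OF \<Lambda> that] by (simp add: positive_reals_def)
  show "1 \<in> \<Lambda>" using subgroup.one_closed[OF \<Lambda>] by (simp add: positive_reals_def)
  show "l * m \<in> \<Lambda>" if "l \<in> \<Lambda>" "m \<in> \<Lambda>" for l m
    using subgroup.m_closed[OF \<Lambda> that] by (simp add: positive_reals_def)
  show "inverse l \<in> \<Lambda>" if "l \<in> \<Lambda>" for l
  proof -
    have "inv\<^bsub>positive_reals\<^esub> l = inverse l"
      using pos[OF that] by (intro group.inv_equality[OF group_positive_reals]) (auto simp: positive_reals_def)
    then show ?thesis using subgroup.m_inv_closed[OF \<Lambda> that] by simp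
  qed
qed (use assms in \<open>auto simp: is_Z\<Lambda>_module_def\<close>)

lemma affine_group_simps [simp]:
  "carrier (affine_group \<Gamma> \<Lambda>) = \<Gamma> \<times> \<Lambda>"
  "g \<otimes>\<^bsub>affine_group \<Gamma> \<Lambda>\<^esub> g' = (fst g + snd g * fst g', snd g * snd g')"
  "\<one>\<^bsub>affine_group \<Gamma> \<Lambda>\<^esub> = (0, 1)"
  by (auto simp: affine_group_def split_beta)

context stein_system
begin

lemma group_affine_group: "group (affine_group \<Gamma> \<Lambda>)"
proof (rule groupI)
  fix g assume g: "g \<in> carrier (affine_group \<Gamma> \<Lambda>)"
  then show "\<exists>g'\<in>carrier (affine_group \<Gamma> \<Lambda>). g' \<otimes>\<^bsub>affine_group \<Gamma> \<Lambda>\<^esub> g = \<one>\<^bsub>affine_group \<Gamma> \<Lambda>\<^esub>"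
    using affine_inverse_in[of g] \<Lambda>_pos[of "snd g"]
    by (intro bexI[of _ "affine_inverse g"]) (auto simp: affine_inverse_def)
qed (auto simp: add scale \<Lambda>_mult algebra_simps)

lemma inv_affine_group:
  assumes "g \<in> \<Gamma> \<times> \<Lambda>"
  shows "inv\<^bsub>affine_group \<Gamma> \<Lambda>\<^esub> g = affine_inverse g"
  using assms affine_inverse_in[OF assms] \<Lambda>_pos[of "snd g"]
  by (intro group.inv_equality[OF group_affine_group]) (auto simp: affine_inverse_def)

lemma topspace_stein_arrows [simp]:
  "topspace (arrows (stein_groupoid \<Gamma> \<Lambda>)) = stein_set \<Gamma> \<times> (\<Gamma> \<times> \<Lambda>)"
  by (simp add: stein_groupoid_def transformation_groupoid_def)

lemma stein_groupoid_simps [simp]: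
  "arrows (stein_groupoid \<Gamma> \<Lambda>) = prod_topology (stein_space \<Gamma>) (discrete_topology (\<Gamma> \<times> \<Lambda>))"
  "gunits (stein_groupoid \<Gamma> \<Lambda>) = stein_set \<Gamma> \<times> {(0, 1)}"
  "grange (stein_groupoid \<Gamma> \<Lambda>) (x, g) = (x, (0, 1))"
  "gmult (stein_groupoid \<Gamma> \<Lambda>) (x, g) (y, g') = (x, (fst g + snd g * fst g', snd g * snd g'))"
  by (simp_all add: stein_groupoid_def transformation_groupoid_def)

lemma gsource_stein_groupoid:
  "g \<in> \<Gamma> \<times> \<Lambda> \<Longrightarrow> gsource (stein_groupoid \<Gamma> \<Lambda>) (x, g) = (stein_action (affine_inverse g) x, (0, 1))"
  by (simp add: stein_groupoid_def transformation_groupoid_def inv_affine_group)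

end

text \<open>The arrow \<open>(g x, g)\<close> has range \<open>g x\<close> and source \<open>x\<close>. Its image has range \<open>h (g x)\<close> and source \<open>h x\<close>, so its
group component carries \<open>h x\<close> to \<open>h (g x)\<close>. Products of such arrows give the cocycle equation,
and discreteness of the group makes the cocycle locally constant.\<close>

lemma orbit_map_of_groupoid_isomorphism:
  assumes S1: "stein_system \<Gamma> \<Lambda>" and S2: "stein_system \<Gamma>' \<Lambda>'"
    and maps: "homeomorphic_maps (arrows (stein_groupoid \<Gamma> \<Lambda>)) (arrows (stein_groupoid \<Gamma>' \<Lambda>')) \<phi> \<psi>"
    and \<phi>: "groupoid_hom (stein_groupoid \<Gamma> \<Lambda>) (stein_groupoid \<Gamma>' \<Lambda>') \<phi>"
    and \<psi>: "groupoid_hom (stein_groupoid \<Gamma>' \<Lambda>') (stein_groupoid \<Gamma> \<Lambda>) \<psi>"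
  shows "orbit_map \<Gamma> \<Lambda> \<Gamma>' \<Lambda>' (\<lambda>x. fst (\<phi> (x, (0, 1)))) (\<lambda>y. fst (\<psi> (y, (0, 1))))
    (\<lambda>g x. snd (\<phi> (stein_action g x, g)))"
proof -
  interpret A: stein_system \<Gamma> \<Lambda> by fact
  interpret B: stein_system \<Gamma>' \<Lambda>' by fact
  let ?S = "stein_groupoid \<Gamma> \<Lambda>" and ?T = "stein_groupoid \<Gamma>' \<Lambda>'"
  let ?X = "prod_topology (stein_space \<Gamma>) (discrete_topology (\<Gamma> \<times> \<Lambda>))"
    and ?Y = "prod_topology (stein_space \<Gamma>') (discrete_topology (\<Gamma>' \<times> \<Lambda>'))"
  let ?h = "\<lambda>x. fst (\<phi> (x, (0, 1)))" and ?p = "\<lambda>y. fst (\<psi> (y, (0, 1)))"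
  have cont: "continuous_map ?X ?Y \<phi>"
    "continuous_map ?Y ?X \<psi>"
    and inverse: "\<And>a. a \<in> stein_set \<Gamma> \<times> (\<Gamma> \<times> \<Lambda>) \<Longrightarrow> \<psi> (\<phi> a) = a"
      "\<And>a. a \<in> stein_set \<Gamma>' \<times> (\<Gamma>' \<times> \<Lambda>') \<Longrightarrow> \<phi> (\<psi> a) = a"
    using maps by (auto simp: homeomorphic_maps_def)
  have \<phi>_in: "\<phi> a \<in> stein_set \<Gamma>' \<times> (\<Gamma>' \<times> \<Lambda>')" if "a \<in> stein_set \<Gamma> \<times> (\<Gamma> \<times> \<Lambda>)" for a
    using \<phi> that unfolding groupoid_hom_def A.topspace_stein_arrows B.topspace_stein_arrows by blast
  have \<phi>_unit: "\<phi> (x, (0, 1)) = (?h x, (0, 1))" "?h x \<in> stein_set \<Gamma>'" if "x \<in> stein_set \<Gamma>" for x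
  proof -
    have "(x, (0, 1)) \<in> gunits ?S" using that by simp
    then have "\<phi> (x, (0, 1)) \<in> gunits ?T"
      using \<phi> unfolding groupoid_hom_def by blast
    then have "\<phi> (x, (0, 1)) \<in> stein_set \<Gamma>' \<times> {(0, 1)}" by simp
    then show "\<phi> (x, (0, 1)) = (?h x, (0, 1))" "?h x \<in> stein_set \<Gamma>'"
      by (metis mem_Times_iff prod.collapse singletonD)+
  qed
  have \<psi>_unit: "\<psi> (y, (0, 1)) = (?p y, (0, 1))" if "y \<in> stein_set \<Gamma>'" for y
  proof -
    have "(y, (0, 1)) \<in> gunits ?T" using that by simp
    then have "\<psi> (y, (0, 1)) \<in> gunits ?S"
      using \<psi> unfolding groupoid_hom_def by blast
    then have "\<psi> (y, (0, 1)) \<in> stein_set \<Gamma> \<times> {(0, 1)}" by simp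
    then show "\<psi> (y, (0, 1)) = (?p y, (0, 1))"
      by (metis mem_Times_iff prod.collapse singletonD)
  qed
  have hom: "\<phi> (grange ?S a) = grange ?T (\<phi> a)"
    "\<phi> (gsource ?S a) = gsource ?T (\<phi> a)"
    if "a \<in> stein_set \<Gamma> \<times> (\<Gamma> \<times> \<Lambda>)" for a
    using \<phi> that unfolding groupoid_hom_def A.topspace_stein_arrows by blast+
  have hom_mult: "\<phi> (gmult ?S a b) = gmult ?T (\<phi> a) (\<phi> b)"
    if "a \<in> stein_set \<Gamma> \<times> (\<Gamma> \<times> \<Lambda>)" "b \<in> stein_set \<Gamma> \<times> (\<Gamma> \<times> \<Lambda>)"
      "gsource ?S a = grange ?S b" for a b
    using \<phi> that unfolding groupoid_hom_def A.topspace_stein_arrows by blast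
  have fst_\<phi>: "fst (\<phi> (x, g)) = ?h x" if "x \<in> stein_set \<Gamma>" "g \<in> \<Gamma> \<times> \<Lambda>" for x g
  proof -
    have "\<phi> (x, (0, 1)) = grange ?T (\<phi> (x, g))"
      using hom(1)[of "(x, g)"] that by simp
    also have "\<dots> = (fst (\<phi> (x, g)), (0, 1))" by (metis B.stein_groupoid_simps(3) prod.collapse)
    finally show ?thesis by simp
  qed
  show ?thesis
  proof
    show "homeomorphic_maps (stein_space \<Gamma>) (stein_space \<Gamma>') ?h ?p"
      unfolding homeomorphic_maps_def
    proof (intro conjI ballI)
      have "continuous_map (stein_space \<Gamma>) ?X
          (\<lambda>x. (x, (0, 1)))" by (intro continuous_map_pairedI) auto
      from continuous_map_compose[OF continuous_map_compose[OF this cont(1)] continuous_map_fst]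
      show "continuous_map (stein_space \<Gamma>) (stein_space \<Gamma>') ?h" by (simp add: o_def)
      have "continuous_map (stein_space \<Gamma>') ?Y
          (\<lambda>x. (x, (0, 1)))" by (intro continuous_map_pairedI) auto
      from continuous_map_compose[OF continuous_map_compose[OF this cont(2)] continuous_map_fst]
      show "continuous_map (stein_space \<Gamma>') (stein_space \<Gamma>) ?p" by (simp add: o_def)
      show "?p (?h x) = x" if "x \<in> topspace (stein_space \<Gamma>)" for x
        using \<phi>_unit(1)[of x, symmetric] inverse(1)[of "(x, (0, 1))"] that by simp
      show "?h (?p y) = y" if "y \<in> topspace (stein_space \<Gamma>')" for y
        using \<psi>_unit[of y, symmetric] inverse(2)[of "(y, (0, 1))"] that by simp
    qed
  next
    fix g x assume "g \<in> \<Gamma> \<times> \<Lambda>" "x \<in> stein_set \<Gamma>"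
    then show "snd (\<phi> (stein_action g x, g)) \<in> \<Gamma>' \<times> \<Lambda>'"
      using \<phi>_in[of "(stein_action g x, g)"] by auto
  next
    fix g x assume g: "g \<in> \<Gamma> \<times> \<Lambda>" and x: "x \<in> stein_set \<Gamma>"
    let ?c = "snd (\<phi> (stein_action g x, g))"
    have gx: "(stein_action g x, g) \<in> stein_set \<Gamma> \<times> (\<Gamma> \<times> \<Lambda>)" using g x by simp
    have c: "?c \<in> \<Gamma>' \<times> \<Lambda>'" using \<phi>_in[OF gx] by auto
    have e: "\<phi> (stein_action g x, g) = (?h (stein_action g x), ?c)"
      using fst_\<phi>[of "stein_action g x" g] g x by (metis A.action_in prod.collapse)
    have "\<phi> (x, (0, 1)) = gsource ?T (\<phi> (stein_action g x, g))"
      using hom(2)[OF gx] g A.gsource_stein_groupoid[OF g] by simp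
    also have "\<dots> = gsource ?T (?h (stein_action g x), ?c)"
      by (rule arg_cong[OF e])
    also have "\<dots> = (stein_action (affine_inverse ?c) (?h (stein_action g x)), (0, 1))"
      by (rule B.gsource_stein_groupoid[OF c])
    finally have "?h x = stein_action (affine_inverse ?c) (?h (stein_action g x))" by simp
    then show "?h (stein_action g x) = stein_action ?c (?h x)" using c by simp
  next
    fix g assume g: "g \<in> \<Gamma> \<times> \<Lambda>"
    have "continuous_map (stein_space \<Gamma>) ?X
        (\<lambda>x. (x, g))" using g by (intro continuous_map_pairedI) auto
    from continuous_map_compose[OF continuous_map_compose[OF this cont(1)] continuous_map_snd]
    have D: "continuous_map (stein_space \<Gamma>) (discrete_topology (\<Gamma>' \<times> \<Lambda>')) (\<lambda>x. snd (\<phi> (x, g)))"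
      by (simp add: o_def)
    have "locally_constant \<Gamma> (\<lambda>x. snd (\<phi> (x, g)))"
      unfolding locally_constant_def
    proof
      fix x assume x: "x \<in> stein_set \<Gamma>"
      have "snd (\<phi> (x, g)) \<in> \<Gamma>' \<times> \<Lambda>'" using \<phi>_in[of "(x, g)"] g x by auto
      then have "stein_open \<Gamma> {z \<in> stein_set \<Gamma>. snd (\<phi> (z, g)) \<in> {snd (\<phi> (x, g))}}"
        using openin_continuous_map_preimage[OF D, of "{snd (\<phi> (x, g))}"] by simp
      then show "\<exists>\<epsilon>>0. \<forall>z\<in>stein_set \<Gamma>. stein_near \<epsilon> x z \<longrightarrow> snd (\<phi> (z, g)) = snd (\<phi> (x, g))"
        unfolding openin_stein_space_iff[OF A.dense] using x by blast
    qed
    then show "locally_constant \<Gamma> (\<lambda>x. snd (\<phi> (stein_action g x, g)))"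
      using A.locally_constant_action g by blast
  next
    fix g g' x assume g: "g \<in> \<Gamma> \<times> \<Lambda>" "g' \<in> \<Gamma> \<times> \<Lambda>" and x: "x \<in> stein_set \<Gamma>"
    let ?m = "(fst g + snd g * fst g', snd g * snd g')"
    let ?y = "stein_action g' x"
    have y: "?y \<in> stein_set \<Gamma>" using g x by simp
    have "gmult ?S (stein_action g ?y, g) (?y, g') = (stein_action ?m x, ?m)"
      by (simp add: stein_action_action)
    moreover have "\<phi> (gmult ?S (stein_action g ?y, g) (?y, g')) =
        gmult ?T (\<phi> (stein_action g ?y, g)) (\<phi> (?y, g'))"
      using g y A.gsource_stein_groupoid[OF g(1)] by (intro hom_mult) simp_all
    moreover have "snd (snd (gmult ?T a b)) = snd (snd a) * snd (snd b)" for a b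
      by (cases a; cases b) simp
    ultimately show "snd (snd (\<phi> (stein_action ?m x, ?m))) =
        snd (snd (\<phi> (stein_action g ?y, g))) * snd (snd (\<phi> (stein_action g' x, g')))" by metis
  qed
qed

lemma isomorphic_top_groupoids_imp_orbit_map:
  assumes "stein_system \<Gamma> \<Lambda>" "stein_system \<Gamma>' \<Lambda>'"
    and "isomorphic_top_groupoids (stein_groupoid \<Gamma> \<Lambda>) (stein_groupoid \<Gamma>' \<Lambda>')"
  shows "\<exists>h p C. orbit_map \<Gamma> \<Lambda> \<Gamma>' \<Lambda>' h p C" "\<exists>h p C. orbit_map \<Gamma>' \<Lambda>' \<Gamma> \<Lambda> h p C"
proof -
  obtain \<phi> \<psi> where *: "homeomorphic_maps (arrows (stein_groupoid \<Gamma> \<Lambda>)) (arrows (stein_groupoid \<Gamma>' \<Lambda>')) \<phi> \<psi>"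
    "groupoid_hom (stein_groupoid \<Gamma> \<Lambda>) (stein_groupoid \<Gamma>' \<Lambda>') \<phi>"
    "groupoid_hom (stein_groupoid \<Gamma>' \<Lambda>') (stein_groupoid \<Gamma> \<Lambda>) \<psi>"
    using assms(3) by (auto simp: isomorphic_top_groupoids_def)
  show "\<exists>h p C. orbit_map \<Gamma> \<Lambda> \<Gamma>' \<Lambda>' h p C"
    using orbit_map_of_groupoid_isomorphism[OF assms(1,2) *] by blast
  show "\<exists>h p C. orbit_map \<Gamma>' \<Lambda>' \<Gamma> \<Lambda> h p C"
    using orbit_map_of_groupoid_isomorphism[OF assms(2,1) homeomorphic_maps_sym[THEN iffD1, OF *(1)] *(3,2)] by blast
qed

text \<open>Rigidity needs a weight, which exists unless \<open>\<Lambda>\<close> is trivial and \<open>\<Lambda>'\<close> is not. The inclusion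
\<open>\<Lambda>' \<subseteq> \<Lambda>\<close> excludes this case. If \<open>\<Lambda>'\<close> is nontrivial, then the inverse orbit map has a weight, and
the inclusion is part of its rigidity.\<close>

lemma orbit_maps_imp_similar:
  assumes S1: "stein_system \<Gamma> \<Lambda>" and S2: "stein_system \<Gamma>' \<Lambda>'"
    and rank: "module_rank \<Gamma> \<ge> 2" "module_rank \<Gamma>' \<ge> 2"
    and f: "orbit_map \<Gamma> \<Lambda> \<Gamma>' \<Lambda>' h p C" and b: "orbit_map \<Gamma>' \<Lambda>' \<Gamma> \<Lambda> h' p' C'"
  shows "\<Lambda> = \<Lambda>' \<and> (\<exists>s>0. \<Gamma> = (*) s ` \<Gamma>')"
proof -
  interpret f: orbit_map \<Gamma> \<Lambda> \<Gamma>' \<Lambda>' h p C by fact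
  interpret b: orbit_map \<Gamma>' \<Lambda>' \<Gamma> \<Lambda> h' p' C' by fact
  obtain e \<alpha> where r1: "circle_rotation \<Gamma> e \<alpha>" using f.A.rank_ge_two_imp_rotation[OF rank(1)] .
  obtain e' \<alpha>' where r2: "circle_rotation \<Gamma>' e' \<alpha>'" using f.B.rank_ge_two_imp_rotation[OF rank(2)] .
  have \<Lambda>12: "\<Lambda>' \<subseteq> \<Lambda>"
  proof (cases "\<Lambda>' = {1}")
    case False
    then obtain F where F: "b.drift_weight F (\<lambda>_. 0)"
      using b.weight_exists[OF r2] by blast
    show ?thesis using b.rigidity(1)[OF F] .
  qed (use f.A.\<Lambda>_one in simp)
  then have "\<Lambda>' = {1} \<or> \<Lambda> \<noteq> {1}" using f.B.\<Lambda>_one by blast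
  then obtain F where F: "f.drift_weight F (\<lambda>_. 0)"
    using f.weight_exists[OF r1] by blast
  have \<Lambda>: "\<Lambda> = \<Lambda>'" using f.rigidity(1)[OF F] \<Lambda>12 by blast
  obtain k where k: "k > 0" "\<forall>a\<in>\<Gamma>. k * a \<in> \<Gamma>'" "\<forall>c\<in>\<Gamma>'. \<exists>a\<in>\<Gamma>. c = k * a"
    using f.rigidity(2)[OF F] \<Lambda>12 by blast
  have "\<Gamma> = (*) (1 / k) ` \<Gamma>'"
  proof (intro equalityI subsetI)
    fix a assume "a \<in> \<Gamma>"
    then show "a \<in> (*) (1 / k) ` \<Gamma>'" using k by (intro image_eqI[of _ _ "k * a"]) auto
  next
    fix a assume "a \<in> (*) (1 / k) ` \<Gamma>'"
    then obtain c where "c \<in> \<Gamma>'" "a = 1 / k * c" by auto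
    then show "a \<in> \<Gamma>" using k by force
  qed
  moreover have "1 / k > 0" using k(1) by simp
  ultimately show ?thesis using \<Lambda> by blast
qed

section \<open>From similarity to conjugacy to isomorphism\<close>

lemma stein_dilation_homeomorphic:
  assumes d: "closure \<Gamma> = UNIV" "closure \<Gamma>' = UNIV" and s: "s > 0" and eq: "\<Gamma>' = (*) s ` \<Gamma>"
  shows "homeomorphic_maps (stein_space \<Gamma>) (stein_space \<Gamma>') (stein_action (0, s)) (stein_action (0, inverse s))"
proof -
  have cont: "continuous_map (stein_space \<Gamma>) (stein_space \<Gamma>') (stein_action (0, s))"
    if d: "closure \<Gamma> = UNIV" "closure \<Gamma>' = UNIV" and s: "s > 0" and eq: "\<And>t. s * t \<in> \<Gamma>' \<longleftrightarrow> t \<in> \<Gamma>"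
    for \<Gamma> \<Gamma>' :: "real set" and s
  proof -
    have in_iff: "stein_action (0, s) x \<in> stein_set \<Gamma>' \<longleftrightarrow> x \<in> stein_set \<Gamma>" for x
      using eq by (cases x) auto
    have "stein_open \<Gamma> {x \<in> stein_set \<Gamma>. stein_action (0, s) x \<in> U}"
      if U: "stein_open \<Gamma>' U" for U
      unfolding openin_stein_space_iff[OF d(1)]
    proof (intro conjI ballI)
      fix x assume "x \<in> {x \<in> stein_set \<Gamma>. stein_action (0, s) x \<in> U}"
      then obtain \<epsilon> where e: "\<epsilon> > 0" "\<And>z. z \<in> stein_set \<Gamma>' \<Longrightarrow> stein_near \<epsilon> (stein_action (0, s) x) z \<Longrightarrow> z \<in> U"
        using U unfolding openin_stein_space_iff[OF d(2)] by blast
      have "stein_action (0, s) z \<in> U" if "z \<in> stein_set \<Gamma>" "stein_near (\<epsilon> / s) x z" for z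
        using e(2)[of "stein_action (0, s) z"] stein_near_action[of "(0, s)" "\<epsilon> / s" x z] that s in_iff by simp
      then show "\<exists>\<epsilon>>0. \<forall>z\<in>stein_set \<Gamma>. stein_near \<epsilon> x z \<longrightarrow> z \<in> {x \<in> stein_set \<Gamma>. stein_action (0, s) x \<in> U}"
        using e(1) s by (intro exI[of _ "\<epsilon> / s"]) auto
    qed auto
    then show ?thesis using in_iff by (auto simp: continuous_map_def)
  qed
  show ?thesis
    unfolding homeomorphic_maps_def
  proof (intro conjI ballI)
    show "continuous_map (stein_space \<Gamma>) (stein_space \<Gamma>') (stein_action (0, s))"
      using s eq by (intro cont d) auto
    show "continuous_map (stein_space \<Gamma>') (stein_space \<Gamma>) (stein_action (0, inverse s))"
    proof (rule cont[OF d(2,1)])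
      show "inverse s * t \<in> \<Gamma> \<longleftrightarrow> t \<in> \<Gamma>'" for t
      proof
        assume "inverse s * t \<in> \<Gamma>"
        then show "t \<in> \<Gamma>'" unfolding eq using s by (intro image_eqI[of _ _ "inverse s * t"]) auto
      qed (use s eq in \<open>auto simp: mult.assoc[symmetric]\<close>)
    qed (use s in simp)
  qed (use s in \<open>auto simp: stein_action_action\<close>)
qed

lemma similar_imp_conjugate:
  assumes S1: "stein_system \<Gamma> \<Lambda>" and S2: "stein_system \<Gamma>' \<Lambda>"
    and s: "s > 0" "\<Gamma> = (*) s ` \<Gamma>'"
  shows "conjugate_actions (affine_group \<Gamma> \<Lambda>) (stein_space \<Gamma>) stein_action
           (affine_group \<Gamma>' \<Lambda>) (stein_space \<Gamma>') stein_action"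
proof -
  interpret A: stein_system \<Gamma> \<Lambda> by fact
  interpret B: stein_system \<Gamma>' \<Lambda> by fact
  let ?\<theta> = "\<lambda>(t, l). (inverse s * t, l :: real)"
  have "bij_betw ?\<theta> (\<Gamma> \<times> \<Lambda>) (\<Gamma>' \<times> \<Lambda>)"
    by (rule bij_betw_byWitness[of _ "\<lambda>(t, l). (s * t, l)"]) (use s in \<open>auto simp: mult.assoc[symmetric]\<close>)
  moreover have "?\<theta> \<in> hom (affine_group \<Gamma> \<Lambda>) (affine_group \<Gamma>' \<Lambda>)"
    using s by (auto simp: hom_def algebra_simps)
  ultimately have "?\<theta> \<in> iso (affine_group \<Gamma> \<Lambda>) (affine_group \<Gamma>' \<Lambda>)"
    by (simp add: iso_def)
  moreover have "homeomorphic_maps (stein_space \<Gamma>') (stein_space \<Gamma>) (stein_action (0, s)) (stein_action (0, inverse s))"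
    by (rule stein_dilation_homeomorphic[OF B.dense A.dense s])
  then have "homeomorphic_map (stein_space \<Gamma>) (stein_space \<Gamma>') (stein_action (0, inverse s))"
    using homeomorphic_maps_map homeomorphic_maps_sym by blast
  moreover have "stein_action (0, inverse s) (stein_action g x) = stein_action (?\<theta> g) (stein_action (0, inverse s) x)" for g x
    by (cases g) (simp add: stein_action_action mult.commute)
  ultimately show ?thesis unfolding conjugate_actions_def by blast
qed

lemma groupoid_hom_transformation:
  assumes G: "group G" and H: "group H" and \<theta>: "\<theta> \<in> hom G H"
    and h: "h ` topspace X \<subseteq> topspace Y"
    and equi: "\<And>g x. g \<in> carrier G \<Longrightarrow> x \<in> topspace X \<Longrightarrow> h (act g x) = act' (\<theta> g) (h x)"
  shows "groupoid_hom (transformation_groupoid G X act) (transformation_groupoid H Y act') (\<lambda>(x, g). (h x, \<theta> g))"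
proof -
  interpret group_hom G H \<theta> using G H \<theta> by (simp add: group_hom_def group_hom_axioms_def)
  show ?thesis
    using h equi by (auto simp: groupoid_hom_def transformation_groupoid_def)
qed

lemma conjugate_imp_isomorphic:
  assumes G: "group G" and H: "group H"
    and act: "\<And>g x. g \<in> carrier G \<Longrightarrow> x \<in> topspace X \<Longrightarrow> act g x \<in> topspace X"
    and "conjugate_actions G X act H Y act'"
  shows "isomorphic_top_groupoids (transformation_groupoid G X act) (transformation_groupoid H Y act')"
proof -
  obtain \<theta> h where \<theta>: "\<theta> \<in> iso G H" and h: "homeomorphic_map X Y h"
    and equi: "\<And>g x. g \<in> carrier G \<Longrightarrow> x \<in> topspace X \<Longrightarrow> h (act g x) = act' (\<theta> g) (h x)"
    using assms(4) by (auto simp: conjugate_actions_def)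
  obtain k where k: "homeomorphic_maps X Y h k" using h homeomorphic_map_maps by blast
  define \<eta> where "\<eta> = inv_into (carrier G) \<theta>"
  have \<eta>: "\<eta> \<in> iso H G" unfolding \<eta>_def by (rule group.iso_set_sym[OF G \<theta>])
  have \<theta>_bij: "bij_betw \<theta> (carrier G) (carrier H)" using \<theta> by (simp add: iso_def)
  have \<theta>\<eta>: "\<theta> (\<eta> g) = g" "\<eta> g \<in> carrier G" if "g \<in> carrier H" for g
    using that \<theta>_bij unfolding \<eta>_def
    by (auto simp: bij_betw_inv_into_right bij_betw_def inv_into_into)
  have \<eta>\<theta>: "\<eta> (\<theta> g) = g" "\<theta> g \<in> carrier H" if "g \<in> carrier G" for g
    using that \<theta>_bij unfolding \<eta>_def by (auto simp: bij_betw_inv_into_left bij_betw_apply)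
  have hk: "h x \<in> topspace Y" "k (h x) = x" if "x \<in> topspace X" for x
    using that k continuous_map_funspace[of X Y h] by (auto simp: homeomorphic_maps_def)
  have kh: "k y \<in> topspace X" "h (k y) = y" if "y \<in> topspace Y" for y
    using that k continuous_map_funspace[of Y X k] by (auto simp: homeomorphic_maps_def)
  have equi': "k (act' g y) = act (\<eta> g) (k y)" if "g \<in> carrier H" "y \<in> topspace Y" for g y
    using equi[of "\<eta> g" "k y"] \<theta>\<eta>[OF that(1)] kh[OF that(2)] hk(2)[OF act[of "\<eta> g" "k y"]] by simp
  have "homeomorphic_maps (discrete_topology (carrier G)) (discrete_topology (carrier H)) \<theta> \<eta>"
    using \<theta>\<eta> \<eta>\<theta> by (auto simp: homeomorphic_maps_def)
  with k have "homeomorphic_maps (prod_topology X (discrete_topology (carrier G)))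
      (prod_topology Y (discrete_topology (carrier H))) (\<lambda>(x, g). (h x, \<theta> g)) (\<lambda>(y, g). (k y, \<eta> g))"
    by (simp add: homeomorphic_maps_prod)
  then have "homeomorphic_maps (arrows (transformation_groupoid G X act)) (arrows (transformation_groupoid H Y act'))
      (\<lambda>(x, g). (h x, \<theta> g)) (\<lambda>(y, g). (k y, \<eta> g))"
    by (simp add: transformation_groupoid_def)
  moreover have "groupoid_hom (transformation_groupoid G X act) (transformation_groupoid H Y act') (\<lambda>(x, g). (h x, \<theta> g))"
    using \<theta> hk equi by (intro groupoid_hom_transformation G H) (auto simp: iso_def)
  moreover have "groupoid_hom (transformation_groupoid H Y act') (transformation_groupoid G X act) (\<lambda>(y, g). (k y, \<eta> g))"
    using \<eta> kh equi' by (intro groupoid_hom_transformation G H) (auto simp: iso_def)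
  ultimately show ?thesis unfolding isomorphic_top_groupoids_def by blast
qed

theorem theorem5p8:
  fixes \<Lambda>\<^sub>1 \<Lambda>\<^sub>2 \<Gamma>\<^sub>1 \<Gamma>\<^sub>2 :: "real set"
  assumes "finitely_generated_subgroup \<Lambda>\<^sub>1 positive_reals"
    and "finitely_generated_subgroup \<Lambda>\<^sub>2 positive_reals"
    and "is_Z\<Lambda>_module \<Lambda>\<^sub>1 \<Gamma>\<^sub>1" and "is_Z\<Lambda>_module \<Lambda>\<^sub>2 \<Gamma>\<^sub>2"
    and "countable \<Gamma>\<^sub>1" and "countable \<Gamma>\<^sub>2"
    and "closure \<Gamma>\<^sub>1 = UNIV" and "closure \<Gamma>\<^sub>2 = UNIV"
    and "module_rank \<Gamma>\<^sub>1 \<ge> 2" and "module_rank \<Gamma>\<^sub>2 \<ge> 2"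
  shows "(isomorphic_top_groupoids (stein_groupoid \<Gamma>\<^sub>1 \<Lambda>\<^sub>1) (stein_groupoid \<Gamma>\<^sub>2 \<Lambda>\<^sub>2)
          \<longleftrightarrow> \<Lambda>\<^sub>1 = \<Lambda>\<^sub>2 \<and> (\<exists>s>0. \<Gamma>\<^sub>1 = (*) s ` \<Gamma>\<^sub>2))
       \<and> (\<Lambda>\<^sub>1 = \<Lambda>\<^sub>2 \<and> (\<exists>s>0. \<Gamma>\<^sub>1 = (*) s ` \<Gamma>\<^sub>2)
          \<longleftrightarrow> conjugate_actions
                (affine_group \<Gamma>\<^sub>1 \<Lambda>\<^sub>1) (stein_space \<Gamma>\<^sub>1) stein_action
                (affine_group \<Gamma>\<^sub>2 \<Lambda>\<^sub>2) (stein_space \<Gamma>\<^sub>2) stein_action)"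
proof -
  have S1: "stein_system \<Gamma>\<^sub>1 \<Lambda>\<^sub>1" and S2: "stein_system \<Gamma>\<^sub>2 \<Lambda>\<^sub>2"
    using assms by (auto simp: finitely_generated_subgroup_def intro!: stein_systemI)
  interpret A: stein_system \<Gamma>\<^sub>1 \<Lambda>\<^sub>1 by fact
  interpret B: stein_system \<Gamma>\<^sub>2 \<Lambda>\<^sub>2 by fact
  let ?iso = "isomorphic_top_groupoids (stein_groupoid \<Gamma>\<^sub>1 \<Lambda>\<^sub>1) (stein_groupoid \<Gamma>\<^sub>2 \<Lambda>\<^sub>2)"
  let ?sim = "\<Lambda>\<^sub>1 = \<Lambda>\<^sub>2 \<and> (\<exists>s>0. \<Gamma>\<^sub>1 = (*) s ` \<Gamma>\<^sub>2)"
  let ?conj = "conjugate_actions (affine_group \<Gamma>\<^sub>1 \<Lambda>\<^sub>1) (stein_space \<Gamma>\<^sub>1) stein_action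
                (affine_group \<Gamma>\<^sub>2 \<Lambda>\<^sub>2) (stein_space \<Gamma>\<^sub>2) stein_action"
  have "?iso \<Longrightarrow> ?sim"
  proof -
    assume ?iso
    then obtain h p C h' p' C' where "orbit_map \<Gamma>\<^sub>1 \<Lambda>\<^sub>1 \<Gamma>\<^sub>2 \<Lambda>\<^sub>2 h p C" "orbit_map \<Gamma>\<^sub>2 \<Lambda>\<^sub>2 \<Gamma>\<^sub>1 \<Lambda>\<^sub>1 h' p' C'"
      using isomorphic_top_groupoids_imp_orbit_map[OF S1 S2] by blast
    then show ?sim by (rule orbit_maps_imp_similar[OF S1 S2 assms(9,10)])
  qed
  moreover have "?sim \<Longrightarrow> ?conj"
    using similar_imp_conjugate S1 S2 by blast
  moreover have "?conj \<Longrightarrow> ?iso"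
    unfolding stein_groupoid_def
    by (rule conjugate_imp_isomorphic[OF A.group_affine_group B.group_affine_group]) auto
  ultimately show ?thesis by blast
qed

end
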